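(* Let $M$ be a smooth $n$-manifold, let $A\subset TM\setminus\mathbf 0$ be an open conic subset with $\pi(A)=M$, and let $\overset{o}{\nu}$ be a homogeneous nonlinear connection on $A\to M$. (1) Let $\nabla^*$ be a linear connection on the vector bundle $\mathcal VA\to A$. Its Christoffel symbols $H_{ij}^a,V_{ij}^a$ with respect to $\overset{o}{\nu}$ satisfy: (a) Under a change of coordinates $x\rightsquigarrow\bar x$ of $M$, the $H_{ij}^a$ transform as the Christoffel symbols of an $A$-anisotropic connection, $$\bar H_{ij}^a=\frac{\partial\bar x^a}{\partial x^m}\Big(\frac{\partial^2x^m}{\partial\bar x^i\partial\bar x^j}+\frac{\partial x^k}{\partial\bar x^i}\frac{\partial x^l}{\partial\bar x^j}H^m_{kl}\Big),$$ and the $V_{ij}^a$ transform as the components of an $A$-anisotropic $(1,2)$ tensor, $$\bar V_{ij}^a=\frac{\partial\bar x^a}{\partial x^m}\frac{\partial x^k}{\partial\bar x^i}\frac{\partial x^l}{\partial\bar x^j}V^m_{kl}.$$ In particular, if all the $V_{ij}^a$ vanish for some coordinates on $U$, then they vanish for any coordinates on $U$. (b) If $\nabla^*$ is invariant by homotheties, then for all $\lambda>0$: (b1) $H_{ij}^a(x,\lambda y)=H_{ij}^a(x,y)$, and (b2) $V_{ij}^a(x,\lambda y)=\lambda^{-1}V_{ij}^a(x,y)$. (2) Conversely, any choice, for each chart $(U,x)$ of a coordinate atlas of $M$, of functions $H_{ij}^a,V_{ij}^a$ on $A\cap TU$ satisfying the transformation rules in (a) determines a unique linear connection $\nabla^*$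 on $\mathcal VA\to A$ whose Christoffel symbols with respect to $\overset{o}{\nu}$ in that atlas are the given $H_{ij}^a,V_{ij}^a$. Moreover, if the chosen functions $H_{ij}^a$ are $0$-homogeneous in $y$ and the $V_{ij}^a$ are $(-1)$-homogeneous in $y$ (that is, (b1) and (b2) hold), then this $\nabla^*$ is invariant by homotheties.
   Context: All objects are smooth; repeated indices are summed. $\pi:TM\to M$ is the projection, $\pi_A=\pi|_A$; conic means invariant under $v\mapsto\lambda v$, $\lambda>0$. $(x,y)$ are the natural coordinates on $TU$ induced by a chart $(U,x)$ of $M$. Both sides of the transformation rules are evaluated at the same vector $v\in A$. **Nonlinear connection on $A\to M$.** $\mathcal VA=\ker T\pi_A\subset TA$ is the vertical bundle. A nonlinear connection $\overset{o}{\nu}$ is a smooth distribution $\overset{o}{\mathcal H}A$ with $TA=\overset{o}{\mathcal H}A\oplus\mathcal VA$, with components $\overset{o}{N}{}_i^a$ given by $\overset{o}{\mathcal H}_{(x,y)}A=\mathrm{Span}_i\{\delta_i|_{(x,y)}\}$, $\delta_i=\partial_{x^i}-\overset{o}{N}{}_i^a(x,y)\partial_{y^a}$. It is homogeneous if invariant under the homotheties $h_\lambda:A\to A$, $h_\lambda(v)=\lambda v$ ($\lambda>0$), i.e. $\overset{o}{N}{}_i^a(x,\lambda y)=\lambda\overset{o}{N}{}_i^a(x,y)$. Write $\dot\partial_i=\partial_{y^i}$. **Anisotropic vector fields.** $\mathcal T^1_0(M_A)$ denotes the sections over $A$ of $\pi_A^*(TM)$; these are identified with sections of $\mathcal VA\to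 A$ via $Z^i(x,y)\partial_{x^i}|_x\leftrightarrow Z^i(x,y)\partial_{y^i}|_{(x,y)}$, so $\partial_j$ is identified with $\dot\partial_j$. **Linear connections on $\mathcal VA\to A$.** A linear connection on the vector bundle $\mathcal VA\to A$ is identified with its Koszul derivative $\nabla^*:\mathfrak X(A)\times\mathcal T^1_0(M_A)\to\mathcal T^1_0(M_A)$. Its horizontal and vertical Christoffel symbols with respect to $\overset{o}{\nu}$ in the chart $(U,x)$ are the functions $H^a_{ij},V^a_{ij}$ on $A\cap TU$ with $$\nabla^*_{\delta_i}\partial_j=H^a_{ij}(x,y)\,\partial_a,\qquad \nabla^*_{\dot\partial_i}\partial_j=V^a_{ij}(x,y)\,\partial_a .$$ **Invariance by homotheties.** Let $h_{\lambda*}:\mathcal VA\to\mathcal VA$ be the restriction of $Th_\lambda$, i.e. $(x,y,z)\mapsto(x,\lambda y,\lambda z)$ where $(x,y,z)$ stands for $z^a\partial_{y^a}|_{(x,y)}$. The linear connection is invariant by homotheties if its horizontal distribution $\mathcal H\subset T(\mathcal VA)$ satisfies $(Th_{\lambda*})_{(x,y,z)}(\mathcal H_{(x,y,z)})=\mathcal H_{(x,\lambda y,\lambda z)}$ for all $\lambda>0$. Equivalently, for every section $Z^{\mathcal V}$ of $\mathcal VA\to A$ with $Z^{\mathcal V}\circ h_\lambda=\lambda^{-1}h_{\lambda*}\circ Z^{\mathcal V}$ for all $\lambda>0$ and every $W_{(x,y)}\in T_{(x,y)}A$, $$\nabla^*_{(Th_\lambda)_{(x,y)}(W_{(x,y)})}Z^{\mathcal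 V}=\lambda^{-1}(Th_\lambda)_{(x,y)}\big(\nabla^*_{W_{(x,y)}}Z^{\mathcal V}\big)\quad\text{for all }\lambda>0 .$$ *)

theory Defs
  imports "HOL-Analysis.Analysis"
begin

text \<open>
  These notions are meant for open \<open>S\<close>, where they are the usual classes of maps and
  do not depend on the values of \<open>f\<close> outside \<open>S\<close>.
\<close>

primrec Ck_on :: "nat \<Rightarrow> 'a::euclidean_space set \<Rightarrow> ('a \<Rightarrow> 'b::real_normed_vector) \<Rightarrow> bool" where
  "Ck_on 0 S f \<longleftrightarrow> continuous_on S f"
| "Ck_on (Suc k) S f \<longleftrightarrow>
     (\<forall>x\<in>S. f differentiable (at x)) \<and> (\<forall>v. Ck_on k S (\<lambda>x. frechet_derivative f (at x) v))"

definition smooth_on :: "'a::euclidean_space set \<Rightarrow> ('a \<Rightarrow> 'b::real_normed_vector) \<Rightarrow> bool" where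
  "smooth_on S f \<longleftrightarrow> (\<forall>k. Ck_on k S f)"

definition partial_deriv :: "'n::finite \<Rightarrow> (real^'n \<Rightarrow> real) \<Rightarrow> real^'n \<Rightarrow> real" where
  "partial_deriv i f x = frechet_derivative f (at x) (axis i 1)"

text \<open>
  A chart is a pair of its domain and its coordinate map; the values of the coordinate map outside
  the domain are irrelevant. The topology of a manifold is the one induced by its charts.
\<close>

type_synonym ('m, 'e) chart = "'m set \<times> ('m \<Rightarrow> 'e)"

definition chart_inv :: "('m, 'e) chart \<Rightarrow> 'e \<Rightarrow> 'm" where
  "chart_inv c = inv_into (fst c) (snd c)"

definition transition :: "('m, 'e) chart \<Rightarrow> ('m, 'f) chart \<Rightarrow> 'e \<Rightarrow> 'f" where
  "transition c d = snd d \<circ> chart_inv c"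

definition carrier :: "('m, 'e) chart set \<Rightarrow> 'm set" where
  "carrier C = (\<Union>c\<in>C. fst c)"

definition smooth_atlas :: "('m, 'e::euclidean_space) chart set \<Rightarrow> bool" where
  "smooth_atlas C \<longleftrightarrow>
     (\<forall>c\<in>C. inj_on (snd c) (fst c)) \<and>
     (\<forall>c\<in>C. \<forall>d\<in>C. open (snd c ` (fst c \<inter> fst d)) \<and>
        smooth_on (snd c ` (fst c \<inter> fst d)) (transition c d))"

definition atlas_topology :: "('m, 'e::euclidean_space) chart set \<Rightarrow> 'm topology" where
  "atlas_topology C =
     topology (\<lambda>W. W \<subseteq> carrier C \<and> (\<forall>c\<in>C. open (snd c ` (W \<inter> fst c))))"

definition smooth_manifold :: "('m, 'e::euclidean_space) chart set \<Rightarrow> bool" where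
  "smooth_manifold C \<longleftrightarrow>
     smooth_atlas C \<and>
     (\<forall>c. fst c \<subseteq> carrier C \<and> smooth_atlas (insert c C) \<longrightarrow> c \<in> C) \<and>
     Hausdorff_space (atlas_topology C) \<and>
     second_countable (atlas_topology C)"

definition restrict_atlas :: "('m, 'e) chart set \<Rightarrow> 'm set \<Rightarrow> ('m, 'e) chart set" where
  "restrict_atlas C W = (\<lambda>c. (fst c \<inter> W, snd c)) ` C"

definition smooth_map ::
    "('m, 'e::euclidean_space) chart set \<Rightarrow> ('p, 'f::euclidean_space) chart set \<Rightarrow> ('m \<Rightarrow> 'p) \<Rightarrow> bool" where
  "smooth_map C D f \<longleftrightarrow>
     f ` carrier C \<subseteq> carrier D \<and>
     (\<forall>c\<in>C. \<forall>d\<in>D. open (snd c ` (fst c \<inter> f -` fst d)) \<and>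
        smooth_on (snd c ` (fst c \<inter> f -` fst d)) (snd d \<circ> f \<circ> chart_inv c))"

definition smooth_fun_on :: "('m, 'e::euclidean_space) chart set \<Rightarrow> 'm set \<Rightarrow> ('m \<Rightarrow> real) \<Rightarrow> bool" where
  "smooth_fun_on C W f \<longleftrightarrow> (\<forall>c\<in>C. smooth_on (snd c ` (fst c \<inter> W)) (f \<circ> chart_inv c))"

definition chart_at :: "('m, 'e) chart set \<Rightarrow> 'm \<Rightarrow> ('m, 'e) chart" where
  "chart_at C p = (SOME c. c \<in> C \<and> p \<in> fst c)"

text \<open>
  A tangent vector is a base point together with its components in every chart around that point;
  the components in different charts are related by the derivative of the coordinate change.
\<close>

type_synonym ('m, 'e) tvec = "'m \<times> (('m, 'e) chart \<Rightarrow> 'e)"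

definition tangent_space :: "('m, 'e::euclidean_space) chart set \<Rightarrow> 'm \<Rightarrow> ('m, 'e) tvec set" where
  "tangent_space C p = {w. fst w = p \<and>
     (\<forall>c\<in>C. \<forall>d\<in>C. p \<in> fst c \<and> p \<in> fst d \<longrightarrow>
        snd w d = frechet_derivative (transition c d) (at (snd c p)) (snd w c)) \<and>
     (\<forall>c. \<not> (c \<in> C \<and> p \<in> fst c) \<longrightarrow> snd w c = 0)}"

definition tangent_bundle :: "('m, 'e::euclidean_space) chart set \<Rightarrow> ('m, 'e) tvec set" where
  "tangent_bundle C = (\<Union>p\<in>carrier C. tangent_space C p)"

definition natural_chart ::
    "('m, 'e::euclidean_space) chart set \<Rightarrow> ('m, 'e) chart \<Rightarrow> (('m, 'e) tvec, 'e \<times> 'e) chart" where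
  "natural_chart C c = ({w \<in> tangent_bundle C. fst w \<in> fst c}, \<lambda>w. (snd c (fst w), snd w c))"

definition tangent_atlas ::
    "('m, 'e::euclidean_space) chart set \<Rightarrow> (('m, 'e) tvec, 'e \<times> 'e) chart set" where
  "tangent_atlas C = natural_chart C ` C"

definition tzero :: "'m \<Rightarrow> ('m, 'e::euclidean_space) tvec" where
  "tzero p = (p, \<lambda>c. 0)"

definition tscale :: "real \<Rightarrow> ('m, 'e::euclidean_space) tvec \<Rightarrow> ('m, 'e) tvec" where
  "tscale r w = (fst w, \<lambda>c. r *\<^sub>R snd w c)"

definition tadd :: "('m, 'e::euclidean_space) tvec \<Rightarrow> ('m, 'e) tvec \<Rightarrow> ('m, 'e) tvec" where
  "tadd v w = (fst v, \<lambda>c. snd v c + snd w c)"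

definition tcomb :: "'m \<Rightarrow> 'i set \<Rightarrow> ('i \<Rightarrow> real) \<Rightarrow> ('i \<Rightarrow> ('m, 'e::euclidean_space) tvec) \<Rightarrow> ('m, 'e) tvec" where
  "tcomb p I r E = (p, \<lambda>c. \<Sum>i\<in>I. r i *\<^sub>R snd (E i) c)"

definition tspan :: "'m \<Rightarrow> 'i set \<Rightarrow> ('i \<Rightarrow> ('m, 'e::euclidean_space) tvec) \<Rightarrow> ('m, 'e) tvec set" where
  "tspan p I E = {tcomb p I r E | r. True}"

text \<open>The tangent vector at \<open>p\<close> whose components in the chart \<open>c\<close> are \<open>e\<close>.\<close>

definition coord_vec ::
    "('m, 'e::euclidean_space) chart set \<Rightarrow> ('m, 'e) chart \<Rightarrow> 'm \<Rightarrow> 'e \<Rightarrow> ('m, 'e) tvec" where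
  "coord_vec C c p e =
     (p, \<lambda>d. if d \<in> C \<and> p \<in> fst d then frechet_derivative (transition c d) (at (snd c p)) e else 0)"

definition tangent_map ::
    "('m, 'e::euclidean_space) chart set \<Rightarrow> ('p, 'f::euclidean_space) chart set \<Rightarrow> ('m \<Rightarrow> 'p)
      \<Rightarrow> ('m, 'e) tvec \<Rightarrow> ('p, 'f) tvec" where
  "tangent_map C D f w =
     (let p = fst w; c = chart_at C p; d = chart_at D (f p) in
        coord_vec D d (f p)
          (frechet_derivative (snd d \<circ> f \<circ> chart_inv c) (at (snd c p)) (snd w c)))"

definition dir_deriv :: "('m, 'e::euclidean_space) chart set \<Rightarrow> ('m, 'e) tvec \<Rightarrow> ('m \<Rightarrow> real) \<Rightarrow> real" where
  "dir_deriv C w f =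
     (let p = fst w; c = chart_at C p in
        frechet_derivative (f \<circ> chart_inv c) (at (snd c p)) (snd w c))"

definition vector_fields ::
    "('m, 'e::euclidean_space) chart set \<Rightarrow> 'm set \<Rightarrow> ('m \<Rightarrow> ('m, 'e) tvec) set" where
  "vector_fields C W =
     {X \<in> W \<rightarrow>\<^sub>E tangent_bundle C.
        (\<forall>p\<in>W. fst (X p) = p) \<and> smooth_map (restrict_atlas C W) (tangent_atlas C) X}"

definition smooth_distribution ::
    "('m, 'e::euclidean_space) chart set \<Rightarrow> nat \<Rightarrow> ('m \<Rightarrow> ('m, 'e) tvec set) \<Rightarrow> bool" where
  "smooth_distribution C k H \<longleftrightarrow>
     (\<forall>p\<in>carrier C. \<exists>W E. openin (atlas_topology C) W \<and> p \<in> W \<and>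
        (\<forall>i<k. E i \<in> vector_fields C W) \<and>
        (\<forall>q\<in>W. H q = tspan q {..<k} (\<lambda>i. E i q) \<and>
          (\<forall>r. tcomb q {..<k} r (\<lambda>i. E i q) = tzero q \<longrightarrow> (\<forall>i<k. r i = 0))))"

text \<open>
  From here on \<open>C\<close> is the maximal atlas of \<open>M\<close> and \<open>A\<close> is an open subset of \<open>TM\<close>, which is
  a manifold with the atlas of natural coordinates.
\<close>

type_synonym ('m, 'e) ttvec = "(('m, 'e) tvec, 'e \<times> 'e) tvec"

definition conic_domain :: "('m, 'e::euclidean_space) chart set \<Rightarrow> ('m, 'e) tvec set \<Rightarrow> bool" where
  "conic_domain C A \<longleftrightarrow>
     openin (atlas_topology (tangent_atlas C)) A \<and>
     (\<forall>v\<in>A. v \<noteq> tzero (fst v)) \<and>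
     (\<forall>v\<in>A. \<forall>l>0. tscale l v \<in> A) \<and>
     fst ` A = carrier C"

definition domain_atlas ::
    "('m, 'e::euclidean_space) chart set \<Rightarrow> ('m, 'e) tvec set \<Rightarrow> (('m, 'e) tvec, 'e \<times> 'e) chart set" where
  "domain_atlas C A = restrict_atlas (tangent_atlas C) A"

definition domain_chart ::
    "('m, 'e::euclidean_space) chart set \<Rightarrow> ('m, 'e) tvec set \<Rightarrow> ('m, 'e) chart
      \<Rightarrow> (('m, 'e) tvec, 'e \<times> 'e) chart" where
  "domain_chart C A c = (fst (natural_chart C c) \<inter> A, snd (natural_chart C c))"

definition vertical_space ::
    "('m, 'e::euclidean_space) chart set \<Rightarrow> ('m, 'e) tvec set \<Rightarrow> ('m, 'e) tvec \<Rightarrow> ('m, 'e) ttvec set" where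
  "vertical_space C A v =
     {w \<in> tangent_space (domain_atlas C A) v. tangent_map (domain_atlas C A) C fst w = tzero (fst v)}"

definition nonlinear_connection ::
    "('m, real^'n) chart set \<Rightarrow> ('m, real^'n) tvec set
      \<Rightarrow> (('m, real^'n) tvec \<Rightarrow> ('m, real^'n) ttvec set) \<Rightarrow> bool" where
  "nonlinear_connection C A HA \<longleftrightarrow>
     smooth_distribution (domain_atlas C A) CARD('n) HA \<and>
     (\<forall>v\<in>A. \<forall>w\<in>tangent_space (domain_atlas C A) v.
        \<exists>!hu. hu \<in> HA v \<times> vertical_space C A v \<and> w = tadd (fst hu) (snd hu))"

definition homogeneous_nonlinear_connection ::
    "('m, real^'n) chart set \<Rightarrow> ('m, real^'n) tvec set
      \<Rightarrow> (('m, real^'n) tvec \<Rightarrow> ('m, real^'n) ttvec set) \<Rightarrow> bool" where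
  "homogeneous_nonlinear_connection C A HA \<longleftrightarrow>
     nonlinear_connection C A HA \<and>
     (\<forall>l>0. \<forall>v\<in>A. tangent_map (domain_atlas C A) (domain_atlas C A) (tscale l) ` HA v = HA (tscale l v))"

definition dx_vec ::
    "('m, real^'n) chart set \<Rightarrow> ('m, real^'n) tvec set \<Rightarrow> ('m, real^'n) chart \<Rightarrow> 'n
      \<Rightarrow> ('m, real^'n) tvec \<Rightarrow> ('m, real^'n) ttvec" where
  "dx_vec C A c i v = coord_vec (domain_atlas C A) (domain_chart C A c) v (axis i 1, 0)"

definition dy_vec ::
    "('m, real^'n) chart set \<Rightarrow> ('m, real^'n) tvec set \<Rightarrow> ('m, real^'n) chart \<Rightarrow> 'n
      \<Rightarrow> ('m, real^'n) tvec \<Rightarrow> ('m, real^'n) ttvec" where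
  "dy_vec C A c i v = coord_vec (domain_atlas C A) (domain_chart C A c) v (0, axis i 1)"

text \<open>\<open>N $ a $ i\<close> is the component with upper index \<open>a\<close> and lower index \<open>i\<close>.\<close>

definition delta_of ::
    "('m, real^'n) chart set \<Rightarrow> ('m, real^'n) tvec set \<Rightarrow> ('m, real^'n) chart \<Rightarrow> real^'n^'n
      \<Rightarrow> 'n \<Rightarrow> ('m, real^'n) tvec \<Rightarrow> ('m, real^'n) ttvec" where
  "delta_of C A c N i v =
     tadd (dx_vec C A c i v) (tscale (- 1) (tcomb v UNIV (\<lambda>a. N $ a $ i) (\<lambda>a. dy_vec C A c a v)))"

definition nonlinear_components ::
    "('m, real^'n) chart set \<Rightarrow> ('m, real^'n) tvec set
      \<Rightarrow> (('m, real^'n) tvec \<Rightarrow> ('m, real^'n) ttvec set)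
      \<Rightarrow> ('m, real^'n) chart \<Rightarrow> ('m, real^'n) tvec \<Rightarrow> real^'n^'n" where
  "nonlinear_components C A HA c v = (THE N. HA v = tspan v UNIV (\<lambda>i. delta_of C A c N i v))"

definition delta_vec ::
    "('m, real^'n) chart set \<Rightarrow> ('m, real^'n) tvec set
      \<Rightarrow> (('m, real^'n) tvec \<Rightarrow> ('m, real^'n) ttvec set)
      \<Rightarrow> ('m, real^'n) chart \<Rightarrow> 'n \<Rightarrow> ('m, real^'n) tvec \<Rightarrow> ('m, real^'n) ttvec" where
  "delta_vec C A HA c i v = delta_of C A c (nonlinear_components C A HA c v) i v"

definition anisotropic_fields ::
    "('m, 'e::euclidean_space) chart set \<Rightarrow> ('m, 'e) tvec set
      \<Rightarrow> (('m, 'e) tvec \<Rightarrow> ('m, 'e) tvec) set" where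
  "anisotropic_fields C A =
     {Z \<in> A \<rightarrow>\<^sub>E tangent_bundle C.
        (\<forall>v\<in>A. fst (Z v) = fst v) \<and> smooth_map (domain_atlas C A) (tangent_atlas C) Z}"

text \<open>
  A linear connection is its Koszul derivative on global sections. Sections are extensional on
  \<open>A\<close> and the derivative is extensional in both arguments, so that equality of HOL functions is
  equality of connections. Real linearity in the second argument is the case of constant \<open>f\<close> in
  the Leibniz rule.
\<close>

type_synonym ('m, 'e) koszul =
  "(('m, 'e) tvec \<Rightarrow> ('m, 'e) ttvec) \<Rightarrow> (('m, 'e) tvec \<Rightarrow> ('m, 'e) tvec) \<Rightarrow> (('m, 'e) tvec \<Rightarrow> ('m, 'e) tvec)"

definition linear_connection ::
    "('m, 'e::euclidean_space) chart set \<Rightarrow> ('m, 'e) tvec set \<Rightarrow> ('m, 'e) koszul \<Rightarrow> bool" where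
  "linear_connection C A nabla \<longleftrightarrow>
     nabla \<in> vector_fields (domain_atlas C A) A \<rightarrow>\<^sub>E (anisotropic_fields C A \<rightarrow>\<^sub>E anisotropic_fields C A) \<and>
     (\<forall>X\<in>vector_fields (domain_atlas C A) A. \<forall>Y\<in>vector_fields (domain_atlas C A) A.
        \<forall>Z\<in>anisotropic_fields C A. \<forall>v\<in>A.
          nabla (\<lambda>u\<in>A. tadd (X u) (Y u)) Z v = tadd (nabla X Z v) (nabla Y Z v)) \<and>
     (\<forall>f. smooth_fun_on (domain_atlas C A) A f \<longrightarrow>
        (\<forall>X\<in>vector_fields (domain_atlas C A) A. \<forall>Z\<in>anisotropic_fields C A. \<forall>v\<in>A.
          nabla (\<lambda>u\<in>A. tscale (f u) (X u)) Z v = tscale (f v) (nabla X Z v))) \<and>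
     (\<forall>X\<in>vector_fields (domain_atlas C A) A.
        \<forall>Y\<in>anisotropic_fields C A. \<forall>Z\<in>anisotropic_fields C A. \<forall>v\<in>A.
          nabla X (\<lambda>u\<in>A. tadd (Y u) (Z u)) v = tadd (nabla X Y v) (nabla X Z v)) \<and>
     (\<forall>f. smooth_fun_on (domain_atlas C A) A f \<longrightarrow>
        (\<forall>X\<in>vector_fields (domain_atlas C A) A. \<forall>Z\<in>anisotropic_fields C A. \<forall>v\<in>A.
          nabla X (\<lambda>u\<in>A. tscale (f u) (Z u)) v =
            tadd (tscale (dir_deriv (domain_atlas C A) (X v) f) (Z v)) (tscale (f v) (nabla X Z v))))"

text \<open>
  The derivative, in the direction of a single tangent vector \<open>w\<close> of \<open>A\<close>, of a section \<open>Z\<close> that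
  need only be defined near the base point of \<open>w\<close>.
\<close>

definition koszul_at ::
    "('m, 'e::euclidean_space) chart set \<Rightarrow> ('m, 'e) tvec set \<Rightarrow> ('m, 'e) koszul
      \<Rightarrow> ('m, 'e) ttvec \<Rightarrow> (('m, 'e) tvec \<Rightarrow> ('m, 'e) tvec) \<Rightarrow> ('m, 'e) tvec" where
  "koszul_at C A nabla w Z = (THE z.
     \<exists>X\<in>vector_fields (domain_atlas C A) A. \<exists>Z'\<in>anisotropic_fields C A.
       X (fst w) = w \<and>
       (\<exists>W. openin (atlas_topology (domain_atlas C A)) W \<and> fst w \<in> W \<and> (\<forall>u\<in>W. Z' u = Z u)) \<and>
       z = nabla X Z' (fst w))"

definition coord_field ::
    "('m, real^'n) chart set \<Rightarrow> ('m, real^'n) chart \<Rightarrow> 'n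
      \<Rightarrow> ('m, real^'n) tvec \<Rightarrow> ('m, real^'n) tvec" where
  "coord_field C c j v = coord_vec C c (fst v) (axis j 1)"

text \<open>
  Symbols take their indices in the order upper index, then the two lower indices, followed by
  the vector at which they are evaluated.
\<close>

type_synonym ('m, 'n) symbols = "'n \<Rightarrow> 'n \<Rightarrow> 'n \<Rightarrow> ('m, real^'n) tvec \<Rightarrow> real"

definition christoffel_H ::
    "('m, real^'n) chart set \<Rightarrow> ('m, real^'n) tvec set
      \<Rightarrow> (('m, real^'n) tvec \<Rightarrow> ('m, real^'n) ttvec set) \<Rightarrow> ('m, real^'n) koszul
      \<Rightarrow> ('m, real^'n) chart \<Rightarrow> ('m, 'n::finite) symbols" where
  "christoffel_H C A HA nabla c a i j v =
     snd (koszul_at C A nabla (delta_vec C A HA c i v) (coord_field C c j)) c $ a"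

definition christoffel_V ::
    "('m, real^'n) chart set \<Rightarrow> ('m, real^'n) tvec set \<Rightarrow> ('m, real^'n) koszul
      \<Rightarrow> ('m, real^'n) chart \<Rightarrow> ('m, 'n::finite) symbols" where
  "christoffel_V C A nabla c a i j v =
     snd (koszul_at C A nabla (dy_vec C A c i v) (coord_field C c j)) c $ a"

text \<open>
  In the transformation rules the chart \<open>c\<close> carries the coordinates \<open>x\<close> and \<open>d\<close> carries the
  barred ones.
\<close>

definition coord_jacobian ::
    "('m, real^'n) chart \<Rightarrow> ('m, real^'n) chart \<Rightarrow> 'n \<Rightarrow> 'n::finite \<Rightarrow> 'm \<Rightarrow> real" where
  "coord_jacobian c d a m p = partial_deriv m (\<lambda>x. transition c d x $ a) (snd c p)"

definition coord_hessian ::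
    "('m, real^'n) chart \<Rightarrow> ('m, real^'n) chart \<Rightarrow> 'n \<Rightarrow> 'n \<Rightarrow> 'n::finite \<Rightarrow> 'm \<Rightarrow> real" where
  "coord_hessian c d a i j p =
     partial_deriv i (partial_deriv j (\<lambda>x. transition c d x $ a)) (snd c p)"

definition connection_rule ::
    "('m, real^'n) chart \<Rightarrow> ('m, real^'n) chart \<Rightarrow> ('m, 'n::finite) symbols \<Rightarrow> ('m, 'n) symbols
      \<Rightarrow> ('m, real^'n) tvec \<Rightarrow> bool" where
  "connection_rule c d H Hbar v \<longleftrightarrow>
     (\<forall>a i j. Hbar a i j v =
        (\<Sum>m\<in>UNIV. coord_jacobian c d a m (fst v) *
          (coord_hessian d c m i j (fst v) +
           (\<Sum>k\<in>UNIV. \<Sum>l\<in>UNIV.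
              coord_jacobian d c k i (fst v) * coord_jacobian d c l j (fst v) * H m k l v))))"

definition tensor_rule ::
    "('m, real^'n) chart \<Rightarrow> ('m, real^'n) chart \<Rightarrow> ('m, 'n::finite) symbols \<Rightarrow> ('m, 'n) symbols
      \<Rightarrow> ('m, real^'n) tvec \<Rightarrow> bool" where
  "tensor_rule c d V Vbar v \<longleftrightarrow>
     (\<forall>a i j. Vbar a i j v =
        (\<Sum>m\<in>UNIV. \<Sum>k\<in>UNIV. \<Sum>l\<in>UNIV.
           coord_jacobian c d a m (fst v) *
           coord_jacobian d c k i (fst v) * coord_jacobian d c l j (fst v) * V m k l v))"

definition vertical_bundle ::
    "('m, 'e::euclidean_space) chart set \<Rightarrow> ('m, 'e) tvec set \<Rightarrow> ('m, 'e) ttvec set" where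
  "vertical_bundle C A = (\<Union>v\<in>A. vertical_space C A v)"

text \<open>
  The coordinates \<open>((x, y), z)\<close>: in the natural chart of \<open>A\<close> a vertical vector has components
  \<open>(0, z)\<close>.
\<close>

definition vertical_chart ::
    "('m, 'e::euclidean_space) chart set \<Rightarrow> ('m, 'e) tvec set \<Rightarrow> ('m, 'e) chart
      \<Rightarrow> (('m, 'e) ttvec, ('e \<times> 'e) \<times> 'e) chart" where
  "vertical_chart C A c =
     ({w \<in> vertical_bundle C A. fst w \<in> fst (domain_chart C A c)},
      \<lambda>w. (snd (domain_chart C A c) (fst w), snd (snd w (domain_chart C A c))))"

definition vertical_atlas ::
    "('m, 'e::euclidean_space) chart set \<Rightarrow> ('m, 'e) tvec set
      \<Rightarrow> (('m, 'e) ttvec, ('e \<times> 'e) \<times> 'e) chart set" where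
  "vertical_atlas C A = vertical_chart C A ` C"

text \<open>The identification of the pullback of \<open>TM\<close> to \<open>A\<close> with the vertical bundle.\<close>

definition vertical_lift ::
    "('m, 'e::euclidean_space) chart set \<Rightarrow> ('m, 'e) tvec set
      \<Rightarrow> ('m, 'e) tvec \<Rightarrow> ('m, 'e) tvec \<Rightarrow> ('m, 'e) ttvec" where
  "vertical_lift C A v z =
     (let c = chart_at C (fst v) in
        coord_vec (domain_atlas C A) (domain_chart C A c) v (0, snd z c))"

text \<open>
  The horizontal space at \<open>e\<close> consists of the velocities of the sections through \<open>e\<close> in those
  directions in which their covariant derivative vanishes.
\<close>

definition horizontal_distribution ::
    "('m, 'e::euclidean_space) chart set \<Rightarrow> ('m, 'e) tvec set \<Rightarrow> ('m, 'e) koszul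
      \<Rightarrow> ('m, 'e) ttvec \<Rightarrow> (('m, 'e) ttvec, ('e \<times> 'e) \<times> 'e) tvec set" where
  "horizontal_distribution C A nabla e =
     {tangent_map (domain_atlas C A) (vertical_atlas C A) (\<lambda>v. vertical_lift C A v (Z v)) w | Z w.
        Z \<in> anisotropic_fields C A \<and> w \<in> tangent_space (domain_atlas C A) (fst e) \<and>
        vertical_lift C A (fst e) (Z (fst e)) = e \<and>
        koszul_at C A nabla w Z = tzero (fst (fst e))}"

definition vertical_homothety ::
    "('m, 'e::euclidean_space) chart set \<Rightarrow> ('m, 'e) tvec set \<Rightarrow> real
      \<Rightarrow> ('m, 'e) ttvec \<Rightarrow> ('m, 'e) ttvec" where
  "vertical_homothety C A l = tangent_map (domain_atlas C A) (domain_atlas C A) (tscale l)"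

definition homothety_invariant ::
    "('m, 'e::euclidean_space) chart set \<Rightarrow> ('m, 'e) tvec set \<Rightarrow> ('m, 'e) koszul \<Rightarrow> bool" where
  "homothety_invariant C A nabla \<longleftrightarrow>
     (\<forall>l>0. \<forall>e\<in>vertical_bundle C A.
        tangent_map (vertical_atlas C A) (vertical_atlas C A) (vertical_homothety C A l)
            ` horizontal_distribution C A nabla e
          = horizontal_distribution C A nabla (vertical_homothety C A l e))"

end

theory Submission
  imports Defs
begin

text \<open>
  Fix a chart \<open>c\<close> with coordinates \<open>x\<close>, a direction \<open>v = (x, y)\<close> in \<open>A\<close> and a tangent vector
  \<open>w\<close> of \<open>A\<close> at \<open>v\<close>. The nonlinear connection splits \<open>w\<close> into \<open>a\<^sup>i \<delta>\<^sub>i\<close> and a vertical vector with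
  fibre components \<open>\<eta>\<close>. A linear connection on the vertical bundle is given near \<open>v\<close> by

    \<open>(\<nabla>\<^sub>w Z)\<^sup>c = w (Z\<^sup>c) + H (a, Z\<^sup>c) + V (\<eta>, Z\<^sup>c)\<close>,

  where \<open>Z\<^sup>c\<close> are the components of the section \<open>Z\<close>, and \<open>H\<close>, \<open>V\<close> are the bilinear maps whose
  coefficients are the Christoffel symbols. Everything follows from this formula.

  The formula itself (\<open>nabla_coordinates\<close>, \<open>koszul_at_cov\<close>) is locality of a connection, which is
  an operator on global sections. Locality rests on bump functions, and these exist because \<open>M\<close> is
  Hausdorff. For the same reason the derivative of a section that is only defined near \<open>v\<close> in the
  direction of a single tangent vector is well defined (\<open>koszul_at_eq\<close>).

  Transformation rules. If \<open>K\<close> is the Jacobian of the coordinate change from a chart \<open>d\<close> to \<open>c\<close>, then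
  \<open>Z\<^sup>c = K Z\<^sup>d\<close>, and \<open>K\<close> depends on the base point, so
  \<open>w (Z\<^sup>c) = K (w (Z\<^sup>d)) + S (a, Z\<^sup>d)\<close> with the second derivative \<open>S\<close> of the coordinate change
  (\<open>vdd_change\<close>). Both \<open>a\<close> and \<open>\<eta>\<close> transform by the Jacobian, \<open>\<eta>\<close> because the horizontal
  spaces do not depend on charts (\<open>eta_change\<close>). So the right-hand side above transforms like a tangent
  vector of \<open>M\<close> if and only if \<open>H\<close> absorbs \<open>S\<close> and \<open>V\<close> is a tensor. One direction is
  \<open>christoffel_rules\<close>; the other (\<open>cov_change\<close>) says that the formula, applied to given symbols,
  defines a connection independently of the chart. It preserves smoothness because the components \<open>N\<close>
  of the nonlinear connection are smooth (\<open>local_matrix\<close>), and by the formula it is the only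
  connection with these symbols.

  Homotheties. A section is parallel in the direction \<open>w\<close> at \<open>v\<close> exactly if \<open>w (Z\<^sup>c)\<close> is
  minus the connection form \<open>\<Gamma>\<^sub>v (w, z) = H (a, z) + V (\<eta>, z)\<close>, where \<open>z\<close> is the value of \<open>Z\<close>
  at \<open>v\<close>. So the horizontal space at \<open>z\<close> is the graph of \<open>w \<mapsto> - \<Gamma>\<^sub>v (w, z)\<close>
  (\<open>horizontal_iff\<close>). The tangent map of the homothety \<open>h\<close> by \<open>l\<close> takes the graph at \<open>z\<close> to the graph
  at \<open>l z\<close> if and only if \<open>\<Gamma>\<^sub>v (w, z) = \<Gamma>\<^sub>l\<^sub>v (Th w, z)\<close> (\<open>homothety_horizontal_iff\<close>).
  Since \<open>N\<close> is positively homogeneous of degree \<open>1\<close>, \<open>Th\<close> fixes \<open>a\<close> and multiplies \<open>\<eta>\<close> by \<open>l\<close>; comparing coefficients shows that this is the homogeneity of degree \<open>0\<close> of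
  \<open>H\<close> and of degree \<open>- 1\<close> of \<open>V\<close> (\<open>homogeneous_form_iff\<close>).
\<close>

section \<open>Smooth functions on open subsets of Euclidean spaces\<close>

lemma Ck_on_SucD:
  assumes "Ck_on (Suc k) S f" "x \<in> S"
  shows "(f has_derivative frechet_derivative f (at x)) (at x)"
  using assms by (simp add: frechet_derivative_works)

lemma Ck_on_cong_imp:
  assumes "open S" "\<forall>x\<in>S. f x = g x" "Ck_on k S f"
  shows "Ck_on k S g"
  using assms
proof (induction k arbitrary: f g)
  case 0
  then show ?case by (auto cong: continuous_on_cong)
next
  case (Suc k)
  have d: "(g has_derivative frechet_derivative f (at x)) (at x)" if x: "x \<in> S" for x
    using has_derivative_transform_within_open[OF Ck_on_SucD[OF Suc.prems(3) x] Suc.prems(1) x]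
      Suc.prems(2) by auto
  then have "frechet_derivative f (at x) = frechet_derivative g (at x)" if "x \<in> S" for x
    using that frechet_derivative_at by blast
  then have "Ck_on k S (\<lambda>x. frechet_derivative g (at x) v)" for v
    using Suc.IH[OF Suc.prems(1), of "\<lambda>x. frechet_derivative f (at x) v"] Suc.prems(3) by simp
  then show ?case using d by (auto intro: differentiableI)
qed

lemma Ck_on_SucI:
  assumes "open S" "\<And>x. x \<in> S \<Longrightarrow> (f has_derivative F x) (at x)" "\<And>v. Ck_on k S (\<lambda>x. F x v)"
  shows "Ck_on (Suc k) S f"
proof -
  have "F x = frechet_derivative f (at x)" if "x \<in> S" for x
    using assms(2)[OF that] frechet_derivative_at by blast
  then have "Ck_on k S (\<lambda>x. frechet_derivative f (at x) v)" for v
    using Ck_on_cong_imp[OF assms(1) _ assms(3)[of v]] by simp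
  then show ?thesis
    using assms(2) by (auto intro: differentiableI)
qed

lemma smooth_on_cong:
  assumes "open S" "\<And>x. x \<in> S \<Longrightarrow> f x = g x"
  shows "smooth_on S f \<longleftrightarrow> smooth_on S g"
  unfolding smooth_on_def using assms Ck_on_cong_imp by metis

lemma Ck_on_subset: "Ck_on k S f \<Longrightarrow> T \<subseteq> S \<Longrightarrow> Ck_on k T f"
  by (induction k arbitrary: f) (auto intro: continuous_on_subset)

lemma smooth_on_subset: "smooth_on S f \<Longrightarrow> T \<subseteq> S \<Longrightarrow> smooth_on T f"
  unfolding smooth_on_def using Ck_on_subset by blast

lemma Ck_on_Suc_imp: "Ck_on (Suc k) S f \<Longrightarrow> Ck_on k S f"
proof (induction k arbitrary: f)
  case 0
  then show ?case
    by (auto intro!: continuous_at_imp_continuous_on differentiable_imp_continuous_within)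
qed auto

lemma Ck_on_local:
  assumes "\<And>x. x \<in> S \<Longrightarrow> \<exists>T. open T \<and> x \<in> T \<and> Ck_on k T f"
  shows "Ck_on k S f"
  using assms
proof (induction k arbitrary: f)
  case 0
  then show ?case
    by (auto intro!: continuous_at_imp_continuous_on simp: continuous_on_eq_continuous_at) 
      (metis continuous_on_eq_continuous_at)
next
  case (Suc k)
  have "Ck_on k S (\<lambda>x. frechet_derivative f (at x) v)" for v
    using Suc.prems by (intro Suc.IH) fastforce
  moreover have "f differentiable (at x)" if "x \<in> S" for x
    using Suc.prems[OF that] by auto
  ultimately show ?case by simp
qed

lemma smooth_on_differentiable: "smooth_on S f \<Longrightarrow> x \<in> S \<Longrightarrow> f differentiable (at x)"
  unfolding smooth_on_def by (drule spec[of _ 1]) simp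

lemma smooth_on_has_derivative:
  "smooth_on S f \<Longrightarrow> x \<in> S \<Longrightarrow> (f has_derivative frechet_derivative f (at x)) (at x)"
  using smooth_on_differentiable frechet_derivative_works by blast

lemma smooth_on_derivative:
  "smooth_on S f \<Longrightarrow> smooth_on S (\<lambda>x. frechet_derivative f (at x) v)"
  unfolding smooth_on_def by (metis Ck_on.simps(2))

lemma smooth_on_continuous: "smooth_on S f \<Longrightarrow> continuous_on S f"
  unfolding smooth_on_def by (drule spec[of _ 0]) simp

lemma smooth_on_local:
  assumes "\<And>x. x \<in> S \<Longrightarrow> \<exists>T. open T \<and> x \<in> T \<and> smooth_on T f"
  shows "smooth_on S f"
  unfolding smooth_on_def
proof
  show "Ck_on k S f" for k
    by (rule Ck_on_local) (use assms smooth_on_def in blast)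
qed

lemma Ck_on_const: "Ck_on k S (\<lambda>x. c)"
proof (induction k arbitrary: c)
  case (Suc k)
  then show ?case by (simp add: frechet_derivative_const)
qed simp

lemma smooth_on_const [intro]: "smooth_on S (\<lambda>x. c)"
  unfolding smooth_on_def using Ck_on_const by blast

lemma smooth_on_linear:
  assumes "bounded_linear f" "open S"
  shows "smooth_on S f"
  unfolding smooth_on_def
proof
  show "Ck_on k S f" for k
  proof (cases k)
    case 0
    then show ?thesis using assms linear_continuous_on by auto
  next
    case (Suc m)
    then show ?thesis
      using Ck_on_SucI[OF assms(2), of f "\<lambda>_. f" m] assms(1)
      by (simp add: bounded_linear_imp_has_derivative Ck_on_const)
  qed
qed

lemma Ck_on_add:
  assumes "open S" "Ck_on k S f" "Ck_on k S g"
  shows "Ck_on k S (\<lambda>x. f x + g x)"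
  using assms
proof (induction k arbitrary: f g)
  case 0
  then show ?case by (auto intro: continuous_on_add)
next
  case (Suc k)
  show ?case
    by (rule Ck_on_SucI[OF Suc.prems(1)
          has_derivative_add[OF Ck_on_SucD[OF Suc.prems(2)] Ck_on_SucD[OF Suc.prems(3)]]])
      (use Suc in auto)
qed

text \<open>
  By the product rule the derivative of \<open>B f g\<close> is \<open>B f g' + B f' g\<close>, a sum of products whose factors
  have one degree of smoothness less than \<open>f\<close> and \<open>g\<close>; so induction on the degree applies.
\<close>

lemma Ck_on_bilinear:
  assumes B: "bounded_bilinear B" and "open S" "Ck_on k S f" "Ck_on k S g"
  shows "Ck_on k S (\<lambda>x. B (f x) (g x))"
  using assms(2-)
proof (induction k arbitrary: f g)
  case 0
  then show ?case using bounded_bilinear.continuous_on[OF B] by auto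
next
  case (Suc k)
  show ?case
  proof (rule Ck_on_SucI[OF Suc.prems(1)
        bounded_bilinear.FDERIV[OF B Ck_on_SucD[OF Suc.prems(2)] Ck_on_SucD[OF Suc.prems(3)]]])
    show "Ck_on k S (\<lambda>x. B (f x) (frechet_derivative g (at x) v) +
        B (frechet_derivative f (at x) v) (g x))" for v
      using Suc Ck_on_Suc_imp[OF Suc.prems(2)] Ck_on_Suc_imp[OF Suc.prems(3)]
      by (intro Ck_on_add Suc.IH) auto
  qed auto
qed

lemma smooth_on_bilinear:
  "bounded_bilinear B \<Longrightarrow> open S \<Longrightarrow> smooth_on S f \<Longrightarrow> smooth_on S g
    \<Longrightarrow> smooth_on S (\<lambda>x. B (f x) (g x))"
  unfolding smooth_on_def using Ck_on_bilinear by blast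

lemma smooth_on_add: "open S \<Longrightarrow> smooth_on S f \<Longrightarrow> smooth_on S g \<Longrightarrow> smooth_on S (\<lambda>x. f x + g x)"
  unfolding smooth_on_def using Ck_on_add by blast

lemma smooth_on_sum:
  "open S \<Longrightarrow> (\<And>i. i \<in> I \<Longrightarrow> smooth_on S (f i)) \<Longrightarrow> smooth_on S (\<lambda>x. \<Sum>i\<in>I. f i x)"
  by (induction I rule: infinite_finite_induct) (auto intro: smooth_on_add)

lemma Ck_on_sum:
  "open S \<Longrightarrow> (\<And>i. i \<in> I \<Longrightarrow> Ck_on k S (f i)) \<Longrightarrow> Ck_on k S (\<lambda>x. \<Sum>i\<in>I. f i x)"
  by (induction I rule: infinite_finite_induct) (auto intro: Ck_on_add Ck_on_const)

lemma linear_Basis_expansion: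
  fixes f :: "'a::euclidean_space \<Rightarrow> 'b::real_vector"
  assumes "linear f"
  shows "f v = (\<Sum>b\<in>Basis. (v \<bullet> b) *\<^sub>R f b)"
proof -
  have "f v = f (\<Sum>b\<in>Basis. (v \<bullet> b) *\<^sub>R b)" by (simp add: euclidean_representation)
  also have "\<dots> = (\<Sum>b\<in>Basis. (v \<bullet> b) *\<^sub>R f b)"
    by (simp add: linear_sum[OF assms] linear_scale[OF assms])
  finally show ?thesis .
qed

text \<open>
  Expanding \<open>g'\<close> in a basis turns the chain rule into a sum of products of partial derivatives of
  \<open>f\<close>, composed with \<open>g\<close>, and components of \<open>g'\<close>; the former are smooth by induction.
\<close>

lemma Ck_on_compose:
  fixes g :: "'a::euclidean_space \<Rightarrow> 'b::euclidean_space" and f :: "'b \<Rightarrow> 'c::real_normed_vector"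
  assumes "open S" "open T" "g ` S \<subseteq> T" "Ck_on k S g" "Ck_on k T f"
  shows "Ck_on k S (\<lambda>x. f (g x))"
  using assms
proof (induction k arbitrary: f)
  case 0
  then show ?case using continuous_on_compose2 by auto
next
  case (Suc k)
  let ?F = "\<lambda>x. frechet_derivative f (at x)" and ?G = "\<lambda>x. frechet_derivative g (at x)"
  have gS: "g x \<in> T" if "x \<in> S" for x using that Suc.prems(3) by blast
  have d: "((\<lambda>x. f (g x)) has_derivative (\<lambda>v. \<Sum>b\<in>Basis. (?G x v \<bullet> b) *\<^sub>R ?F (g x) b)) (at x)"
    if x: "x \<in> S" for x
  proof -
    have f: "(f has_derivative ?F (g x)) (at (g x))"
      using Ck_on_SucD[OF Suc.prems(5)] gS[OF x] by blast
    have "((\<lambda>x. f (g x)) has_derivative (\<lambda>v. ?F (g x) (?G x v))) (at x)"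
      using has_derivative_compose[OF Ck_on_SucD[OF Suc.prems(4) x] f] .
    moreover have "?F (g x) (?G x v) = (\<Sum>b\<in>Basis. (?G x v \<bullet> b) *\<^sub>R ?F (g x) b)" for v
      using linear_Basis_expansion has_derivative_linear[OF f] by blast
    ultimately show ?thesis by simp
  qed
  show ?case
  proof (rule Ck_on_SucI[OF Suc.prems(1) d])
    fix v
    have 1: "Ck_on k S (\<lambda>x. ?F (g x) b)" for b
      using Suc.prems(5) by (intro Suc.IH Suc.prems Ck_on_Suc_imp[OF Suc.prems(4)]) auto
    have "Ck_on k S (\<lambda>x. ?G x v \<bullet> b)" for b
      using Ck_on_bilinear[OF bounded_bilinear_inner Suc.prems(1), of k "\<lambda>x. ?G x v" "\<lambda>_. b"]
        Suc.prems(4) by (simp add: Ck_on_const)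
    then show "Ck_on k S (\<lambda>x. \<Sum>b\<in>Basis. (?G x v \<bullet> b) *\<^sub>R ?F (g x) b)"
      by (intro Ck_on_sum Ck_on_bilinear[OF bounded_bilinear_scaleR] 1 Suc.prems)
  qed auto
qed

lemma smooth_on_compose:
  fixes g :: "'a::euclidean_space \<Rightarrow> 'b::euclidean_space" and f :: "'b \<Rightarrow> 'c::real_normed_vector"
  assumes "smooth_on S g" "smooth_on T f" "open S" "open T" "g ` S \<subseteq> T"
  shows "smooth_on S (\<lambda>x. f (g x))"
  using assms Ck_on_compose unfolding smooth_on_def by blast

lemma smooth_on_linear_compose:
  fixes g :: "'a::euclidean_space \<Rightarrow> 'b::euclidean_space"
  assumes "bounded_linear f" "open S" "smooth_on S g"
  shows "smooth_on S (\<lambda>x. f (g x))"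
  using smooth_on_compose[OF assms(3) smooth_on_linear[OF assms(1) open_UNIV]] assms(2) by auto

lemma smooth_on_Pair:
  fixes f :: "'a::euclidean_space \<Rightarrow> 'b::euclidean_space" and g :: "'a \<Rightarrow> 'c::euclidean_space"
  assumes "open S" "smooth_on S f" "smooth_on S g"
  shows "smooth_on S (\<lambda>x. (f x, g x))"
proof -
  have "smooth_on S (\<lambda>x. (f x, 0) + (0, g x))"
    by (intro smooth_on_add[OF assms(1)]
        smooth_on_linear_compose[OF bounded_linear_Pair[OF bounded_linear_ident bounded_linear_zero] assms(1,2)]
        smooth_on_linear_compose[OF bounded_linear_Pair[OF bounded_linear_zero bounded_linear_ident] assms(1,3)])
  then show ?thesis by simp
qed

text \<open>
  The derivative of \<open>f\<close> in the direction \<open>Y\<close>, where base point and direction both vary, is linear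
  in the direction; expanding it in a basis reduces its smoothness to that of the partial derivatives.
\<close>

lemma smooth_on_derivative_along:
  fixes g :: "'a::euclidean_space \<Rightarrow> 'b::euclidean_space" and f :: "'b \<Rightarrow> 'c::real_normed_vector"
  assumes "open S" "open T" "smooth_on S g" "smooth_on S Y" "smooth_on T f" "g ` S \<subseteq> T"
  shows "smooth_on S (\<lambda>x. frechet_derivative f (at (g x)) (Y x))"
proof -
  have "frechet_derivative f (at (g x)) (Y x) =
      (\<Sum>b\<in>Basis. (Y x \<bullet> b) *\<^sub>R frechet_derivative f (at (g x)) b)" if "x \<in> S" for x
    using linear_Basis_expansion has_derivative_linear[OF smooth_on_has_derivative[OF assms(5)]]
      that assms(6) by blast
  moreover have "smooth_on S (\<lambda>x. \<Sum>b\<in>Basis. (Y x \<bullet> b) *\<^sub>R frechet_derivative f (at (g x)) b)"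
    by (intro smooth_on_sum smooth_on_bilinear[OF bounded_bilinear_scaleR]
        smooth_on_bilinear[OF bounded_bilinear_inner] assms smooth_on_const
        smooth_on_compose[OF assms(3) smooth_on_derivative[OF assms(5)]])
  ultimately show ?thesis
    using smooth_on_cong[OF assms(1)] by (metis (no_types, lifting))
qed

text \<open>
  The derivative is a polynomial in the inverse itself, so the induction closes.
\<close>

lemma smooth_on_inverse_real: "smooth_on (- {0::real}) inverse"
  unfolding smooth_on_def
proof
  fix k show "Ck_on k (- {0::real}) inverse"
  proof (induction k)
    case 0
    then show ?case by (auto intro!: continuous_intros)
  next
    case (Suc k)
    show ?case
    proof (rule Ck_on_SucI)
      show "(inverse has_derivative (\<lambda>v. - (inverse x * v * inverse x))) (at x)"
        if "x \<in> - {0::real}" for x :: real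
        using that by (auto intro!: derivative_eq_intros)
      have o: "open (- {0::real})" by auto
      show "Ck_on k (- {0::real}) (\<lambda>x. - (inverse x * v * inverse x))" for v
        using Ck_on_bilinear[OF bounded_bilinear_mult o
            Ck_on_bilinear[OF bounded_bilinear_mult o Suc Ck_on_const[of k _ "- v"]] Suc] by simp
    qed auto
  qed
qed

lemma smooth_on_divide:
  fixes f g :: "'a::euclidean_space \<Rightarrow> real"
  assumes "open S" "smooth_on S f" "smooth_on S g" "\<And>x. x \<in> S \<Longrightarrow> g x \<noteq> 0"
  shows "smooth_on S (\<lambda>x. f x / g x)"
  unfolding divide_inverse
  by (intro smooth_on_bilinear[OF bounded_bilinear_mult] assms
      smooth_on_compose[OF assms(3) smooth_on_inverse_real]) (use assms in auto)

section \<open>Bump functions\<close>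

text \<open>
  The derivatives of the flat function \<open>exp (- 1 / x)\<close> are combinations of functions of this family, so
  that all of them can be shown to be smooth by one induction.
\<close>

definition flat :: "nat \<Rightarrow> real \<Rightarrow> real" where
  "flat n x = (if x > 0 then inverse x ^ n * exp (- inverse x) else 0)"

lemma flat_limit: "(flat n \<longlongrightarrow> 0) (at 0)"
proof -
  have "((\<lambda>x::real. inverse x ^ n * exp (- inverse x)) \<longlongrightarrow> 0) (at_right 0)"
  proof -
    have "((\<lambda>x::real. x ^ n * exp (- x)) \<longlongrightarrow> 0) at_top"
      using tendsto_power_div_exp_0[of n] by (simp add: exp_minus divide_inverse)
    then show ?thesis
      by (rule filterlim_compose[OF _ filterlim_inverse_at_top_right])
  qed
  then have "(flat n \<longlongrightarrow> 0) (at_right 0)"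
    by (rule Lim_transform_eventually) (auto simp: flat_def eventually_at_right_less eventually_at_filter)
  moreover have "(flat n \<longlongrightarrow> 0) (at_left 0)"
    by (rule tendsto_eventually) (auto simp: flat_def eventually_at_filter)
  ultimately show ?thesis by (simp add: filterlim_split_at)
qed

lemma flat_has_derivative:
  "(flat n has_real_derivative flat (n + 2) x - n * flat (Suc n) x) (at x)"
proof (cases x "0::real" rule: linorder_cases)
  case less
  have "(flat n has_real_derivative 0) (at x)"
    by (rule has_field_derivative_transform_within_open[where f="\<lambda>_. 0" and S="{..<0}"])
      (use less in \<open>auto simp: flat_def\<close>)
  then show ?thesis using less by (simp add: flat_def)
next
  case equal
  have "(\<lambda>h. (flat n (0 + h) - flat n 0) / h) = flat (Suc n)"
    by (auto simp: flat_def field_simps)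
  then have "(flat n has_real_derivative 0) (at 0)"
    using flat_limit[of "Suc n"] unfolding DERIV_def by simp
  then show ?thesis using equal by (simp add: flat_def)
next
  case greater
  have n: "n * inverse x ^ (n - 1) * inverse x = n * inverse x ^ n" by (cases n) auto
  have "((\<lambda>x. inverse x ^ n * exp (- inverse x)) has_real_derivative
      (n * inverse x ^ (n - 1) * inverse x) * (- inverse x) * exp (- inverse x) +
      inverse x ^ n * (exp (- inverse x) * (inverse x * inverse x))) (at x)"
    using greater by (auto intro!: derivative_eq_intros simp: algebra_simps)
  then have "((\<lambda>x. inverse x ^ n * exp (- inverse x)) has_real_derivative
      flat (n + 2) x - n * flat (Suc n) x) (at x)"
    unfolding n using greater by (simp add: flat_def algebra_simps)
  then show ?thesis
    by (rule has_field_derivative_transform_within_open[where S="{0<..}"])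
      (use greater in \<open>auto simp: flat_def\<close>)
qed

lemma flat_smooth: "smooth_on UNIV (flat n)"
  unfolding smooth_on_def
proof
  fix k show "Ck_on k UNIV (flat n)"
  proof (induction k arbitrary: n)
    case 0
    have "isCont (flat n) x" for x
      using DERIV_isCont flat_has_derivative by blast
    then show ?case by (simp add: continuous_at_imp_continuous_on)
  next
    case (Suc k)
    show ?case
    proof (rule Ck_on_SucI[where F="\<lambda>x v. v * flat (n + 2) x + (- real n * v) * flat (Suc n) x"])
      show "(flat n has_derivative (\<lambda>v. v * flat (n + 2) x + (- real n * v) * flat (Suc n) x)) (at x)" for x
        using flat_has_derivative[of n x] unfolding has_field_derivative_def
        by (rule has_derivative_eq_rhs) (auto simp: algebra_simps)
      show "Ck_on k UNIV (\<lambda>x. v * flat (n + 2) x + (- real n * v) * flat (Suc n) x)" for v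
        by (intro Ck_on_add Ck_on_bilinear[OF bounded_bilinear_mult] Ck_on_const Suc open_UNIV)
    qed auto
  qed
qed

text \<open>
  The quotient \<open>flat 0 (2 - t) / (flat 0 (2 - t) + flat 0 (t - 1))\<close> is \<open>1\<close> for \<open>t \<le> 1\<close> and \<open>0\<close>
  for \<open>t \<ge> 2\<close>; its denominator has no zeros, because one of the two arguments is positive.
\<close>

lemma smooth_cutoff:
  fixes a :: "'a::euclidean_space"
  assumes "r > 0"
  obtains f :: "'a \<Rightarrow> real" and s where "smooth_on UNIV f" "0 < s" "\<And>x. x \<in> ball a s \<Longrightarrow> f x = 1"
    "\<And>x. x \<notin> cball a r \<Longrightarrow> f x = 0"
proof
  define q where "q x = (2 / r\<^sup>2) * ((x - a) \<bullet> (x - a))" for x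
  have sq: "smooth_on UNIV (\<lambda>x. u + s * q x)" for u s
  proof -
    have "smooth_on UNIV (\<lambda>x. x + (- a))"
      by (intro smooth_on_add smooth_on_const smooth_on_linear bounded_linear_ident open_UNIV)
    then show ?thesis unfolding q_def
      by (intro smooth_on_add smooth_on_bilinear[OF bounded_bilinear_mult] smooth_on_const
          smooth_on_bilinear[OF bounded_bilinear_inner] open_UNIV) auto
  qed
  define f where "f x = flat 0 (2 + (- 1) * q x) / (flat 0 (2 + (- 1) * q x) + flat 0 (- 1 + 1 * q x))" for x
  show "smooth_on UNIV f" unfolding f_def
    by (intro smooth_on_divide smooth_on_add open_UNIV smooth_on_compose[OF sq flat_smooth])
      (auto simp: flat_def add_nonneg_eq_0_iff)
  have q: "q x = 2 * (dist a x)\<^sup>2 / r\<^sup>2" for x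
    by (simp add: q_def dist_norm power2_norm_eq_inner norm_minus_commute[of a])
  show "0 < r / 2" using assms by simp
  show "f x = 1" if "x \<in> ball a (r / 2)" for x
  proof -
    have "(dist a x)\<^sup>2 < (r / 2)\<^sup>2" using that by (intro power_strict_mono) auto
    then have "4 * (dist a x)\<^sup>2 < r\<^sup>2" by (simp add: power_divide)
    then have "2 * (dist a x)\<^sup>2 < r\<^sup>2" using zero_le_power2[of "dist a x"] by linarith
    then have "q x < 1" using assms by (simp add: q)
    then show ?thesis by (simp add: f_def flat_def)
  qed
  show "f x = 0" if "x \<notin> cball a r" for x
  proof -
    have "r\<^sup>2 < (dist a x)\<^sup>2" using that assms by (intro power_strict_mono) auto
    then have "q x > 2" using assms by (auto simp: q field_simps power2_eq_square)
    then show ?thesis by (simp add: f_def flat_def)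
  qed
qed

section \<open>Smooth atlases, their topology and their tangent spaces\<close>

definition jac :: "('m, 'e::euclidean_space) chart \<Rightarrow> ('m, 'f::euclidean_space) chart \<Rightarrow> 'm \<Rightarrow> 'e \<Rightarrow> 'f" where
  "jac c d p = frechet_derivative (transition c d) (at (snd c p))"

text \<open>
  Components of sections are vectors, so smoothness and directional derivatives are needed for functions
  with values in a normed space.
\<close>

definition smf ::
    "('m, 'e::euclidean_space) chart set \<Rightarrow> 'm set \<Rightarrow> ('m \<Rightarrow> 'b::real_normed_vector) \<Rightarrow> bool" where
  "smf C W f \<longleftrightarrow> (\<forall>c\<in>C. smooth_on (snd c ` (fst c \<inter> W)) (f \<circ> chart_inv c))"

definition smooth_near ::
    "('m, 'e::euclidean_space) chart set \<Rightarrow> 'm \<Rightarrow> ('m \<Rightarrow> 'b::real_normed_vector) \<Rightarrow> bool" where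
  "smooth_near C p f \<longleftrightarrow> (\<exists>W. openin (atlas_topology C) W \<and> p \<in> W \<and> smf C W f)"

definition vdd ::
    "('m, 'e::euclidean_space) chart set \<Rightarrow> ('m, 'e) tvec \<Rightarrow> ('m \<Rightarrow> 'b::real_normed_vector) \<Rightarrow> 'b" where
  "vdd C w f =
     (let c = chart_at C (fst w) in
        frechet_derivative (f \<circ> chart_inv c) (at (snd c (fst w))) (snd w c))"

lemma dir_deriv_eq_vdd: "dir_deriv C w f = vdd C w f"
  by (simp add: dir_deriv_def vdd_def Let_def)

lemma smooth_fun_on_eq_smf: "smooth_fun_on C W f \<longleftrightarrow> smf C W f"
  by (simp add: smooth_fun_on_def smf_def)

lemma frechet_derivative_cong_open:
  assumes "open S" "x \<in> S" "\<And>y. y \<in> S \<Longrightarrow> f y = g y"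
  shows "frechet_derivative f (at x) = frechet_derivative g (at x)"
proof -
  have "(f has_derivative D) (at x) \<longleftrightarrow> (g has_derivative D) (at x)" for D
    using has_derivative_transform_within_open[OF _ assms(1,2), of f D UNIV g]
      has_derivative_transform_within_open[OF _ assms(1,2), of g D UNIV f] assms(3) by auto
  then show ?thesis by (simp add: frechet_derivative_def)
qed

lemma fst_tadd [simp]: "fst (tadd v w) = fst v" by (simp add: tadd_def)
lemma snd_tadd [simp]: "snd (tadd v w) c = snd v c + snd w c" by (simp add: tadd_def)
lemma fst_tscale [simp]: "fst (tscale r w) = fst w" by (simp add: tscale_def)
lemma snd_tscale [simp]: "snd (tscale r w) c = r *\<^sub>R snd w c" by (simp add: tscale_def)
lemma fst_tzero [simp]: "fst (tzero p) = p" by (simp add: tzero_def)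
lemma snd_tzero [simp]: "snd (tzero p) c = 0" by (simp add: tzero_def)
lemma fst_tcomb [simp]: "fst (tcomb p I r E) = p" by (simp add: tcomb_def)
lemma snd_tcomb [simp]: "snd (tcomb p I r E) c = (\<Sum>i\<in>I. r i *\<^sub>R snd (E i) c)"
  by (simp add: tcomb_def)
lemma fst_coord_vec [simp]: "fst (coord_vec C c p e) = p" by (simp add: coord_vec_def)

lemma tvec_eqI: "fst v = fst w \<Longrightarrow> (\<And>c. snd v c = snd w c) \<Longrightarrow> v = w"
  by (simp add: prod_eq_iff fun_eq_iff)

lemma tangent_space_fst: "w \<in> tangent_space C p \<Longrightarrow> fst w = p" by (simp add: tangent_space_def)

lemma tangent_bundle_iff: "w \<in> tangent_bundle C \<longleftrightarrow> fst w \<in> carrier C \<and> w \<in> tangent_space C (fst w)"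
  by (auto simp: tangent_bundle_def tangent_space_fst)

lemma chart_at_in: "p \<in> carrier C \<Longrightarrow> chart_at C p \<in> C"
  and in_chart_at: "p \<in> carrier C \<Longrightarrow> p \<in> fst (chart_at C p)"
proof -
  assume "p \<in> carrier C"
  then have "\<exists>c. c \<in> C \<and> p \<in> fst c" by (auto simp: carrier_def)
  then have "chart_at C p \<in> C \<and> p \<in> fst (chart_at C p)" unfolding chart_at_def by (rule someI_ex)
  then show "chart_at C p \<in> C" "p \<in> fst (chart_at C p)" by auto
qed

lemma carrierI: "c \<in> C \<Longrightarrow> p \<in> fst c \<Longrightarrow> p \<in> carrier C"
  by (auto simp: carrier_def)

lemma smf_subset: "smf C W f \<Longrightarrow> W' \<subseteq> W \<Longrightarrow> smf C W' f"
  unfolding smf_def by (blast intro: smooth_on_subset)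

lemma smfD: "smf C W f \<Longrightarrow> c \<in> C \<Longrightarrow> smooth_on (snd c ` (fst c \<inter> W)) (\<lambda>x. f (chart_inv c x))"
  by (simp add: smf_def o_def)

lemma smfI: "(\<And>c. c \<in> C \<Longrightarrow> smooth_on (snd c ` (fst c \<inter> W)) (\<lambda>x. f (chart_inv c x))) \<Longrightarrow> smf C W f"
  by (simp add: smf_def o_def)

lemma smf_const: "smf C W (\<lambda>p. k)"
  by (auto simp: smf_def o_def)

locale atlas =
  fixes C :: "('m, 'e::euclidean_space) chart set"
  assumes smooth_atlas: "smooth_atlas C"
begin

lemma inj: "c \<in> C \<Longrightarrow> inj_on (snd c) (fst c)"
  using smooth_atlas by (simp add: smooth_atlas_def)

lemma inv_left [simp]: "c \<in> C \<Longrightarrow> p \<in> fst c \<Longrightarrow> chart_inv c (snd c p) = p"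
  using inj by (simp add: chart_inv_def inv_into_f_f)

lemma transition_apply [simp]: "c \<in> C \<Longrightarrow> p \<in> fst c \<Longrightarrow> transition c d (snd c p) = snd d p"
  by (simp add: transition_def)

lemma open_overlap: "c \<in> C \<Longrightarrow> d \<in> C \<Longrightarrow> open (snd c ` (fst c \<inter> fst d))"
  using smooth_atlas by (simp add: smooth_atlas_def)

lemma smooth_transition:
  "c \<in> C \<Longrightarrow> d \<in> C \<Longrightarrow> smooth_on (snd c ` (fst c \<inter> fst d)) (transition c d)"
  using smooth_atlas by (simp add: smooth_atlas_def)

lemma openin_iff:
  "openin (atlas_topology C) W \<longleftrightarrow> W \<subseteq> carrier C \<and> (\<forall>c\<in>C. open (snd c ` (W \<inter> fst c)))"
proof -
  let ?P = "\<lambda>W. W \<subseteq> carrier C \<and> (\<forall>c\<in>C. open (snd c ` (W \<inter> fst c)))"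
  have 1: "?P (S \<inter> T)" if S: "?P S" and T: "?P T" for S T
  proof -
    have "snd c ` (S \<inter> T \<inter> fst c) = snd c ` (S \<inter> fst c) \<inter> snd c ` (T \<inter> fst c)" if "c \<in> C" for c
      using inj_on_image_Int[OF inj[OF that], of "S \<inter> fst c" "T \<inter> fst c"]
      by (auto simp: Int_ac)
    then show ?thesis using S T by auto
  qed
  have 2: "?P (\<Union>K)" if K: "\<forall>S\<in>K. ?P S" for K
  proof -
    have "snd c ` (\<Union>K \<inter> fst c) = (\<Union>S\<in>K. snd c ` (S \<inter> fst c))" for c by auto
    then have "open (snd c ` (\<Union>K \<inter> fst c))" if "c \<in> C" for c
      using K that by (metis (no_types, lifting) open_UN)
    then show ?thesis using K by blast
  qed
  have "istopology ?P" unfolding istopology_def using 1 2 by blast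
  then show ?thesis unfolding atlas_topology_def by (simp add: topology_inverse')
qed

lemma open_image: "c \<in> C \<Longrightarrow> openin (atlas_topology C) W \<Longrightarrow> open (snd c ` (fst c \<inter> W))"
  by (simp add: openin_iff Int_commute)

lemma openin_chart: "c \<in> C \<Longrightarrow> openin (atlas_topology C) (fst c)"
  using open_overlap by (auto simp: openin_iff Int_commute carrier_def)

lemma openin_subset_carrier: "openin (atlas_topology C) W \<Longrightarrow> W \<subseteq> carrier C"
  by (simp add: openin_iff)

lemma openin_carrier: "openin (atlas_topology C) (carrier C)"
proof -
  have "openin (atlas_topology C) (\<Union>c\<in>C. fst c)" using openin_chart by blast
  then show ?thesis by (simp add: carrier_def)
qed

lemma topspace [simp]: "topspace (atlas_topology C) = carrier C"
  by (meson openin_carrier openin_subset openin_subset_carrier openin_topspace subset_antisym)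

lemma jac_has_derivative:
  "c \<in> C \<Longrightarrow> d \<in> C \<Longrightarrow> p \<in> fst c \<Longrightarrow> p \<in> fst d \<Longrightarrow> (transition c d has_derivative jac c d p) (at (snd c p))"
  unfolding jac_def by (rule smooth_on_has_derivative[OF smooth_transition]) auto

lemma jac_linear: "c \<in> C \<Longrightarrow> d \<in> C \<Longrightarrow> p \<in> fst c \<Longrightarrow> p \<in> fst d \<Longrightarrow> linear (jac c d p)"
  using jac_has_derivative has_derivative_linear by blast

lemma jac_comp:
  assumes "c \<in> C" "d \<in> C" "e \<in> C" "p \<in> fst c" "p \<in> fst d" "p \<in> fst e"
  shows "jac d e p (jac c d p w) = jac c e p w"
proof -
  have "((\<lambda>x. transition d e (transition c d x)) has_derivative (\<lambda>w. jac d e p (jac c d p w))) (at (snd c p))"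
    using has_derivative_compose[OF jac_has_derivative[of c d p], of "transition d e" "jac d e p"]
      jac_has_derivative[of d e p] assms by simp
  then have D: "(transition c e has_derivative (\<lambda>w. jac d e p (jac c d p w))) (at (snd c p))"
    by (rule has_derivative_transform_within_open[OF _ open_overlap[OF assms(1,2)]])
      (use assms in auto)
  then show ?thesis
    using fun_cong[OF has_derivative_unique[OF D jac_has_derivative[OF assms(1,3,4,6)]], of w] by simp
qed

lemma jac_self: 
  assumes "c \<in> C" "p \<in> fst c"
  shows "jac c c p w = w"
proof -
  have D: "(transition c c has_derivative (\<lambda>w. w)) (at (snd c p))"
    by (rule has_derivative_transform_within_open[OF has_derivative_ident open_overlap[of c c]])
      (use assms in auto)
  then show ?thesis
    using fun_cong[OF has_derivative_unique[OF D jac_has_derivative[OF assms(1,1,2,2)]], of w] by simp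
qed

lemma tangent_space_iff:
  "w \<in> tangent_space C p \<longleftrightarrow> fst w = p \<and>
     (\<forall>c d. c \<in> C \<longrightarrow> d \<in> C \<longrightarrow> p \<in> fst c \<longrightarrow> p \<in> fst d \<longrightarrow> snd w d = jac c d p (snd w c)) \<and>
     (\<forall>c. \<not> (c \<in> C \<and> p \<in> fst c) \<longrightarrow> snd w c = 0)"
  unfolding tangent_space_def mem_Collect_eq jac_def[symmetric] by blast

lemma tangent_comp:
  assumes "w \<in> tangent_space C p" "c \<in> C" "d \<in> C" "p \<in> fst c" "p \<in> fst d"
  shows "snd w d = jac c d p (snd w c)"
  using assms unfolding tangent_space_iff by blast

lemma tangent_spaceI:
  assumes "fst w = p" "c \<in> C" "p \<in> fst c"
    "\<And>d. d \<in> C \<Longrightarrow> p \<in> fst d \<Longrightarrow> snd w d = jac c d p (snd w c)"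
    "\<And>d. \<not> (d \<in> C \<and> p \<in> fst d) \<Longrightarrow> snd w d = 0"
  shows "w \<in> tangent_space C p"
proof -
  have "snd w e = jac d e p (snd w d)" if "d \<in> C" "e \<in> C" "p \<in> fst d" "p \<in> fst e" for d e
    unfolding assms(4)[OF that(1,3)] assms(4)[OF that(2,4)]
    by (rule jac_comp[symmetric]) (use that assms(2,3) in auto)
  then show ?thesis unfolding tangent_space_iff using assms(1,5) by blast
qed

lemma tangent_eqI:
  assumes "w \<in> tangent_space C p" "w' \<in> tangent_space C p" "c \<in> C" "p \<in> fst c" "snd w c = snd w' c"
  shows "w = w'"
proof -
  have "snd w d = snd w' d" for d
  proof (cases "d \<in> C \<and> p \<in> fst d")
    case True
    then show ?thesis
      using tangent_comp[OF assms(1,3), of d] tangent_comp[OF assms(2,3), of d] assms(4,5) by simp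
  next
    case False
    then show ?thesis using assms(1,2) unfolding tangent_space_iff by metis
  qed
  then show ?thesis using assms(1,2) by (auto simp: prod_eq_iff tangent_space_fst)
qed

lemma coord_vec_apply: "d \<in> C \<Longrightarrow> p \<in> fst d \<Longrightarrow> snd (coord_vec C c p e) d = jac c d p e"
  by (simp add: coord_vec_def jac_def)

lemma coord_vec_self [simp]: "c \<in> C \<Longrightarrow> p \<in> fst c \<Longrightarrow> snd (coord_vec C c p e) c = e"
  by (simp add: coord_vec_apply jac_self)

lemma coord_vec_in [simp]: "c \<in> C \<Longrightarrow> p \<in> fst c \<Longrightarrow> coord_vec C c p e \<in> tangent_space C p"
  by (rule tangent_spaceI[of _ p c]) (auto simp: coord_vec_apply jac_self, auto simp: coord_vec_def)

lemma coord_vec_collapse: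
  "w \<in> tangent_space C p \<Longrightarrow> c \<in> C \<Longrightarrow> p \<in> fst c \<Longrightarrow> coord_vec C c p (snd w c) = w"
  by (rule tangent_eqI[of _ p _ c]) auto

lemma tcomb_in: 
  assumes "\<And>i. i \<in> I \<Longrightarrow> E i \<in> tangent_space C p"
  shows "tcomb p I r E \<in> tangent_space C p"
proof -
  have "snd (tcomb p I r E) d = jac c d p (snd (tcomb p I r E) c)"
    if c: "c \<in> C" "d \<in> C" "p \<in> fst c" "p \<in> fst d" for c d
  proof -
    have "snd (E i) d = jac c d p (snd (E i) c)" if "i \<in> I" for i
      by (rule tangent_comp[OF assms[OF that] c])
    then have "snd (tcomb p I r E) d = (\<Sum>i\<in>I. r i *\<^sub>R jac c d p (snd (E i) c))" by simp
    then show ?thesis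
      using jac_linear[OF c] by (simp add: linear_sum linear_scale)
  qed
  moreover have "snd (tcomb p I r E) c = 0" if "\<not> (c \<in> C \<and> p \<in> fst c)" for c
  proof -
    have "snd (E i) c = 0" if "i \<in> I" for i
      using assms[OF that] \<open>\<not> (c \<in> C \<and> p \<in> fst c)\<close> unfolding tangent_space_iff by blast
    then show ?thesis by simp
  qed
  ultimately show ?thesis unfolding tangent_space_iff by (metis fst_tcomb)
qed

lemma tscale_in:
  assumes "v \<in> tangent_space C p"
  shows "tscale r v \<in> tangent_space C p"
proof -
  have "tscale r v = tcomb p {()} (\<lambda>_. r) (\<lambda>_. v)"
    using tangent_space_fst[OF assms] by (simp add: tcomb_def tscale_def)
  then show ?thesis using tcomb_in[of "{()}" "\<lambda>_. v"] assms by simp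
qed

lemma tadd_in: 
  assumes "v \<in> tangent_space C p" "w \<in> tangent_space C p"
  shows "tadd v w \<in> tangent_space C p"
proof -
  have "tadd v w = tcomb p UNIV (\<lambda>_. 1) (\<lambda>b. if b then v else w)"
    using tangent_space_fst[OF assms(1)] by (simp add: tcomb_def tadd_def UNIV_bool add.commute)
  then show ?thesis using tcomb_in[of UNIV "\<lambda>b. if b then v else w"] assms by simp
qed

lemma tzero_in: "tzero p \<in> tangent_space C p"
proof -
  have "tzero p = tcomb p {} (\<lambda>_. 0) (\<lambda>_. tzero p)" by (simp add: tcomb_def tzero_def)
  then show ?thesis using tcomb_in[of "{}" "\<lambda>_. tzero p" p "\<lambda>_. 0"] by (metis empty_iff)
qed

section \<open>Smooth functions on an atlas and their directional derivatives\<close>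

lemma smf_localI:
  assumes "\<And>p. p \<in> W \<Longrightarrow> \<exists>W'. openin (atlas_topology C) W' \<and> p \<in> W' \<and> smf C W' f"
  shows "smf C W f"
  unfolding smf_def
proof
  fix c assume c: "c \<in> C"
  show "smooth_on (snd c ` (fst c \<inter> W)) (f \<circ> chart_inv c)"
  proof (rule smooth_on_local)
    fix x assume "x \<in> snd c ` (fst c \<inter> W)"
    then obtain p where p: "x = snd c p" "p \<in> fst c" "p \<in> W" by blast
    then obtain W' where W': "openin (atlas_topology C) W'" "p \<in> W'" "smf C W' f" using assms by blast
    show "\<exists>T. open T \<and> x \<in> T \<and> smooth_on T (f \<circ> chart_inv c)"
      using W' p c open_image[OF c W'(1)] unfolding smf_def
      by (intro exI[of _ "snd c ` (fst c \<inter> W')"]) auto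
  qed
qed

lemma smf_nearI: "(\<And>p. p \<in> W \<Longrightarrow> smooth_near C p f) \<Longrightarrow> smf C W f"
  by (rule smf_localI) (auto simp: smooth_near_def)

lemma smf_cong:
  assumes "openin (atlas_topology C) W" "\<And>p. p \<in> W \<Longrightarrow> f p = g p"
  shows "smf C W f \<longleftrightarrow> smf C W g"
  unfolding smf_def
proof (rule ball_cong[OF refl])
  fix c assume c: "c \<in> C"
  show "smooth_on (snd c ` (fst c \<inter> W)) (f \<circ> chart_inv c) \<longleftrightarrow> smooth_on (snd c ` (fst c \<inter> W)) (g \<circ> chart_inv c)"
    by (rule smooth_on_cong[OF open_image[OF c assms(1)]]) (use assms(2) c in auto)
qed

text \<open>
  Smoothness can be tested in one chart, because another chart only adds a smooth coordinate change.
\<close>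

lemma smf_chartI:
  assumes "c \<in> C" "W \<subseteq> fst c" "openin (atlas_topology C) W" "smooth_on (snd c ` W) (f \<circ> chart_inv c)"
  shows "smf C W f"
  unfolding smf_def
proof
  fix d assume d: "d \<in> C"
  have W: "fst c \<inter> W = W" using assms(2) by blast
  have o: "open (snd d ` (fst d \<inter> W))" by (rule open_image[OF d assms(3)])
  have "smooth_on (snd d ` (fst d \<inter> W)) (\<lambda>x. (f \<circ> chart_inv c) (transition d c x))"
  proof (rule smooth_on_compose[OF _ assms(4) o])
    show "smooth_on (snd d ` (fst d \<inter> W)) (transition d c)"
      by (rule smooth_on_subset[OF smooth_transition[OF d assms(1)]]) (use assms(2) in auto)
    show "open (snd c ` W)" using open_image[OF assms(1,3)] W by simp
    show "transition d c ` snd d ` (fst d \<inter> W) \<subseteq> snd c ` W" using d by auto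
  qed
  then show "smooth_on (snd d ` (fst d \<inter> W)) (f \<circ> chart_inv d)"
    by (subst smooth_on_cong[OF o, where g="\<lambda>x. (f \<circ> chart_inv c) (transition d c x)"])
      (use assms d in auto)
qed

lemma smf_compose:
  fixes f :: "'m \<Rightarrow> 'b::euclidean_space"
  assumes "openin (atlas_topology C) W" "smf C W f" "smooth_on T F" "open T" "f ` W \<subseteq> T"
  shows "smf C W (\<lambda>p. F (f p))"
proof (rule smfI)
  fix c assume c: "c \<in> C"
  show "smooth_on (snd c ` (fst c \<inter> W)) (\<lambda>x. F (f (chart_inv c x)))"
    by (rule smooth_on_compose[OF smfD[OF assms(2) c] assms(3) open_image[OF c assms(1)] assms(4)])
      (use assms c in auto)
qed

lemma smf_linear:
  fixes f :: "'m \<Rightarrow> 'b::euclidean_space"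
  assumes "openin (atlas_topology C) W" "bounded_linear L" "smf C W f"
  shows "smf C W (\<lambda>p. L (f p))"
  using smf_compose[OF assms(1,3) smooth_on_linear[OF assms(2) open_UNIV]] by simp

lemma smf_bilinear:
  assumes "bounded_bilinear B" "openin (atlas_topology C) W" "smf C W f" "smf C W g"
  shows "smf C W (\<lambda>p. B (f p) (g p))"
  by (intro smfI smooth_on_bilinear[OF assms(1) open_image[OF _ assms(2)]] smfD[OF assms(3)] smfD[OF assms(4)])

lemma smf_add:
  assumes "openin (atlas_topology C) W" "smf C W f" "smf C W g"
  shows "smf C W (\<lambda>p. f p + g p)"
  by (intro smfI smooth_on_add[OF open_image[OF _ assms(1)]] smfD[OF assms(2)] smfD[OF assms(3)])

lemma smf_Pair:
  fixes f :: "'m \<Rightarrow> 'b::euclidean_space" and g :: "'m \<Rightarrow> 'c::euclidean_space"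
  assumes "openin (atlas_topology C) W" "smf C W f" "smf C W g"
  shows "smf C W (\<lambda>p. (f p, g p))"
  by (intro smfI smooth_on_Pair[OF open_image[OF _ assms(1)]] smfD[OF assms(2)] smfD[OF assms(3)])

lemma smf_chart: "c \<in> C \<Longrightarrow> smf C (fst c) (snd c)"
proof (rule smf_chartI[OF _ order_refl openin_chart])
  assume c: "c \<in> C"
  have o: "open (snd c ` fst c)" using open_overlap[OF c c] by simp
  show "smooth_on (snd c ` fst c) (snd c \<circ> chart_inv c)"
    by (subst smooth_on_cong[OF o, where g="\<lambda>x. x"])
      (use smooth_on_linear[OF bounded_linear_ident o] c in auto)
qed auto

lemma openin_preimage:
  assumes "openin (atlas_topology C) W" "smf C W f" "open S"
  shows "openin (atlas_topology C) {p \<in> W. f p \<in> S}"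
  unfolding openin_iff
proof (intro conjI ballI)
  show "{p \<in> W. f p \<in> S} \<subseteq> carrier C" using openin_subset_carrier[OF assms(1)] by blast
  fix c assume c: "c \<in> C"
  have eq: "snd c ` ({p \<in> W. f p \<in> S} \<inter> fst c) = snd c ` (fst c \<inter> W) \<inter> (f \<circ> chart_inv c) -` S"
    using c by (auto simp: image_iff)
  have "continuous_on (snd c ` (fst c \<inter> W)) (f \<circ> chart_inv c)"
    using smooth_on_continuous[OF smfD[OF assms(2) c]] by (simp add: o_def)
  then show "open (snd c ` ({p \<in> W. f p \<in> S} \<inter> fst c))"
    unfolding eq by (rule continuous_open_preimage[OF _ open_image[OF c assms(1)] assms(3)])
qed

lemma smooth_nearI:
  "openin (atlas_topology C) W \<Longrightarrow> p \<in> W \<Longrightarrow> smf C W f \<Longrightarrow> smooth_near C p f"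
  by (auto simp: smooth_near_def)

lemma smooth_near_common:
  assumes "smooth_near C p f" "smooth_near C p g"
  obtains W where "openin (atlas_topology C) W" "p \<in> W" "smf C W f" "smf C W g"
proof -
  obtain W W' where "openin (atlas_topology C) W" "p \<in> W" "smf C W f"
    "openin (atlas_topology C) W'" "p \<in> W'" "smf C W' g"
    using assms unfolding smooth_near_def by blast
  then show thesis
    using that[of "W \<inter> W'"] smf_subset[of C W f "W \<inter> W'"] smf_subset[of C W' g "W \<inter> W'"] by blast
qed

lemma smooth_near_has_derivative:
  assumes "smooth_near C p f" "c \<in> C" "p \<in> fst c"
  shows "((f \<circ> chart_inv c) has_derivative frechet_derivative (f \<circ> chart_inv c) (at (snd c p))) (at (snd c p))"
proof -
  obtain W where W: "openin (atlas_topology C) W" "p \<in> W" "smf C W f"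
    using assms(1) unfolding smooth_near_def by blast
  show ?thesis
    by (rule smooth_on_has_derivative[of "snd c ` (fst c \<inter> W)"])
      (use W assms in \<open>auto simp: smf_def\<close>)
qed

text \<open>
  A directional derivative can be computed in any chart: the chain rule for the coordinate change
  is compensated by the transformation of the components of the tangent vector.
\<close>

lemma vdd_eqI:
  assumes "w \<in> tangent_space C p" "c \<in> C" "p \<in> fst c"
    and f: "((f \<circ> chart_inv c) has_derivative F) (at (snd c p))"
  shows "vdd C w f = F (snd w c)"
proof -
  define d where "d = chart_at C p"
  have d: "d \<in> C" "p \<in> fst d"
    using carrierI[OF assms(2,3)] by (simp_all add: d_def chart_at_in in_chart_at)
  have "((\<lambda>x. (f \<circ> chart_inv c) (transition d c x)) has_derivative (\<lambda>w. F (jac d c p w))) (at (snd d p))"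
    using has_derivative_compose[OF jac_has_derivative[of d c p], of "f \<circ> chart_inv c" F] d assms by simp
  then have "((f \<circ> chart_inv d) has_derivative (\<lambda>w. F (jac d c p w))) (at (snd d p))"
    by (rule has_derivative_transform_within_open[OF _ open_overlap[OF d(1) assms(2)]])
      (use assms d in auto)
  then have "frechet_derivative (f \<circ> chart_inv d) (at (snd d p)) = (\<lambda>w. F (jac d c p w))"
    using frechet_derivative_at by metis
  then show ?thesis
    using tangent_comp[OF assms(1) d(1) assms(2) d(2) assms(3)] tangent_space_fst[OF assms(1)]
    by (simp add: vdd_def Let_def d_def)
qed

lemma vdd_chart:
  assumes "w \<in> tangent_space C p" "c \<in> C" "p \<in> fst c" "smooth_near C p f"
  shows "vdd C w f = frechet_derivative (f \<circ> chart_inv c) (at (snd c p)) (snd w c)"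
  by (rule vdd_eqI[OF assms(1-3) smooth_near_has_derivative[OF assms(4,2,3)]])

lemma vdd_cong:
  assumes "w \<in> tangent_space C p" "openin (atlas_topology C) W" "p \<in> W" "\<And>q. q \<in> W \<Longrightarrow> f q = g q"
  shows "vdd C w f = vdd C w g"
proof -
  define c where "c = chart_at C p"
  have c: "c \<in> C" "p \<in> fst c"
    using openin_subset_carrier[OF assms(2)] assms(3) by (auto simp: c_def chart_at_in in_chart_at)
  have "frechet_derivative (f \<circ> chart_inv c) (at (snd c p)) = frechet_derivative (g \<circ> chart_inv c) (at (snd c p))"
    by (rule frechet_derivative_cong_open[OF open_image[OF c(1) assms(2)]]) (use c assms in auto)
  then show ?thesis
    using tangent_space_fst[OF assms(1)] by (simp add: vdd_def Let_def c_def)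
qed

lemma vdd_coord: 
  assumes "w \<in> tangent_space C p" "c \<in> C" "p \<in> fst c"
  shows "vdd C w (snd c) = snd w c"
proof (rule vdd_eqI[OF assms, of _ "\<lambda>w. w"])
  show "((snd c \<circ> chart_inv c) has_derivative (\<lambda>w. w)) (at (snd c p))"
    by (rule has_derivative_transform_within_open[OF has_derivative_ident open_overlap[of c c]])
      (use assms in auto)
qed

lemma vdd_const:
  assumes "w \<in> tangent_space C p" "p \<in> carrier C"
  shows "vdd C w (\<lambda>q. k) = 0"
  using vdd_eqI[OF assms(1), of "chart_at C p" "\<lambda>q. k" "\<lambda>_. 0"]
    chart_at_in[OF assms(2)] in_chart_at[OF assms(2)]
  by (simp add: o_def)

lemma smooth_near_in_carrier: "smooth_near C p f \<Longrightarrow> p \<in> carrier C"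
  using openin_subset_carrier by (auto simp: smooth_near_def)

lemma vdd_bilinear:
  assumes B: "bounded_bilinear B" and w: "w \<in> tangent_space C p"
    and f: "smooth_near C p f" and g: "smooth_near C p g"
  shows "vdd C w (\<lambda>q. B (f q) (g q)) = B (f p) (vdd C w g) + B (vdd C w f) (g p)"
proof -
  obtain c where c: "c \<in> C" "p \<in> fst c"
    using smooth_near_in_carrier[OF f] by (auto simp: carrier_def)
  have "(((\<lambda>q. B (f q) (g q)) \<circ> chart_inv c) has_derivative
      (\<lambda>h. B (f p) (frechet_derivative (g \<circ> chart_inv c) (at (snd c p)) h) +
           B (frechet_derivative (f \<circ> chart_inv c) (at (snd c p)) h) (g p))) (at (snd c p))"
    using bounded_bilinear.FDERIV[OF B smooth_near_has_derivative[OF f c] smooth_near_has_derivative[OF g c]] c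
    by (simp add: o_def)
  from vdd_eqI[OF w c this] show ?thesis by (simp add: vdd_chart[OF w c] f g)
qed

lemma vdd_compose:
  assumes w: "w \<in> tangent_space C p" and f: "smooth_near C p f"
    and F: "(F has_derivative F') (at (f p))"
  shows "vdd C w (\<lambda>q. F (f q)) = F' (vdd C w f)"
proof -
  obtain c where c: "c \<in> C" "p \<in> fst c"
    using smooth_near_in_carrier[OF f] by (auto simp: carrier_def)
  have "(((\<lambda>q. F (f q)) \<circ> chart_inv c) has_derivative
      (\<lambda>h. F' (frechet_derivative (f \<circ> chart_inv c) (at (snd c p)) h))) (at (snd c p))"
    using has_derivative_compose[OF smooth_near_has_derivative[OF f c], of F F'] F c
    by (simp add: o_def)
  from vdd_eqI[OF w c this] show ?thesis by (simp add: vdd_chart[OF w c] f)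
qed

lemma vdd_linear:
  assumes "w \<in> tangent_space C p" "smooth_near C p f" "bounded_linear L"
  shows "vdd C w (\<lambda>q. L (f q)) = L (vdd C w f)"
  by (rule vdd_compose[OF assms(1,2) bounded_linear_imp_has_derivative[OF assms(3)]])

lemma vdd_sum:
  assumes w: "w \<in> tangent_space C p" "p \<in> carrier C" and f: "\<And>i. i \<in> I \<Longrightarrow> smooth_near C p (f i)"
  shows "vdd C w (\<lambda>q. \<Sum>i\<in>I. f i q) = (\<Sum>i\<in>I. vdd C w (f i))"
proof -
  obtain c where c: "c \<in> C" "p \<in> fst c"
    using w(2) by (auto simp: carrier_def)
  have "(((\<lambda>q. \<Sum>i\<in>I. f i q) \<circ> chart_inv c) has_derivative
      (\<lambda>h. \<Sum>i\<in>I. frechet_derivative (f i \<circ> chart_inv c) (at (snd c p)) h)) (at (snd c p))"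
    using has_derivative_sum[of I "\<lambda>i. f i \<circ> chart_inv c", OF smooth_near_has_derivative[OF f c]]
    by (simp add: o_def)
  from vdd_eqI[OF w(1) c this] show ?thesis by (simp add: vdd_chart[OF w(1) c] f)
qed

lemma vdd_add:
  assumes w: "w \<in> tangent_space C p" and f: "smooth_near C p f" and g: "smooth_near C p g"
  shows "vdd C w (\<lambda>q. f q + g q) = vdd C w f + vdd C w g"
proof -
  obtain c where c: "c \<in> C" "p \<in> fst c"
    using smooth_near_in_carrier[OF f] by (auto simp: carrier_def)
  have "(((\<lambda>q. f q + g q) \<circ> chart_inv c) has_derivative
      (\<lambda>h. frechet_derivative (f \<circ> chart_inv c) (at (snd c p)) h +
           frechet_derivative (g \<circ> chart_inv c) (at (snd c p)) h)) (at (snd c p))"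
    using has_derivative_add[OF smooth_near_has_derivative[OF f c] smooth_near_has_derivative[OF g c]]
    by (simp add: o_def)
  from vdd_eqI[OF w c this] show ?thesis by (simp add: vdd_chart[OF w c] f g)
qed

lemma vdd_tadd:
  assumes "w \<in> tangent_space C p" "w' \<in> tangent_space C p" and f: "smooth_near C p f"
  shows "vdd C (tadd w w') f = vdd C w f + vdd C w' f"
proof -
  obtain c where c: "c \<in> C" "p \<in> fst c"
    using smooth_near_in_carrier[OF f] by (auto simp: carrier_def)
  show ?thesis
    using vdd_chart[OF _ c f] assms tadd_in
      linear_add[OF has_derivative_linear[OF smooth_near_has_derivative[OF f c]]] by simp
qed

lemma vdd_tscale:
  assumes "w \<in> tangent_space C p" and f: "smooth_near C p f"
  shows "vdd C (tscale r w) f = r *\<^sub>R vdd C w f"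
proof -
  obtain c where c: "c \<in> C" "p \<in> fst c"
    using smooth_near_in_carrier[OF f] by (auto simp: carrier_def)
  show ?thesis
    using vdd_chart[OF _ c f] assms tscale_in
      linear_scale[OF has_derivative_linear[OF smooth_near_has_derivative[OF f c]]] by simp
qed

text \<open>
  Differentiating a smooth function along a smooth vector field gives a smooth function: in a chart it is
  the derivative of the coordinate expression in a direction that varies smoothly.
\<close>

lemma smf_vdd:
  assumes "c \<in> C" "openin (atlas_topology C) W" "W \<subseteq> fst c" "smf C W f"
    "smf C W (\<lambda>q. snd (X q) c)" "\<And>q. q \<in> W \<Longrightarrow> X q \<in> tangent_space C q"
  shows "smf C W (\<lambda>q. vdd C (X q) f)"
proof (rule smf_chartI[OF assms(1,3,2)])
  have W: "fst c \<inter> W = W" using assms(3) by blast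
  have o: "open (snd c ` W)" using open_image[OF assms(1,2)] W by simp
  have "smooth_on (snd c ` W)
      (\<lambda>x. frechet_derivative (f \<circ> chart_inv c) (at x) (((\<lambda>q. snd (X q) c) \<circ> chart_inv c) x))"
    by (rule smooth_on_derivative_along[OF o o smooth_on_linear[OF bounded_linear_ident o]])
      (use smfD[OF assms(4,1)] smfD[OF assms(5,1)] W in \<open>auto simp: o_def\<close>)
  then show "smooth_on (snd c ` W) ((\<lambda>q. vdd C (X q) f) \<circ> chart_inv c)"
  proof (rule smooth_on_cong[OF o, THEN iffD1, rotated])
    fix x assume "x \<in> snd c ` W"
    then obtain q where q: "x = snd c q" "q \<in> W" by blast
    have n: "smooth_near C q f" using smooth_nearI[OF assms(2) q(2) assms(4)] .
    show "frechet_derivative (f \<circ> chart_inv c) (at x) (((\<lambda>q. snd (X q) c) \<circ> chart_inv c) x) =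
        ((\<lambda>q. vdd C (X q) f) \<circ> chart_inv c) x"
      using q assms(1) subsetD[OF assms(3) q(2)]
        vdd_chart[OF assms(6)[OF q(2)] assms(1) subsetD[OF assms(3) q(2)] n] by auto
  qed
qed

section \<open>Smooth maps and their tangent maps\<close>

lemma smooth_map_iff:
  "smooth_map C E f \<longleftrightarrow> f ` carrier C \<subseteq> carrier E \<and>
     (\<forall>e\<in>E. openin (atlas_topology C) (f -` fst e \<inter> carrier C) \<and> smf C (f -` fst e \<inter> carrier C) (snd e \<circ> f))"
proof -
  have "fst c \<inter> (f -` S \<inter> carrier C) = fst c \<inter> f -` S" "f -` S \<inter> carrier C \<inter> fst c = fst c \<inter> f -` S"
    if "c \<in> C" for c S
    using that by (auto simp: carrier_def)
  then show ?thesis by (auto simp: smooth_map_def openin_iff smf_def)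
qed

text \<open>
  It suffices to find one good pair of charts at each point. The openness of preimages of chart domains,
  which is part of being a smooth map, follows from continuity in these charts.
\<close>

lemma smooth_mapI:
  assumes "atlas E"
    and "\<And>p. p \<in> carrier C \<Longrightarrow> \<exists>e W. e \<in> E \<and> openin (atlas_topology C) W \<and> p \<in> W \<and> f ` W \<subseteq> fst e \<and>
      smf C W (\<lambda>q. snd e (f q))"
  shows "smooth_map C E f"
proof -
  interpret E: atlas E by fact
  have main: "\<exists>W. openin (atlas_topology C) W \<and> p \<in> W \<and> W \<subseteq> f -` fst e \<inter> carrier C \<and> smf C W (snd e \<circ> f)"
    if e: "e \<in> E" and p: "p \<in> f -` fst e \<inter> carrier C" for e p
  proof -
    obtain d W where d: "d \<in> E" and W: "openin (atlas_topology C) W" "p \<in> W" "f ` W \<subseteq> fst d"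
      "smf C W (\<lambda>q. snd d (f q))"
      using assms(2)[of p] p by blast
    let ?W = "{q \<in> W. snd d (f q) \<in> snd d ` (fst d \<inter> fst e)}"
    have o: "openin (atlas_topology C) ?W"
      by (rule openin_preimage[OF W(1,4) E.open_overlap[OF d e]])
    have sub: "?W \<subseteq> f -` fst e"
      using W(3) E.inj[OF d] by (auto dest!: inj_onD)
    have "smf C ?W (\<lambda>q. transition d e (snd d (f q)))"
      by (rule smf_compose[OF o smf_subset[OF W(4)] E.smooth_transition[OF d e] E.open_overlap[OF d e]]) auto
    then have "smf C ?W (snd e \<circ> f)"
      by (subst smf_cong[OF o, where g="\<lambda>q. transition d e (snd d (f q))"])
        (use W(3) d in \<open>auto simp del: transition_apply intro!: E.transition_apply[symmetric]\<close>)
    then show ?thesis using o sub W p openin_subset_carrier[OF W(1)]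
      by (intro exI[of _ ?W]) auto
  qed
  show ?thesis unfolding smooth_map_iff
  proof (intro conjI ballI)
    show "f ` carrier C \<subseteq> carrier E"
    proof
      fix y assume "y \<in> f ` carrier C"
      then obtain p where p: "y = f p" "p \<in> carrier C" by blast
      obtain e W where "e \<in> E" "p \<in> W" "f ` W \<subseteq> fst e" using assms(2)[OF p(2)] by blast
      then show "y \<in> carrier E" using p(1) carrierI[of e E y] by blast
    qed
    fix e assume e: "e \<in> E"
    show "openin (atlas_topology C) (f -` fst e \<inter> carrier C)"
      by (subst openin_subopen) (use main[OF e] in blast)
    show "smf C (f -` fst e \<inter> carrier C) (snd e \<circ> f)"
      by (rule smf_localI) (use main[OF e] in blast)
  qed
qed

lemma smooth_map_near:
  assumes "smooth_map C E f" "p \<in> carrier C" "e \<in> E" "f p \<in> fst e"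
  shows "smooth_near C p (\<lambda>q. snd e (f q))"
  using assms unfolding smooth_map_iff smooth_near_def by (auto simp: o_def)

text \<open>
  The components of the image vector are directional derivatives of the coordinates of the map, so
  tangent maps can be computed without choosing a chart of the source.
\<close>

lemma tangent_map_apply:
  assumes E: "atlas E" and f: "smooth_map C E f" and w: "w \<in> tangent_space C p" and p: "p \<in> carrier C"
  shows "tangent_map C E f w \<in> tangent_space E (f p)"
    and "e \<in> E \<Longrightarrow> f p \<in> fst e \<Longrightarrow> snd (tangent_map C E f w) e = vdd C w (\<lambda>q. snd e (f q))"
proof -
  interpret E: atlas E by fact
  define d where "d = chart_at E (f p)"
  have fp: "f p \<in> carrier E" using f p by (auto simp: smooth_map_iff)
  have d: "d \<in> E" "f p \<in> fst d"
    using fp by (simp_all add: d_def chart_at_in in_chart_at)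
  have eq: "tangent_map C E f w = coord_vec E d (f p) (vdd C w (\<lambda>q. snd d (f q)))"
    using tangent_space_fst[OF w] by (simp add: tangent_map_def vdd_def Let_def d_def o_def)
  show "tangent_map C E f w \<in> tangent_space E (f p)"
    unfolding eq using d by simp
  assume e: "e \<in> E" "f p \<in> fst e"
  let ?W = "(f -` fst d \<inter> carrier C)"
  have W: "openin (atlas_topology C) ?W" "p \<in> ?W" using f d p by (auto simp: smooth_map_iff)
  have "vdd C w (\<lambda>q. snd e (f q)) = vdd C w (\<lambda>q. transition d e (snd d (f q)))"
    by (rule vdd_cong[OF w W]) (use d in auto)
  also have "\<dots> = jac d e (f p) (vdd C w (\<lambda>q. snd d (f q)))"
    by (rule vdd_compose[OF w smooth_map_near[OF f p d]]) (use E.jac_has_derivative d e in auto)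
  finally show "snd (tangent_map C E f w) e = vdd C w (\<lambda>q. snd e (f q))"
    by (simp add: eq E.coord_vec_apply e)
qed

end

context atlas
begin

lemma smf_near: "openin (atlas_topology C) W \<Longrightarrow> smf C W f \<longleftrightarrow> (\<forall>p\<in>W. smooth_near C p f)"
  using smooth_nearI smf_nearI by metis

lemma smooth_near_cong:
  assumes "smooth_near C p f" "openin (atlas_topology C) W" "p \<in> W" "\<And>q. q \<in> W \<Longrightarrow> f q = g q"
  shows "smooth_near C p g"
proof -
  obtain W' where W': "openin (atlas_topology C) W'" "p \<in> W'" "smf C W' f"
    using assms(1) by (auto simp: smooth_near_def)
  have o: "openin (atlas_topology C) (W \<inter> W')" using assms(2) W'(1) by blast
  have "smf C (W \<inter> W') g"
    by (rule smf_cong[OF o, of f g, THEN iffD1]) (use assms(4) smf_subset[OF W'(3)] in auto)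
  then show ?thesis using o W'(2) assms(3) by (intro smooth_nearI) auto
qed

lemma smooth_near_const: "p \<in> carrier C \<Longrightarrow> smooth_near C p (\<lambda>q. k)"
  using openin_carrier by (auto intro!: smooth_nearI smf_const)

lemma smooth_near_linear:
  fixes f :: "'m \<Rightarrow> 'b::euclidean_space"
  assumes "bounded_linear L" "smooth_near C p f"
  shows "smooth_near C p (\<lambda>q. L (f q))"
  using assms smf_linear[OF _ assms(1)] unfolding smooth_near_def by blast

lemma smooth_near_bilinear:
  assumes "bounded_bilinear B" "smooth_near C p f" "smooth_near C p g"
  shows "smooth_near C p (\<lambda>q. B (f q) (g q))"
  using smooth_near_common[OF assms(2,3)] smf_bilinear[OF assms(1)] unfolding smooth_near_def by metis

lemma smooth_near_add:
  assumes "smooth_near C p f" "smooth_near C p g"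
  shows "smooth_near C p (\<lambda>q. f q + g q)"
  using smooth_near_common[OF assms] smf_add unfolding smooth_near_def by metis

lemma smooth_near_sum:
  "p \<in> carrier C \<Longrightarrow> (\<And>i. i \<in> I \<Longrightarrow> smooth_near C p (f i)) \<Longrightarrow> smooth_near C p (\<lambda>q. \<Sum>i\<in>I. f i q)"
  by (induction I rule: infinite_finite_induct) (auto intro: smooth_near_add smooth_near_const)

lemma smooth_near_Pair:
  fixes f :: "'m \<Rightarrow> 'b::euclidean_space" and g :: "'m \<Rightarrow> 'c::euclidean_space"
  assumes "smooth_near C p f" "smooth_near C p g"
  shows "smooth_near C p (\<lambda>q. (f q, g q))"
  using smooth_near_common[OF assms] smf_Pair unfolding smooth_near_def by metis

lemma smooth_near_compose:
  fixes f :: "'m \<Rightarrow> 'b::euclidean_space"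
  assumes "smooth_near C p f" "open S" "f p \<in> S" "smooth_on S F"
  shows "smooth_near C p (\<lambda>q. F (f q))"
proof -
  obtain W where W: "openin (atlas_topology C) W" "p \<in> W" "smf C W f"
    using assms(1) by (auto simp: smooth_near_def)
  have o: "openin (atlas_topology C) {q \<in> W. f q \<in> S}" by (rule openin_preimage[OF W(1,3) assms(2)])
  show ?thesis
    by (rule smooth_nearI[OF o _ smf_compose[OF o smf_subset[OF W(3)] assms(4,2)]])
      (use W(2) assms(3) in auto)
qed

lemma smooth_near_chart: "c \<in> C \<Longrightarrow> p \<in> fst c \<Longrightarrow> smooth_near C p (snd c)"
  using smf_chart openin_chart smooth_nearI by blast

lemma smooth_near_vdd:
  assumes c: "c \<in> C" "p \<in> fst c" and f: "smooth_near C p f" and X: "smooth_near C p (\<lambda>q. snd (X q) c)"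
    and W: "openin (atlas_topology C) W" "p \<in> W" "\<And>q. q \<in> W \<Longrightarrow> X q \<in> tangent_space C q"
  shows "smooth_near C p (\<lambda>q. vdd C (X q) f)"
proof -
  obtain V where V: "openin (atlas_topology C) V" "p \<in> V" "smf C V f" "smf C V (\<lambda>q. snd (X q) c)"
    using smooth_near_common[OF f X] by metis
  let ?W = "V \<inter> W \<inter> fst c"
  have o: "openin (atlas_topology C) ?W" using V W openin_chart[OF c(1)] by blast
  have "smf C ?W (\<lambda>q. vdd C (X q) f)"
    by (rule smf_vdd[OF c(1) o _ smf_subset[OF V(3)] smf_subset[OF V(4)]]) (use W in auto)
  then show ?thesis using o V W c by (intro smooth_nearI) auto
qed

subsection \<open>Restriction to an open subset\<close>

lemma chart_inv_restrict:
  "c \<in> C \<Longrightarrow> p \<in> fst c \<Longrightarrow> p \<in> W \<Longrightarrow> chart_inv (fst c \<inter> W, snd c) (snd c p) = p"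
  unfolding chart_inv_def using inj_on_subset[OF inj[of c], of "fst c \<inter> W"]
  by (simp add: inv_into_f_f)

lemma atlas_restrict:
  assumes "openin (atlas_topology C) W"
  shows "atlas (restrict_atlas C W)"
proof
  show "Defs.smooth_atlas (restrict_atlas C W)"
    unfolding smooth_atlas_def
  proof (intro conjI ballI)
    fix c' assume "c' \<in> restrict_atlas C W"
    then obtain c where c: "c \<in> C" "c' = (fst c \<inter> W, snd c)" by (auto simp: restrict_atlas_def)
    then show "inj_on (snd c') (fst c')" using inj_on_subset[OF inj[of c]] by simp
    fix d' assume "d' \<in> restrict_atlas C W"
    then obtain d where d: "d \<in> C" "d' = (fst d \<inter> W, snd d)" by (auto simp: restrict_atlas_def)
    have eq: "fst c' \<inter> fst d' = fst c \<inter> (fst d \<inter> W)" using c d by auto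
    have "openin (atlas_topology C) (fst d \<inter> W)" using openin_chart[OF d(1)] assms by blast
    then have o: "open (snd c' ` (fst c' \<inter> fst d'))"
      unfolding eq using open_image[OF c(1), of "fst d \<inter> W"] c(2) by simp
    then show "open (snd c' ` (fst c' \<inter> fst d'))" .
    have "smooth_on (snd c' ` (fst c' \<inter> fst d')) (transition c d)"
      by (rule smooth_on_subset[OF smooth_transition[OF c(1) d(1)]]) (use c d in auto)
    then show "smooth_on (snd c' ` (fst c' \<inter> fst d')) (transition c' d')"
      by (rule smooth_on_cong[OF o, THEN iffD1, rotated])
        (use c d in \<open>auto simp: transition_def chart_inv_restrict\<close>)
  qed
qed

lemma carrier_restrict: "carrier (restrict_atlas C W) = carrier C \<inter> W"
  by (auto simp: carrier_def restrict_atlas_def)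

lemma smooth_near_restrict:
  assumes W: "openin (atlas_topology C) W" and f: "smooth_near (restrict_atlas C W) p f"
  shows "smooth_near C p f"
proof -
  interpret R: atlas "restrict_atlas C W" by (rule atlas_restrict[OF W])
  obtain S where S: "openin (atlas_topology (restrict_atlas C W)) S" "p \<in> S" "smf (restrict_atlas C W) S f"
    using f by (auto simp: smooth_near_def)
  have sub: "S \<subseteq> carrier C \<inter> W" using R.openin_subset_carrier[OF S(1)] carrier_restrict by simp
  have eq: "S \<inter> (fst c \<inter> W) = S \<inter> fst c" "fst c \<inter> W \<inter> S = fst c \<inter> S" for c :: "('m, 'e) chart"
    using sub by auto
  have o: "openin (atlas_topology C) S"
    using S(1) sub eq unfolding R.openin_iff openin_iff by (auto simp: restrict_atlas_def)
  have "smf C S f"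
  proof (rule smfI)
    fix c assume c: "c \<in> C"
    have c': "(fst c \<inter> W, snd c) \<in> restrict_atlas C W" using c by (auto simp: restrict_atlas_def)
    have "smooth_on (snd c ` (fst c \<inter> S)) (\<lambda>x. f (chart_inv (fst c \<inter> W, snd c) x))"
      using smfD[OF S(3) c'] eq by simp
    then show "smooth_on (snd c ` (fst c \<inter> S)) (\<lambda>x. f (chart_inv c x))"
      by (rule smooth_on_cong[OF open_image[OF c o], THEN iffD1, rotated])
        (use c sub in \<open>auto simp: chart_inv_restrict\<close>)
  qed
  then show ?thesis using o S by (intro smooth_nearI) auto
qed

section \<open>Bump functions on a Hausdorff manifold\<close>

text \<open>
  The zero set of \<open>\<rho>\<close> contains an open set that together with \<open>U\<close> covers the manifold. This is what
  extending by zero a product of \<open>\<rho>\<close> with a function on \<open>U\<close> requires.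
\<close>

definition supported_in :: "('m \<Rightarrow> real) \<Rightarrow> 'm set \<Rightarrow> bool" where
  "supported_in \<rho> U \<longleftrightarrow> smf C (carrier C) \<rho> \<and>
     (\<exists>W. openin (atlas_topology C) W \<and> U \<union> W = carrier C \<and> (\<forall>q\<in>W. \<rho> q = 0))"

lemma supported_in_near: "supported_in \<rho> U \<Longrightarrow> p \<in> carrier C \<Longrightarrow> smooth_near C p \<rho>"
  using smf_near[OF openin_carrier, of \<rho>] by (simp add: supported_in_def)

lemma supported_in_cases:
  assumes "supported_in \<rho> U" "p \<in> carrier C"
  obtains "p \<in> U"
    | W where "openin (atlas_topology C) W" "p \<in> W" "\<forall>q\<in>W. \<rho> q = 0" "p \<notin> U" "\<rho> p = 0"
  using assms unfolding supported_in_def by blast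

text \<open>
  A closed coordinate ball is compact, hence closed because the manifold is Hausdorff. A cutoff
  function in coordinates whose support is such a ball therefore extends smoothly by zero.
\<close>

lemma bump:
  assumes H: "Hausdorff_space (atlas_topology C)" and U: "openin (atlas_topology C) U" "p \<in> U"
  obtains \<rho> W where "supported_in \<rho> U" "openin (atlas_topology C) W" "p \<in> W" "W \<subseteq> U" "\<forall>q\<in>W. \<rho> q = 1"
proof -
  obtain c where c: "c \<in> C" "p \<in> fst c"
    using openin_subset_carrier[OF U(1)] U(2) by (auto simp: carrier_def)
  define V where "V = fst c \<inter> U"
  have V: "openin (atlas_topology C) V" "p \<in> V" "V \<subseteq> fst c"
    using openin_chart[OF c(1)] U c unfolding V_def by auto
  have oV: "open (snd c ` V)" using open_image[OF c(1) U(1)] by (simp add: V_def)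
  then obtain r where r: "r > 0" "cball (snd c p) r \<subseteq> snd c ` V"
    using V(2) by (meson imageI open_contains_cball)
  obtain f :: "'e \<Rightarrow> real" and s where f: "smooth_on UNIV f" "0 < s" "\<And>x. x \<in> ball (snd c p) s \<Longrightarrow> f x = 1"
    "\<And>x. x \<notin> cball (snd c p) r \<Longrightarrow> f x = 0"
    using smooth_cutoff[OF r(1)] by metis
  define K where "K = chart_inv c ` cball (snd c p) r"
  have KV: "K \<subseteq> V"
  proof
    fix q assume "q \<in> K"
    then obtain x where x: "q = chart_inv c x" "x \<in> cball (snd c p) r" unfolding K_def by blast
    then obtain q' where "x = snd c q'" "q' \<in> V" using r(2) by blast
    then show "q \<in> V" using x(1) c(1) V(3) by auto
  qed
  have cont: "continuous_map (top_of_set (snd c ` V)) (atlas_topology C) (chart_inv c)"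
    unfolding continuous_map
  proof (intro conjI allI impI)
    show "chart_inv c ` topspace (top_of_set (snd c ` V)) \<subseteq> topspace (atlas_topology C)"
      using openin_subset_carrier[OF V(1)] inv_left[OF c(1) subsetD[OF V(3)]] by auto
    fix S assume S: "openin (atlas_topology C) S"
    have "{x \<in> topspace (top_of_set (snd c ` V)). chart_inv c x \<in> S} = snd c ` (fst c \<inter> (V \<inter> S))"
      using c(1) V(3) by auto
    moreover have "open (snd c ` (fst c \<inter> (V \<inter> S)))" using open_image[OF c(1)] V(1) S by blast
    ultimately show "openin (top_of_set (snd c ` V)) {x \<in> topspace (top_of_set (snd c ` V)). chart_inv c x \<in> S}"
      using V(3) by (auto intro!: open_subset)
  qed
  have "compactin (top_of_set (snd c ` V)) (cball (snd c p) r)"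
    using r(2) by (simp add: compactin_subtopology compactin_euclidean_iff)
  then have "compactin (atlas_topology C) K"
    unfolding K_def by (rule image_compactin[OF _ cont])
  then have "closedin (atlas_topology C) K"
    by (rule compactin_imp_closedin[OF H])
  then have oK: "openin (atlas_topology C) (carrier C - K)"
    using openin_diff[OF openin_carrier] by blast
  define \<rho> where "\<rho> q = (if q \<in> V then f (snd c q) else 0)" for q
  have zero: "\<rho> q = 0" if "q \<in> carrier C - K" for q
  proof (cases "q \<in> V")
    case True
    then have "chart_inv c (snd c q) = q" using c(1) V(3) by auto
    then have "snd c q \<notin> cball (snd c p) r"
      using that unfolding K_def by (metis DiffD2 imageI)
    then show ?thesis using f(4) by (simp add: \<rho>_def)
  qed (simp add: \<rho>_def)
  have smooth: "smf C (carrier C) \<rho>"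
  proof (rule smf_nearI)
    fix q assume q: "q \<in> carrier C"
    show "smooth_near C q \<rho>"
    proof (cases "q \<in> V")
      case True
      have "smooth_near C q (\<lambda>q. f (snd c q))"
        by (rule smooth_near_compose[OF smooth_near_chart open_UNIV _ f(1)]) (use c True V in auto)
      then show ?thesis
        by (rule smooth_near_cong[OF _ V(1) True]) (simp add: \<rho>_def)
    next
      case False
      then have "q \<in> carrier C - K" using KV q by blast
      then show ?thesis
        by (rule smooth_near_cong[OF smooth_near_const[OF q, of 0] oK]) (simp add: zero)
    qed
  qed
  define W where "W = {q \<in> V. snd c q \<in> ball (snd c p) s}"
  have oW: "openin (atlas_topology C) W"
    unfolding W_def by (rule openin_preimage[OF V(1) smf_subset[OF smf_chart[OF c(1)] V(3)] open_ball])
  have "U \<union> (carrier C - K) = carrier C"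
    using KV openin_subset_carrier[OF U(1)] by (auto simp: V_def)
  then have "supported_in \<rho> U" unfolding supported_in_def using smooth oK zero by blast
  then show thesis
  proof (rule that[OF _ oW])
    show "p \<in> W" using V(2) f(2) by (simp add: W_def)
    show "W \<subseteq> U" by (auto simp: W_def V_def)
    show "\<forall>q\<in>W. \<rho> q = 1" using f(3) by (simp add: W_def \<rho>_def)
  qed
qed

section \<open>The tangent bundle\<close>

lemma fst_natural_chart: "fst (natural_chart C c) = {w \<in> tangent_bundle C. fst w \<in> fst c}"
  and snd_natural_chart: "snd (natural_chart C c) w = (snd c (fst w), snd w c)"
  by (simp_all add: natural_chart_def)

lemma in_natural_chart:
  "c \<in> C \<Longrightarrow> w \<in> fst (natural_chart C c) \<longleftrightarrow> fst w \<in> fst c \<and> w \<in> tangent_space C (fst w)"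
  by (auto simp: fst_natural_chart tangent_bundle_iff carrier_def)

lemma inj_natural_chart:
  assumes "c \<in> C"
  shows "inj_on (snd (natural_chart C c)) (fst (natural_chart C c))"
proof (rule inj_onI)
  fix v w assume v: "v \<in> fst (natural_chart C c)" "w \<in> fst (natural_chart C c)"
    and eq: "snd (natural_chart C c) v = snd (natural_chart C c) w"
  have s: "snd c (fst v) = snd c (fst w)" "snd v c = snd w c"
    using eq by (simp_all add: snd_natural_chart)
  have m: "fst v \<in> fst c" "fst w \<in> fst c" "v \<in> tangent_space C (fst v)" "w \<in> tangent_space C (fst w)"
    using v assms by (simp_all add: in_natural_chart)
  have f: "fst v = fst w" by (rule inj_onD[OF inj[OF assms] s(1) m(1,2)])
  show "v = w"
    by (rule tangent_eqI[OF _ m(4) assms m(2) s(2)]) (use m(3) f in simp)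
qed

lemma chart_inv_natural:
  assumes "c \<in> C" "p \<in> fst c"
  shows "chart_inv (natural_chart C c) (snd c p, y) = coord_vec C c p y"
proof -
  have "chart_inv (natural_chart C c) (snd (natural_chart C c) (coord_vec C c p y)) = coord_vec C c p y"
    unfolding chart_inv_def
    by (rule inv_into_f_f[OF inj_natural_chart[OF assms(1)]]) (simp add: assms in_natural_chart)
  then show ?thesis using assms by (simp add: snd_natural_chart)
qed

lemma natural_overlap:
  assumes "c \<in> C" "d \<in> C"
  shows "snd (natural_chart C c) ` (fst (natural_chart C c) \<inter> fst (natural_chart C d)) =
    snd c ` (fst c \<inter> fst d) \<times> UNIV"
proof (intro equalityI subsetI)
  fix z assume "z \<in> snd c ` (fst c \<inter> fst d) \<times> (UNIV :: 'e set)"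
  then obtain p y where p: "z = (snd c p, y)" "p \<in> fst c" "p \<in> fst d" by blast
  then have "z = snd (natural_chart C c) (coord_vec C c p y)" using assms by (simp add: snd_natural_chart)
  moreover have "coord_vec C c p y \<in> fst (natural_chart C c) \<inter> fst (natural_chart C d)"
    using p assms by (simp add: in_natural_chart)
  ultimately show "z \<in> snd (natural_chart C c) ` (fst (natural_chart C c) \<inter> fst (natural_chart C d))"
    by blast
qed (use assms in \<open>auto simp: in_natural_chart snd_natural_chart\<close>)

text \<open>
  The coordinate changes of the tangent bundle are \<open>(x, y) \<mapsto> (\<tau> x, D\<tau> x y)\<close> for the coordinate
  changes \<open>\<tau>\<close> of the manifold.
\<close>

lemma atlas_tangent: "atlas (tangent_atlas C)"
proof
  show "Defs.smooth_atlas (tangent_atlas C)"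
    unfolding smooth_atlas_def
  proof (intro conjI ballI)
    fix c' assume "c' \<in> tangent_atlas C"
    then obtain c where c: "c \<in> C" "c' = natural_chart C c" by (auto simp: tangent_atlas_def)
    then show "inj_on (snd c') (fst c')" using inj_natural_chart by simp
    fix d' assume "d' \<in> tangent_atlas C"
    then obtain d where d: "d \<in> C" "d' = natural_chart C d" by (auto simp: tangent_atlas_def)
    define S where "S = snd c ` (fst c \<inter> fst d)"
    have im: "snd c' ` (fst c' \<inter> fst d') = S \<times> UNIV"
      unfolding S_def using natural_overlap[OF c(1) d(1)] c d by simp
    have oS: "open S" unfolding S_def by (rule open_overlap[OF c(1) d(1)])
    then have o: "open (S \<times> (UNIV :: 'e set))" by (simp add: open_Times)
    then show "open (snd c' ` (fst c' \<inter> fst d'))" unfolding im .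
    have T: "smooth_on S (transition c d)" unfolding S_def by (rule smooth_transition[OF c(1) d(1)])
    have "smooth_on (S \<times> UNIV) (\<lambda>z::'e \<times> 'e. (transition c d (fst z),
        frechet_derivative (transition c d) (at (fst z)) (snd z)))"
    proof (rule smooth_on_Pair[OF o])
      have f: "smooth_on (S \<times> UNIV) (fst :: 'e \<times> 'e \<Rightarrow> 'e)"
        by (rule smooth_on_linear[OF bounded_linear_fst o])
      show "smooth_on (S \<times> UNIV) (\<lambda>z::'e \<times> 'e. transition c d (fst z))"
        by (rule smooth_on_compose[OF f T o oS]) auto
      show "smooth_on (S \<times> UNIV) (\<lambda>z::'e \<times> 'e. frechet_derivative (transition c d) (at (fst z)) (snd z))"
        by (rule smooth_on_derivative_along[OF o oS f smooth_on_linear[OF bounded_linear_snd o] T]) auto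
    qed
    then show "smooth_on (snd c' ` (fst c' \<inter> fst d')) (transition c' d')"
      unfolding im
    proof (rule smooth_on_cong[OF o, THEN iffD1, rotated])
      fix z :: "'e \<times> 'e" assume "z \<in> S \<times> UNIV"
      then obtain p y where p: "z = (snd c p, y)" "p \<in> fst c" "p \<in> fst d"
        unfolding S_def by blast
      have "transition c' d' z = snd d' (coord_vec C c p y)"
        using chart_inv_natural[OF c(1) p(2), of y] by (simp add: transition_def c(2) p(1))
      then show "(transition c d (fst z), frechet_derivative (transition c d) (at (fst z)) (snd z)) =
          transition c' d' z"
        using p c(1) d by (simp add: snd_natural_chart coord_vec_apply jac_def)
    qed
  qed
qed

lemma carrier_tangent: "carrier (tangent_atlas C) = tangent_bundle C"
  using tangent_bundle_iff[of _ C] by (auto simp: carrier_def tangent_atlas_def fst_natural_chart)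

end

section \<open>Sections along a smooth map\<close>

text \<open>
  Vector fields on \<open>A\<close> are sections of \<open>TA\<close> along the identity of \<open>A\<close>, and anisotropic
  vector fields are sections of \<open>TM\<close> along the projection from \<open>A\<close> to \<open>M\<close>. Both are covered by
  sections of \<open>TC\<close> along a smooth map \<open>g\<close> from a manifold \<open>D\<close> to a manifold \<open>C\<close>.
\<close>

definition sections_along ::
    "('p, 'f::euclidean_space) chart set \<Rightarrow> ('m, 'e::euclidean_space) chart set \<Rightarrow> ('p \<Rightarrow> 'm)
      \<Rightarrow> ('p \<Rightarrow> ('m, 'e) tvec) set" where
  "sections_along D C g =
     {Z \<in> carrier D \<rightarrow>\<^sub>E tangent_bundle C.
        (\<forall>v\<in>carrier D. fst (Z v) = g v) \<and> smooth_map D (tangent_atlas C) Z}"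

locale along = D: atlas D + C: atlas C
  for D :: "('p, 'f::euclidean_space) chart set" and C :: "('m, 'e::euclidean_space) chart set" +
  fixes g :: "'p \<Rightarrow> 'm"
  assumes smooth_base: "smooth_map D C g"
begin

lemma base_in: "v \<in> carrier D \<Longrightarrow> g v \<in> carrier C"
  using smooth_base by (auto simp: D.smooth_map_iff)

lemma openin_base: "c \<in> C \<Longrightarrow> openin (atlas_topology D) (g -` fst c \<inter> carrier D)"
  using smooth_base by (simp add: D.smooth_map_iff)

text \<open>
  The base coordinates of a section are those of \<open>g\<close>, hence smooth; only the components of the
  tangent vectors remain to be checked, in one chart at each point.
\<close>

lemma sectionI:
  assumes "Z \<in> extensional (carrier D)" "\<And>v. v \<in> carrier D \<Longrightarrow> Z v \<in> tangent_space C (g v)"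
    "\<And>v. v \<in> carrier D \<Longrightarrow> \<exists>c\<in>C. g v \<in> fst c \<and> smooth_near D v (\<lambda>u. snd (Z u) c)"
  shows "Z \<in> sections_along D C g"
proof -
  have fst: "fst (Z v) = g v" if "v \<in> carrier D" for v
    using assms(2)[OF that] by (rule tangent_space_fst)
  have tb: "Z v \<in> tangent_bundle C" if "v \<in> carrier D" for v
    using assms(2)[OF that] base_in[OF that] fst[OF that] by (simp add: tangent_bundle_iff)
  have "smooth_map D (tangent_atlas C) Z"
  proof (rule D.smooth_mapI[OF C.atlas_tangent])
    fix v assume v: "v \<in> carrier D"
    obtain c where c: "c \<in> C" "g v \<in> fst c" "smooth_near D v (\<lambda>u. snd (Z u) c)"
      using assms(3)[OF v] by blast
    let ?S = "g -` fst c \<inter> carrier D"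
    have "smooth_near D v (\<lambda>u. (snd c (g u), snd (Z u) c))"
      by (rule D.smooth_near_Pair[OF D.smooth_map_near[OF smooth_base v c(1,2)] c(3)])
    then have "smooth_near D v (\<lambda>u. snd (natural_chart C c) (Z u))"
      by (rule D.smooth_near_cong[OF _ D.openin_carrier v]) (simp add: C.snd_natural_chart fst)
    then obtain W where W: "openin (atlas_topology D) W" "v \<in> W" "smf D W (\<lambda>u. snd (natural_chart C c) (Z u))"
      by (auto simp: smooth_near_def)
    show "\<exists>e W. e \<in> tangent_atlas C \<and> openin (atlas_topology D) W \<and> v \<in> W \<and> Z ` W \<subseteq> fst e \<and>
        smf D W (\<lambda>u. snd e (Z u))"
    proof (intro exI conjI)
      show "natural_chart C c \<in> tangent_atlas C" using c(1) by (simp add: tangent_atlas_def)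
      show "openin (atlas_topology D) (W \<inter> ?S)" using W(1) openin_base[OF c(1)] by blast
      show "v \<in> W \<inter> ?S" using W(2) v c(2) by simp
      show "Z ` (W \<inter> ?S) \<subseteq> fst (natural_chart C c)"
        using tb fst by (auto simp: C.fst_natural_chart)
      show "smf D (W \<inter> ?S) (\<lambda>u. snd (natural_chart C c) (Z u))"
        by (rule smf_subset[OF W(3)]) blast
    qed
  qed
  then show ?thesis
    using assms(1) fst tb by (auto simp: sections_along_def PiE_def)
qed

lemma section_in: "Z \<in> sections_along D C g \<Longrightarrow> v \<in> carrier D \<Longrightarrow> Z v \<in> tangent_space C (g v)"
  by (auto simp: sections_along_def tangent_bundle_iff dest!: PiE_mem)

lemma section_extensional: "Z \<in> sections_along D C g \<Longrightarrow> Z \<in> extensional (carrier D)"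
  by (auto simp: sections_along_def PiE_def)

lemma section_near:
  assumes Z: "Z \<in> sections_along D C g" and v: "v \<in> carrier D" and c: "c \<in> C" "g v \<in> fst c"
  shows "smooth_near D v (\<lambda>u. snd (Z u) c)"
proof -
  have "smooth_map D (tangent_atlas C) Z" using Z by (simp add: sections_along_def)
  moreover have "natural_chart C c \<in> tangent_atlas C" using c by (simp add: tangent_atlas_def)
  moreover have "Z v \<in> fst (natural_chart C c)"
    using section_in[OF Z v] tangent_space_fst[OF section_in[OF Z v]] c by (simp add: C.in_natural_chart)
  ultimately have "smooth_near D v (\<lambda>u. snd (natural_chart C c) (Z u))"
    using D.smooth_map_near v by blast
  from D.smooth_near_linear[OF bounded_linear_snd this] show ?thesis
    by (simp add: C.snd_natural_chart)
qed

lemma section_tcomb: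
  assumes f: "\<And>i. i \<in> I \<Longrightarrow> smf D (carrier D) (f i)" and E: "\<And>i. i \<in> I \<Longrightarrow> E i \<in> sections_along D C g"
  shows "(\<lambda>u\<in>carrier D. tcomb (g u) I (\<lambda>i. f i u) (\<lambda>i. E i u)) \<in> sections_along D C g"
proof (rule sectionI)
  fix v assume v: "v \<in> carrier D"
  show "(\<lambda>u\<in>carrier D. tcomb (g u) I (\<lambda>i. f i u) (\<lambda>i. E i u)) v \<in> tangent_space C (g v)"
    using v by (simp add: C.tcomb_in section_in[OF E])
  obtain c where c: "c \<in> C" "g v \<in> fst c" using base_in[OF v] by (auto simp: carrier_def)
  have fn: "smooth_near D v (f i)" if "i \<in> I" for i
    using f[OF that] v D.smf_near[OF D.openin_carrier] by blast
  have "smooth_near D v (\<lambda>u. \<Sum>i\<in>I. f i u *\<^sub>R snd (E i u) c)"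
    by (intro D.smooth_near_sum v D.smooth_near_bilinear[OF bounded_bilinear_scaleR] fn section_near E c)
  then have "smooth_near D v (\<lambda>u. snd ((\<lambda>u\<in>carrier D. tcomb (g u) I (\<lambda>i. f i u) (\<lambda>i. E i u)) u) c)"
    by (rule D.smooth_near_cong[OF _ D.openin_carrier v]) simp
  then show "\<exists>c\<in>C. g v \<in> fst c \<and>
      smooth_near D v (\<lambda>u. snd ((\<lambda>u\<in>carrier D. tcomb (g u) I (\<lambda>i. f i u) (\<lambda>i. E i u)) u) c)"
    using c by blast
qed auto

lemma section_tscale:
  assumes f: "smf D (carrier D) f" and Z: "Z \<in> sections_along D C g"
  shows "(\<lambda>u\<in>carrier D. tscale (f u) (Z u)) \<in> sections_along D C g"
proof -
  have "(\<lambda>u\<in>carrier D. tscale (f u) (Z u)) = (\<lambda>u\<in>carrier D. tcomb (g u) {()} (\<lambda>i. f u) (\<lambda>i. Z u))"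
    using tangent_space_fst[OF section_in[OF Z]]
    by (intro restrict_ext) (simp add: tcomb_def tscale_def)
  then show ?thesis using section_tcomb[of "{()}" "\<lambda>_. f" "\<lambda>_. Z"] assms by simp
qed

lemma section_tadd:
  assumes Y: "Y \<in> sections_along D C g" and Z: "Z \<in> sections_along D C g"
  shows "(\<lambda>u\<in>carrier D. tadd (Y u) (Z u)) \<in> sections_along D C g"
proof -
  have "(\<lambda>u\<in>carrier D. tadd (Y u) (Z u)) =
      (\<lambda>u\<in>carrier D. tcomb (g u) UNIV (\<lambda>i. 1) (\<lambda>i. (if i then Y else Z) u))"
    using tangent_space_fst[OF section_in[OF Y]]
    by (intro restrict_ext) (simp add: tcomb_def tadd_def UNIV_bool add.commute)
  moreover have "(if i then Y else Z) \<in> sections_along D C g" for i using assms by simp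
  ultimately show ?thesis
    using section_tcomb[of UNIV "\<lambda>_ _. 1" "\<lambda>i. if i then Y else Z", OF smf_const] by simp
qed

text \<open>
  A section over \<open>W\<close> becomes global after multiplication with a function supported in \<open>W\<close>.
\<close>

lemma section_extend:
  assumes \<rho>: "D.supported_in \<rho> W" and W: "openin (atlas_topology D) W"
    and Z: "\<And>u. u \<in> W \<Longrightarrow> Z u \<in> tangent_space C (g u)"
      "\<And>u. u \<in> W \<Longrightarrow> \<exists>c\<in>C. g u \<in> fst c \<and> smooth_near D u (\<lambda>u. snd (Z u) c)"
  shows "(\<lambda>u\<in>carrier D. if u \<in> W then tscale (\<rho> u) (Z u) else tzero (g u)) \<in> sections_along D C g"
    (is "?Z \<in> _")
proof (rule sectionI)
  fix v assume v: "v \<in> carrier D"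
  show "?Z v \<in> tangent_space C (g v)"
    using v Z(1) by (simp add: C.tscale_in C.tzero_in)
  show "\<exists>c\<in>C. g v \<in> fst c \<and> smooth_near D v (\<lambda>u. snd (?Z u) c)"
  proof (cases rule: D.supported_in_cases[OF \<rho> v])
    case 1
    then obtain c where c: "c \<in> C" "g v \<in> fst c" "smooth_near D v (\<lambda>u. snd (Z u) c)" using Z(2) by blast
    note r = D.supported_in_near[OF \<rho> v]
    have "smooth_near D v (\<lambda>u. snd (?Z u) c)"
      by (rule D.smooth_near_cong[OF D.smooth_near_bilinear[OF bounded_bilinear_scaleR r c(3)] W 1])
        (use D.openin_subset_carrier[OF W] in auto)
    then show ?thesis using c by blast
  next
    case (2 W')
    obtain c where c: "c \<in> C" "g v \<in> fst c" using base_in[OF v] by (auto simp: carrier_def)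
    have "smooth_near D v (\<lambda>u. snd (?Z u) c)"
      by (rule D.smooth_near_cong[OF D.smooth_near_const[OF v, of 0] 2(1,2)])
        (use 2(3) D.openin_subset_carrier[OF 2(1)] in auto)
    then show ?thesis using c by blast
  qed
qed auto

lemma frame_near:
  assumes c: "c \<in> C" and v: "v \<in> carrier D" "g v \<in> fst c"
  shows "smooth_near D v (\<lambda>u. snd (coord_vec C c (g u) e) c)"
  by (rule D.smooth_near_cong[OF D.smooth_near_const[OF v(1), of e] openin_base[OF c]]) (use v c in auto)

text \<open>
  The coordinate frame and the components of a section, both made global by multiplying with \<open>\<rho>\<close>.
\<close>

definition cut_frame :: "('p \<Rightarrow> real) \<Rightarrow> ('m, 'e) chart \<Rightarrow> 'e \<Rightarrow> 'p \<Rightarrow> ('m, 'e) tvec" where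
  "cut_frame \<rho> c e = (\<lambda>u\<in>carrier D.
     if u \<in> g -` fst c \<inter> carrier D then tscale (\<rho> u) (coord_vec C c (g u) e) else tzero (g u))"

definition cut_component ::
    "('p \<Rightarrow> real) \<Rightarrow> ('m, 'e) chart \<Rightarrow> ('p \<Rightarrow> ('m, 'e) tvec) \<Rightarrow> 'e \<Rightarrow> 'p \<Rightarrow> real" where
  "cut_component \<rho> c Z b u = (if u \<in> g -` fst c \<inter> carrier D then \<rho> u * (snd (Z u) c \<bullet> b) else 0)"

context
  fixes \<rho> c
  assumes \<rho>: "D.supported_in \<rho> (g -` fst c \<inter> carrier D)" and c: "c \<in> C"
begin

lemma cut_frame_section: "cut_frame \<rho> c e \<in> sections_along D C g"
  unfolding cut_frame_def
  by (rule section_extend[OF \<rho> openin_base[OF c]]) (use c frame_near[OF c] in auto)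

lemma cut_component_smooth:
  assumes Z: "Z \<in> sections_along D C g"
  shows "smf D (carrier D) (cut_component \<rho> c Z b)"
proof (rule D.smf_nearI)
  fix u assume u: "u \<in> carrier D"
  show "smooth_near D u (cut_component \<rho> c Z b)"
  proof (cases rule: D.supported_in_cases[OF \<rho> u])
    case 1
    have n: "smooth_near D u (\<lambda>u. snd (Z u) c \<bullet> b)"
      by (rule D.smooth_near_linear[OF bounded_linear_inner_left section_near[OF Z u c]]) (use 1 in auto)
    show ?thesis
      by (rule D.smooth_near_cong[OF D.smooth_near_bilinear[OF bounded_bilinear_mult
            D.supported_in_near[OF \<rho> u] n] openin_base[OF c] 1]) (simp add: cut_component_def)
  next
    case (2 W)
    show ?thesis
      by (rule D.smooth_near_cong[OF D.smooth_near_const[OF u, of 0] 2(1,2)])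
        (use 2(3) in \<open>simp add: cut_component_def\<close>)
  qed
qed

text \<open>
  Frame and coefficients each carry one factor \<open>\<rho>\<close>, hence the square.
\<close>

lemma cut_frame_combination:
  assumes Z: "Z \<in> sections_along D C g"
  shows "(\<lambda>u\<in>carrier D. tscale (\<rho> u * \<rho> u) (Z u)) =
    (\<lambda>u\<in>carrier D. tcomb (g u) Basis (\<lambda>b. cut_component \<rho> c Z b u) (\<lambda>b. cut_frame \<rho> c b u))"
proof (rule restrict_ext)
  fix u assume u: "u \<in> carrier D"
  note Zu = section_in[OF Z u]
  let ?t = "tcomb (g u) Basis (\<lambda>b. cut_component \<rho> c Z b u) (\<lambda>b. cut_frame \<rho> c b u)"
  show "tscale (\<rho> u * \<rho> u) (Z u) = ?t"
  proof (cases rule: D.supported_in_cases[OF \<rho> u])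
    case 1
    have "snd ?t c = (\<rho> u * \<rho> u) *\<^sub>R (\<Sum>b\<in>Basis. (snd (Z u) c \<bullet> b) *\<^sub>R b)"
      using 1 c u by (simp add: cut_component_def cut_frame_def scaleR_right.sum ac_simps)
    then have s: "snd (tscale (\<rho> u * \<rho> u) (Z u)) c = snd ?t c"
      by (simp add: euclidean_representation)
    show ?thesis
      by (rule C.tangent_eqI[OF C.tscale_in[OF Zu] C.tcomb_in[OF section_in[OF cut_frame_section u]] c _ s])
        (use 1 in auto)
  next
    case (2 W)
    then have "cut_component \<rho> c Z b u = 0" for b by (simp add: cut_component_def)
    then show ?thesis
      using tangent_space_fst[OF Zu] 2(5) by (simp add: tcomb_def tscale_def)
  qed
qed

end

end

section \<open>The manifold of directions and its tangent vectors\<close>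

text \<open>
  The second derivative of the coordinate change from \<open>c\<close> to \<open>d\<close> at \<open>p\<close>, as a bilinear map.
\<close>

definition hess :: "('m, 'e::euclidean_space) chart \<Rightarrow> ('m, 'e) chart \<Rightarrow> 'm \<Rightarrow> 'e \<Rightarrow> 'e \<Rightarrow> 'e" where
  "hess c d p a z = (\<Sum>b\<in>Basis. (z \<bullet> b) *\<^sub>R
     frechet_derivative (\<lambda>x. frechet_derivative (transition c d) (at x) b) (at (snd c p)) a)"

locale conic = C: atlas C for C :: "('m, 'e::euclidean_space) chart set" +
  fixes A :: "('m, 'e) tvec set"
  assumes openA: "openin (atlas_topology (tangent_atlas C)) A"
    and scaleA: "v \<in> A \<Longrightarrow> l > 0 \<Longrightarrow> tscale l v \<in> A"
    and Hausdorff: "Hausdorff_space (atlas_topology C)"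
begin

abbreviation "D \<equiv> domain_atlas C A"
abbreviation "dch c \<equiv> domain_chart C A c"

text \<open>The base and fibre components of a tangent vector of \<open>A\<close> in the natural coordinates.\<close>

abbreviation "xcomp c w \<equiv> fst (snd w (dch c))"
abbreviation "ycomp c w \<equiv> snd (snd w (dch c))"

sublocale T: atlas "tangent_atlas C" by (rule C.atlas_tangent)

sublocale D: atlas "domain_atlas C A"
  unfolding domain_atlas_def by (rule T.atlas_restrict[OF openA])

lemma A_tangent: "v \<in> A \<Longrightarrow> v \<in> tangent_space C (fst v)"
  and A_base: "v \<in> A \<Longrightarrow> fst v \<in> carrier C"
  using T.openin_subset_carrier[OF openA] tangent_bundle_iff[of v C] by (auto simp: C.carrier_tangent)

lemma carrier_D [simp]: "carrier D = A"
  using T.openin_subset_carrier[OF openA] by (auto simp: domain_atlas_def T.carrier_restrict)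

lemma D_eq: "D = dch ` C"
  by (auto simp: domain_atlas_def restrict_atlas_def tangent_atlas_def domain_chart_def)

lemma dom_in [simp]: "c \<in> C \<Longrightarrow> dch c \<in> D"
  by (simp add: D_eq)

lemma in_dom [simp]: "c \<in> C \<Longrightarrow> v \<in> fst (dch c) \<longleftrightarrow> v \<in> A \<and> fst v \<in> fst c"
  using A_tangent[of v] by (auto simp: domain_chart_def C.in_natural_chart)

lemma snd_dom [simp]: "snd (dch c) v = (snd c (fst v), snd v c)"
  by (simp add: domain_chart_def C.snd_natural_chart)

lemma chart_ex: "v \<in> A \<Longrightarrow> \<exists>c\<in>C. fst v \<in> fst c"
  using A_base by (auto simp: carrier_def)

lemma base_near: "c \<in> C \<Longrightarrow> v \<in> A \<Longrightarrow> fst v \<in> fst c \<Longrightarrow> smooth_near D v (\<lambda>u. snd c (fst u))"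
  using D.smooth_near_linear[OF bounded_linear_fst D.smooth_near_chart[of "dch c" v]] by simp

lemma fibre_near: "c \<in> C \<Longrightarrow> v \<in> A \<Longrightarrow> fst v \<in> fst c \<Longrightarrow> smooth_near D v (\<lambda>u. snd u c)"
  using D.smooth_near_linear[OF bounded_linear_snd D.smooth_near_chart[of "dch c" v]] by simp

lemma openin_dom: "c \<in> C \<Longrightarrow> openin (atlas_topology D) (fst (dch c))"
  by (rule D.openin_chart[OF dom_in])

lemma smooth_map_fst: "smooth_map D C fst"
proof (rule D.smooth_mapI[OF C.atlas_axioms])
  fix v assume "v \<in> carrier D"
  then have v: "v \<in> A" by simp
  then obtain c where c: "c \<in> C" "fst v \<in> fst c" using chart_ex by blast
  have "smf D (fst (dch c)) (\<lambda>q. snd c (fst q))"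
    using base_near[OF c(1)] c(1) by (simp add: D.smf_near[OF openin_dom])
  then show "\<exists>e W. e \<in> C \<and> openin (atlas_topology D) W \<and> v \<in> W \<and> fst ` W \<subseteq> fst e \<and>
      smf D W (\<lambda>q. snd e (fst q))"
    using c v openin_dom[OF c(1)] by (intro exI[of _ c] exI[of _ "fst (dch c)"]) auto
qed

lemma smooth_map_id: "smooth_map D D (\<lambda>v. v)"
proof (rule D.smooth_mapI[OF D.atlas_axioms])
  fix v assume "v \<in> carrier D"
  then obtain c where c: "c \<in> D" "v \<in> fst c" by (auto simp: carrier_def)
  then show "\<exists>e W. e \<in> D \<and> openin (atlas_topology D) W \<and> v \<in> W \<and> (\<lambda>v. v) ` W \<subseteq> fst e \<and>
      smf D W (\<lambda>q. snd e q)"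
    using D.smf_chart[OF c(1)] D.openin_chart[OF c(1)]
    by (intro exI[of _ c] exI[of _ "fst c"]) auto
qed

sublocale AF: along "domain_atlas C A" C fst
  by unfold_locales (rule smooth_map_fst)

sublocale VF: along "domain_atlas C A" "domain_atlas C A" "\<lambda>v. v"
  by unfold_locales (rule smooth_map_id)

lemma anisotropic_fields_eq: "anisotropic_fields C A = sections_along D C fst"
  by (simp add: anisotropic_fields_def sections_along_def)

lemma vector_fields_eq: "vector_fields D A = sections_along D D (\<lambda>v. v)"
proof -
  have "restrict_atlas D A = D"
  proof -
    have "(fst c \<inter> A, snd c) = c" if "c \<in> D" for c
      using that by (auto simp: D_eq prod_eq_iff)
    then show ?thesis unfolding restrict_atlas_def by simp
  qed
  then show ?thesis by (simp add: vector_fields_def sections_along_def)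
qed

text \<open>
  Directions over different base points are separated by open sets of \<open>M\<close>, directions over the same
  point by their coordinates in a chart.
\<close>

lemma hausdorff_D: "Hausdorff_space (atlas_topology D)"
  unfolding Hausdorff_space_def
proof (intro allI impI)
  fix v w assume "v \<in> topspace (atlas_topology D) \<and> w \<in> topspace (atlas_topology D) \<and> v \<noteq> w"
  then have v: "v \<in> A" "w \<in> A" "v \<noteq> w" by auto
  have pre: "openin (atlas_topology D) {u \<in> A. fst u \<in> U}" if U: "openin (atlas_topology C) U" for U
  proof (subst openin_subopen, rule ballI)
    fix u assume u: "u \<in> {u \<in> A. fst u \<in> U}"
    then obtain c where c: "c \<in> C" "fst u \<in> fst c" using chart_ex by blast
    let ?S = "{q \<in> fst (dch c). snd c (fst q) \<in> snd c ` (fst c \<inter> U)}"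
    have "smf D (fst (dch c)) (\<lambda>q. snd c (fst q))"
      using base_near[OF c(1)] c(1) by (simp add: D.smf_near[OF openin_dom])
    then have "openin (atlas_topology D) ?S"
      by (rule D.openin_preimage[OF openin_dom[OF c(1)] _ C.open_image[OF c(1) U]])
    moreover have "?S \<subseteq> {u \<in> A. fst u \<in> U}"
    proof
      fix q assume "q \<in> ?S"
      then obtain p where "q \<in> A" "fst q \<in> fst c" "p \<in> fst c" "p \<in> U" "snd c (fst q) = snd c p"
        using c(1) by auto
      then show "q \<in> {u \<in> A. fst u \<in> U}" using inj_onD[OF C.inj[OF c(1)], of "fst q" p] by simp
    qed
    moreover have "u \<in> ?S" using u c by auto
    ultimately show "\<exists>T. openin (atlas_topology D) T \<and> u \<in> T \<and> T \<subseteq> {u \<in> A. fst u \<in> U}" by blast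
  qed
  show "\<exists>U V. openin (atlas_topology D) U \<and> openin (atlas_topology D) V \<and> v \<in> U \<and> w \<in> V \<and> disjnt U V"
  proof (cases "fst v = fst w")
    case False
    then obtain U V where U: "openin (atlas_topology C) U" "openin (atlas_topology C) V"
      "fst v \<in> U" "fst w \<in> V" "disjnt U V"
      using Hausdorff A_base[OF v(1)] A_base[OF v(2)] unfolding Hausdorff_space_def by (metis C.topspace)
    show ?thesis
      using pre[OF U(1)] pre[OF U(2)] U(3-5) v
      by (intro exI[of _ "{u \<in> A. fst u \<in> U}"] exI[of _ "{u \<in> A. fst u \<in> V}"]) (auto simp: disjnt_iff)
  next
    case True
    obtain c where c: "c \<in> C" "fst v \<in> fst c" using chart_ex[OF v(1)] by blast
    have "snd (dch c) v \<noteq> snd (dch c) w"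
      using inj_onD[OF D.inj[OF dom_in[OF c(1)]], of v w] v c True by auto
    then obtain U V where U: "open U" "open V" "snd (dch c) v \<in> U" "snd (dch c) w \<in> V" "U \<inter> V = {}"
      using separation_t2[of "snd (dch c) v" "snd (dch c) w"] by metis
    have o: "openin (atlas_topology D) {u \<in> fst (dch c). snd (dch c) u \<in> S}" if "open S" for S
      by (rule D.openin_preimage[OF openin_dom[OF c(1)] D.smf_chart[OF dom_in[OF c(1)]] that])
    show ?thesis
    proof (intro exI conjI)
      show "disjnt {u \<in> fst (dch c). snd (dch c) u \<in> U} {u \<in> fst (dch c). snd (dch c) u \<in> V}"
        using U(5) unfolding disjnt_iff by blast
    qed (use o U v c True in auto)
  qed
qed

lemma xcomp_vdd:
  assumes w: "w \<in> tangent_space D v" and v: "v \<in> A" and c: "c \<in> C" "fst v \<in> fst c"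
  shows "vdd D w (\<lambda>u. snd c (fst u)) = xcomp c w"
    and "vdd D w (\<lambda>u. snd u c) = ycomp c w"
proof -
  have n: "smooth_near D v (snd (dch c))" by (rule D.smooth_near_chart) (use v c in auto)
  have e: "vdd D w (snd (dch c)) = snd w (dch c)" by (rule D.vdd_coord[OF w]) (use v c in auto)
  show "vdd D w (\<lambda>u. snd c (fst u)) = xcomp c w"
    using D.vdd_linear[OF w n bounded_linear_fst] e by simp
  show "vdd D w (\<lambda>u. snd u c) = ycomp c w"
    using D.vdd_linear[OF w n bounded_linear_snd] e by simp
qed

lemma xcomp_change:
  assumes w: "w \<in> tangent_space D v" and v: "v \<in> A"
    and c: "c \<in> C" "fst v \<in> fst c" and d: "d \<in> C" "fst v \<in> fst d"
  shows "xcomp d w = jac c d (fst v) (xcomp c w)"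
proof -
  have "xcomp d w = vdd D w (\<lambda>u. snd d (fst u))" using xcomp_vdd[OF w v d] by simp
  also have "\<dots> = vdd D w (\<lambda>u. transition c d (snd c (fst u)))"
    by (rule D.vdd_cong[OF w openin_dom[OF c(1)]]) (use v c in auto)
  also have "\<dots> = jac c d (fst v) (vdd D w (\<lambda>u. snd c (fst u)))"
    by (rule D.vdd_compose[OF w base_near[OF c(1) v c(2)]]) (rule C.jac_has_derivative[OF c(1) d(1) c(2) d(2)])
  finally show ?thesis using xcomp_vdd[OF w v c] by simp
qed

text \<open>
  The components of a section along the projection in two charts differ by the Jacobian of the
  coordinate change, which itself varies with the base point; differentiating it produces the second
  derivatives of the coordinate change.
\<close>

lemma vdd_change:
  assumes w: "w \<in> tangent_space D v" and v: "v \<in> A"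
    and c: "c \<in> C" "fst v \<in> fst c" and d: "d \<in> C" "fst v \<in> fst d"
    and W: "openin (atlas_topology D) W" "v \<in> W" "\<And>u. u \<in> W \<Longrightarrow> Z u \<in> tangent_space C (fst u)"
    and Z: "smooth_near D v (\<lambda>u. snd (Z u) d)"
  shows "vdd D w (\<lambda>u. snd (Z u) c) =
    jac d c (fst v) (vdd D w (\<lambda>u. snd (Z u) d)) + hess d c (fst v) (xcomp d w) (snd (Z v) d)"
proof -
  let ?J = "\<lambda>b x. frechet_derivative (transition d c) (at x) b"
  let ?V = "W \<inter> (fst (dch c) \<inter> fst (dch d))"
  have oV: "openin (atlas_topology D) ?V" using W(1) openin_dom[OF c(1)] openin_dom[OF d(1)] by blast
  have vV: "v \<in> ?V" using W(2) v c d by simp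
  have lin: "jac d c p z = (\<Sum>b\<in>Basis. (z \<bullet> b) *\<^sub>R ?J b (snd d p))" if "p \<in> fst c" "p \<in> fst d" for p z
    using linear_Basis_expansion[OF C.jac_linear[OF d(1) c(1) that(2,1)], of z] by (simp add: jac_def)
  let ?S = "snd d ` (fst d \<inter> fst c)"
  have S: "open ?S" "snd d (fst v) \<in> ?S" using C.open_overlap[OF d(1) c(1)] c d by auto
  have Jb: "smooth_on ?S (?J b)" for b by (rule smooth_on_derivative[OF C.smooth_transition[OF d(1) c(1)]])
  have nJ: "smooth_near D v (\<lambda>u. ?J b (snd d (fst u)))" for b
    by (rule D.smooth_near_compose[OF base_near[OF d(1) v d(2)] S Jb])
  have dJ: "vdd D w (\<lambda>u. ?J b (snd d (fst u))) = frechet_derivative (?J b) (at (snd d (fst v))) (xcomp d w)" for b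
    using D.vdd_compose[OF w base_near[OF d(1) v d(2)] smooth_on_has_derivative[OF Jb S(2)]]
      xcomp_vdd[OF w v d] by simp
  have nZ: "smooth_near D v (\<lambda>u. snd (Z u) d \<bullet> b)" for b
    by (rule D.smooth_near_linear[OF bounded_linear_inner_left Z])
  have dZ: "vdd D w (\<lambda>u. snd (Z u) d \<bullet> b) = vdd D w (\<lambda>u. snd (Z u) d) \<bullet> b" for b
    by (rule D.vdd_linear[OF w Z bounded_linear_inner_left])
  have "vdd D w (\<lambda>u. snd (Z u) c) = vdd D w (\<lambda>u. \<Sum>b\<in>Basis. (snd (Z u) d \<bullet> b) *\<^sub>R ?J b (snd d (fst u)))"
  proof (rule D.vdd_cong[OF w oV vV])
    fix u assume u: "u \<in> ?V"
    then have f: "fst u \<in> fst c" "fst u \<in> fst d" using c d by auto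
    have "snd (Z u) c = jac d c (fst u) (snd (Z u) d)"
      by (rule C.tangent_comp[OF W(3) d(1) c(1) f(2,1)]) (use u in blast)
    then show "snd (Z u) c = (\<Sum>b\<in>Basis. (snd (Z u) d \<bullet> b) *\<^sub>R ?J b (snd d (fst u)))"
      using lin[OF f] by metis
  qed
  also have "\<dots> = (\<Sum>b\<in>Basis. vdd D w (\<lambda>u. (snd (Z u) d \<bullet> b) *\<^sub>R ?J b (snd d (fst u))))"
    by (rule D.vdd_sum[OF w]) (use v D.smooth_near_bilinear[OF bounded_bilinear_scaleR nZ nJ] in auto)
  also have "\<dots> = (\<Sum>b\<in>Basis. (snd (Z v) d \<bullet> b) *\<^sub>R frechet_derivative (?J b) (at (snd d (fst v))) (xcomp d w)
      + (vdd D w (\<lambda>u. snd (Z u) d) \<bullet> b) *\<^sub>R ?J b (snd d (fst v)))"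
    by (simp add: D.vdd_bilinear[OF bounded_bilinear_scaleR w nZ nJ] dJ dZ)
  also have "\<dots> = hess d c (fst v) (xcomp d w) (snd (Z v) d) + jac d c (fst v) (vdd D w (\<lambda>u. snd (Z u) d))"
    by (simp add: sum.distrib hess_def lin[OF c(2) d(2)])
  finally show ?thesis by (simp add: add.commute)
qed

lemma hess_zero_left [simp]:
  assumes "c \<in> C" "p \<in> fst c" "d \<in> C" "p \<in> fst d"
  shows "hess c d p 0 z = 0"
proof -
  have "linear (frechet_derivative (\<lambda>x. frechet_derivative (transition c d) (at x) b) (at (snd c p)))" for b
    by (rule has_derivative_linear[OF smooth_on_has_derivative[OF
          smooth_on_derivative[OF C.smooth_transition[OF assms(1,3)]]]]) (use assms in auto)
  then show ?thesis by (simp add: hess_def linear_0)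
qed

text \<open>
  The fibre coordinates of \<open>u\<close> are the components of \<open>u\<close> itself, viewed as a section along the
  projection; for a vertical vector the second derivatives of the coordinate change do not contribute.
\<close>

lemma ycomp_change_vertical:
  assumes w: "w \<in> tangent_space D v" and v: "v \<in> A"
    and c: "c \<in> C" "fst v \<in> fst c" and d: "d \<in> C" "fst v \<in> fst d" and vert: "xcomp d w = 0"
  shows "ycomp c w = jac d c (fst v) (ycomp d w)"
  using vdd_change[OF w v c d D.openin_carrier _ _ fibre_near[OF d(1) v d(2)]] v A_tangent vert
    xcomp_vdd[OF w v c] xcomp_vdd[OF w v d] c d by simp

lemma tangent_fst:
  assumes w: "w \<in> tangent_space D v" and v: "v \<in> A"
  shows "tangent_map D C fst w \<in> tangent_space C (fst v)"
    and "c \<in> C \<Longrightarrow> fst v \<in> fst c \<Longrightarrow> snd (tangent_map D C fst w) c = xcomp c w"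
  using D.tangent_map_apply[OF C.atlas_axioms smooth_map_fst w] v xcomp_vdd[OF w v] by simp_all

lemma vertical_space_iff:
  assumes v: "v \<in> A" and c: "c \<in> C" "fst v \<in> fst c"
  shows "w \<in> vertical_space C A v \<longleftrightarrow> w \<in> tangent_space D v \<and> xcomp c w = 0"
proof -
  have "tangent_map D C fst w = tzero (fst v) \<longleftrightarrow> xcomp c w = 0" if w: "w \<in> tangent_space D v"
  proof
    assume "tangent_map D C fst w = tzero (fst v)"
    then show "xcomp c w = 0" using tangent_fst(2)[OF w v c] by simp
  next
    assume "xcomp c w = 0"
    then have "snd (tangent_map D C fst w) c = snd (tzero (fst v)) c"
      using tangent_fst(2)[OF w v c] by simp
    then show "tangent_map D C fst w = tzero (fst v)"
      by (rule C.tangent_eqI[OF tangent_fst(1)[OF w v] C.tzero_in c])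
  qed
  then show ?thesis by (auto simp: vertical_space_def)
qed

section \<open>The vertical bundle as a manifold\<close>

abbreviation "VA \<equiv> vertical_atlas C A"
abbreviation "vch c \<equiv> vertical_chart C A c"

text \<open>The vertical vector at \<open>v\<close> with fibre component \<open>z\<close> in the chart \<open>c\<close>.\<close>

definition vert :: "('m, 'e) chart \<Rightarrow> ('m, 'e) tvec \<Rightarrow> 'e \<Rightarrow> ('m, 'e) ttvec" where
  "vert c v z = coord_vec D (dch c) v (0, z)"

lemma vertical_bundle_iff:
  assumes c: "c \<in> C" "fst (fst e) \<in> fst c"
  shows "e \<in> vertical_bundle C A \<longleftrightarrow> fst e \<in> A \<and> e \<in> tangent_space D (fst e) \<and> xcomp c e = 0"
proof -
  have "fst e = v" if "e \<in> vertical_space C A v" for v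
    using that tangent_space_fst[of e D v] by (simp add: vertical_space_def)
  then have "e \<in> vertical_bundle C A \<longleftrightarrow> fst e \<in> A \<and> e \<in> vertical_space C A (fst e)"
    unfolding vertical_bundle_def by blast
  then show ?thesis using vertical_space_iff[OF _ c] by blast
qed

lemma vertical_bundle_fst: "e \<in> vertical_bundle C A \<Longrightarrow> fst e \<in> A"
  by (auto simp: vertical_bundle_def vertical_space_def dest: tangent_space_fst)

lemma vert:
  assumes v: "v \<in> A" and c: "c \<in> C" "fst v \<in> fst c"
  shows "fst (vert c v z) = v" "vert c v z \<in> tangent_space D v" "snd (vert c v z) (dch c) = (0, z)"
    "vert c v z \<in> vertical_bundle C A"
  using v c vertical_bundle_iff[of c "vert c v z"] by (simp_all add: vert_def)

lemma vert_comp: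
  assumes v: "v \<in> A" and c: "c \<in> C" "fst v \<in> fst c" and d: "d \<in> C" "fst v \<in> fst d"
  shows "snd (vert c v z) (dch d) = (0, jac c d (fst v) z)"
proof -
  note w = vert[OF v c, of z]
  have "xcomp d (vert c v z) = 0"
    using xcomp_change[OF w(2) v c d] w(3) linear_0[OF C.jac_linear[OF c(1) d(1) c(2) d(2)]] by simp
  moreover have "ycomp d (vert c v z) = jac c d (fst v) z"
    using ycomp_change_vertical[OF w(2) v d c] w(3) by simp
  ultimately show ?thesis by (simp add: prod_eq_iff)
qed

lemma fst_vch: "c \<in> C \<Longrightarrow> e \<in> fst (vch c) \<longleftrightarrow> e \<in> vertical_bundle C A \<and> fst (fst e) \<in> fst c"
  using vertical_bundle_fst[of e] by (auto simp: vertical_chart_def)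

lemma snd_vch [simp]: "snd (vch c) e = ((snd c (fst (fst e)), snd (fst e) c), ycomp c e)"
  by (simp add: vertical_chart_def)

lemma vertical_collapse:
  assumes "e \<in> vertical_bundle C A" "c \<in> C" "fst (fst e) \<in> fst c"
  shows "vert c (fst e) (ycomp c e) = e"
proof -
  have e: "fst e \<in> A" "e \<in> tangent_space D (fst e)" "xcomp c e = 0"
    using assms vertical_bundle_iff by blast+
  have s: "snd e (dch c) = (0, ycomp c e)" using e(3) by (simp add: prod_eq_iff)
  show ?thesis
    unfolding vert_def s[symmetric]
    by (rule D.coord_vec_collapse[OF e(2)]) (use assms e in auto)
qed

lemma inj_vch:
  assumes c: "c \<in> C"
  shows "inj_on (snd (vch c)) (fst (vch c))"
proof (rule inj_onI)
  fix e f assume e: "e \<in> fst (vch c)" "f \<in> fst (vch c)" and eq: "snd (vch c) e = snd (vch c) f"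
  then have m: "e \<in> vertical_bundle C A" "fst (fst e) \<in> fst c" "f \<in> vertical_bundle C A" "fst (fst f) \<in> fst c"
    using fst_vch[OF c] by blast+
  have "snd (dch c) (fst e) = snd (dch c) (fst f)" using eq by simp
  then have "fst e = fst f"
    by (rule inj_onD[OF D.inj[OF dom_in[OF c]]]) (use m c vertical_bundle_fst in auto)
  moreover have "ycomp c e = ycomp c f" using eq by simp
  ultimately show "e = f"
    using vertical_collapse[OF m(1) c m(2)] vertical_collapse[OF m(3) c m(4)] by metis
qed

lemma vch_vert:
  "v \<in> A \<Longrightarrow> c \<in> C \<Longrightarrow> fst v \<in> fst c \<Longrightarrow> vert c v z \<in> fst (vch c)"
  "v \<in> A \<Longrightarrow> c \<in> C \<Longrightarrow> fst v \<in> fst c \<Longrightarrow> snd (vch c) (vert c v z) = (snd (dch c) v, z)"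
  using vert[of v c z] by (simp_all add: fst_vch)

lemma chart_inv_vch:
  assumes "v \<in> A" "c \<in> C" "fst v \<in> fst c"
  shows "chart_inv (vch c) (snd (dch c) v, z) = vert c v z"
  using inv_into_f_f[OF inj_vch[OF assms(2)] vch_vert(1)[OF assms]] vch_vert(2)[OF assms]
  unfolding chart_inv_def by metis

lemma vch_overlap:
  assumes c: "c \<in> C" and d: "d \<in> C"
  shows "snd (vch c) ` (fst (vch c) \<inter> fst (vch d)) = snd (dch c) ` (fst (dch c) \<inter> fst (dch d)) \<times> UNIV"
proof (intro equalityI subsetI)
  fix q assume "q \<in> snd (dch c) ` (fst (dch c) \<inter> fst (dch d)) \<times> (UNIV :: 'e set)"
  then obtain v z where v: "q = (snd (dch c) v, z)" "v \<in> fst (dch c)" "v \<in> fst (dch d)" by blast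
  then have v': "v \<in> A" "fst v \<in> fst c" "fst v \<in> fst d" using c d by auto
  have "vert c v z \<in> fst (vch c) \<inter> fst (vch d)"
    using vert[OF v'(1) c v'(2)] v' c d by (simp add: fst_vch)
  moreover have "q = snd (vch c) (vert c v z)" using vch_vert(2)[OF v'(1) c v'(2)] v(1) by simp
  ultimately show "q \<in> snd (vch c) ` (fst (vch c) \<inter> fst (vch d))" by blast
next
  fix q assume "q \<in> snd (vch c) ` (fst (vch c) \<inter> fst (vch d))"
  then obtain e where e: "q = snd (vch c) e" "e \<in> fst (vch c)" "e \<in> fst (vch d)" by blast
  then have "fst e \<in> fst (dch c) \<inter> fst (dch d)"
    using c d vertical_bundle_fst by (simp add: fst_vch)
  moreover have "q = (snd (dch c) (fst e), ycomp c e)" using e(1) by simp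
  ultimately show "q \<in> snd (dch c) ` (fst (dch c) \<inter> fst (dch d)) \<times> UNIV" by blast
qed

text \<open>
  A coordinate change of the vertical bundle is the coordinate change \<open>\<tau>\<close> of \<open>A\<close> together with
  the derivative of \<open>\<tau>\<close> restricted to vertical vectors.
\<close>

lemma atlas_vertical: "atlas (vertical_atlas C A)"
proof
  show "Defs.smooth_atlas VA"
    unfolding smooth_atlas_def
  proof (intro conjI ballI)
    fix c' assume "c' \<in> VA"
    then obtain c where c: "c \<in> C" "c' = vch c" by (auto simp: vertical_atlas_def)
    then show "inj_on (snd c') (fst c')" using inj_vch by simp
    fix d' assume "d' \<in> VA"
    then obtain d where d: "d \<in> C" "d' = vch d" by (auto simp: vertical_atlas_def)
    define S where "S = snd (dch c) ` (fst (dch c) \<inter> fst (dch d))"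
    let ?t = "transition (dch c) (dch d)"
    have im: "snd c' ` (fst c' \<inter> fst d') = S \<times> UNIV"
      unfolding S_def using vch_overlap[OF c(1) d(1)] c d by simp
    have oS: "open S" unfolding S_def by (rule D.open_overlap[OF dom_in[OF c(1)] dom_in[OF d(1)]])
    then have o: "open (S \<times> (UNIV :: 'e set))" by (simp add: open_Times)
    then show "open (snd c' ` (fst c' \<inter> fst d'))" unfolding im .
    have T: "smooth_on S ?t" unfolding S_def by (rule D.smooth_transition[OF dom_in[OF c(1)] dom_in[OF d(1)]])
    have "smooth_on (S \<times> UNIV) (\<lambda>q::('e \<times> 'e) \<times> 'e. (?t (fst q),
        snd (frechet_derivative ?t (at (fst q)) (0, snd q))))"
    proof (rule smooth_on_Pair[OF o])
      have f: "smooth_on (S \<times> UNIV) (fst :: ('e \<times> 'e) \<times> 'e \<Rightarrow> _)"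
        by (rule smooth_on_linear[OF bounded_linear_fst o])
      show "smooth_on (S \<times> UNIV) (\<lambda>q::('e \<times> 'e) \<times> 'e. ?t (fst q))"
        by (rule smooth_on_compose[OF f T o oS]) auto
      have g: "smooth_on (S \<times> UNIV) (\<lambda>q::('e \<times> 'e) \<times> 'e. (0::'e, snd q))"
        by (intro smooth_on_Pair[OF o] smooth_on_const smooth_on_linear[OF bounded_linear_snd o])
      show "smooth_on (S \<times> UNIV) (\<lambda>q::('e \<times> 'e) \<times> 'e. snd (frechet_derivative ?t (at (fst q)) (0, snd q)))"
        by (rule smooth_on_linear_compose[OF bounded_linear_snd o smooth_on_derivative_along[OF o oS f g T]]) auto
    qed
    then show "smooth_on (snd c' ` (fst c' \<inter> fst d')) (transition c' d')"
      unfolding im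
    proof (rule smooth_on_cong[OF o, THEN iffD1, rotated])
      fix q :: "('e \<times> 'e) \<times> 'e" assume "q \<in> S \<times> UNIV"
      then obtain v z where v: "q = (snd (dch c) v, z)" "v \<in> fst (dch c)" "v \<in> fst (dch d)"
        unfolding S_def by blast
      then have v': "v \<in> A" "fst v \<in> fst c" "fst v \<in> fst d" using c d by auto
      have "transition c' d' q = snd d' (vert c v z)"
        unfolding transition_def c(2) v(1) o_apply chart_inv_vch[OF v'(1) c(1) v'(2)] ..
      also have "\<dots> = (snd (dch d) v, ycomp d (vert c v z))"
        using vert(1)[OF v'(1) c(1) v'(2)] by (simp add: d(2))
      also have "ycomp d (vert c v z) = snd (frechet_derivative ?t (at (fst q)) (0, snd q))"
        using D.coord_vec_apply[of "dch d" v "dch c" "(0, z)"] v(3) d(1)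
        unfolding vert_def v(1) jac_def by simp
      also have "snd (dch d) v = ?t (fst q)"
        using D.transition_apply[OF dom_in[OF c(1)] v(2), of "dch d"] by (simp add: v(1))
      finally show "(?t (fst q), snd (frechet_derivative ?t (at (fst q)) (0, snd q))) = transition c' d' q" ..
    qed
  qed
qed

sublocale VA: atlas "vertical_atlas C A" by (rule atlas_vertical)

lemma carrier_VA [simp]: "carrier VA = vertical_bundle C A"
proof -
  have "e \<in> carrier VA \<longleftrightarrow> (\<exists>c\<in>C. e \<in> vertical_bundle C A \<and> fst (fst e) \<in> fst c)" for e
    using fst_vch unfolding carrier_def vertical_atlas_def by blast
  then show ?thesis using chart_ex vertical_bundle_fst by blast
qed

lemma vch_in [simp]: "c \<in> C \<Longrightarrow> vch c \<in> VA" by (simp add: vertical_atlas_def)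

text \<open>
  The lift does not depend on the chart through which it is defined, since vertical vectors of \<open>A\<close> and
  tangent vectors of \<open>M\<close> transform by the same Jacobian.
\<close>

lemma vertical_lift_comp:
  assumes v: "v \<in> A" and z: "z \<in> tangent_space C (fst v)" and c: "c \<in> C" "fst v \<in> fst c"
  shows "vertical_lift C A v z = vert c v (snd z c)"
proof -
  define d where "d = chart_at C (fst v)"
  have d: "d \<in> C" "fst v \<in> fst d"
    using A_base[OF v] by (simp_all add: d_def chart_at_in in_chart_at)
  have eq: "vertical_lift C A v z = vert d v (snd z d)"
    by (simp add: vertical_lift_def vert_def d_def Let_def)
  have "snd (vert d v (snd z d)) (dch c) = (0, snd z c)"
    using vert_comp[OF v d c, of "snd z d"] C.tangent_comp[OF z d(1) c(1) d(2) c(2)] by simp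
  then have "snd (vert d v (snd z d)) (dch c) = snd (vert c v (snd z c)) (dch c)"
    using vert(3)[OF v c] by simp
  then show ?thesis unfolding eq
    by (rule D.tangent_eqI[OF vert(2)[OF v d] vert(2)[OF v c], rotated 2]) (use v c in auto)
qed

text \<open>
  In coordinates the section of the vertical bundle given by \<open>Z\<close> is \<open>(x, y) \<mapsto> ((x, y), Z)\<close>, and its
  velocity in the direction \<open>w\<close> is \<open>(w, w (Z))\<close>.
\<close>

lemma smooth_lift:
  assumes Z: "Z \<in> sections_along D C fst"
  shows "smooth_map D VA (\<lambda>v. vertical_lift C A v (Z v))"
    and "w \<in> tangent_space D v \<Longrightarrow> v \<in> A \<Longrightarrow> c \<in> C \<Longrightarrow> fst v \<in> fst c \<Longrightarrow>
      snd (tangent_map D VA (\<lambda>v. vertical_lift C A v (Z v)) w) (vch c) =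
        (snd w (dch c), vdd D w (\<lambda>u. snd (Z u) c))"
proof -
  let ?L = "\<lambda>v. vertical_lift C A v (Z v)"
  have L: "?L u = vert c u (snd (Z u) c)" if "u \<in> fst (dch c)" "c \<in> C" for u c
    using that AF.section_in[OF Z, of u] by (intro vertical_lift_comp) auto
  have eq: "(snd (dch c) u, snd (Z u) c) = snd (vch c) (?L u)" if u: "u \<in> fst (dch c)" "c \<in> C" for u c
    unfolding L[OF u] using vch_vert(2)[of u c] u by simp
  have near: "smooth_near D v (\<lambda>u. (snd (dch c) u, snd (Z u) c))"
    if "v \<in> A" "c \<in> C" "fst v \<in> fst c" for v c
    by (rule D.smooth_near_Pair[OF D.smooth_near_chart AF.section_near[OF Z]]) (use that in auto)
  show sm: "smooth_map D VA ?L"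
  proof (rule D.smooth_mapI[OF atlas_vertical])
    fix v assume "v \<in> carrier D"
    then have v: "v \<in> A" by simp
    then obtain c where c: "c \<in> C" "fst v \<in> fst c" using chart_ex by blast
    have "smf D (fst (dch c)) (\<lambda>u. (snd (dch c) u, snd (Z u) c))"
      unfolding D.smf_near[OF openin_dom[OF c(1)]] using near c(1) by auto
    then have "smf D (fst (dch c)) (\<lambda>u. snd (vch c) (?L u))"
      by (rule D.smf_cong[OF openin_dom[OF c(1)], THEN iffD1, rotated]) (use eq c in blast)
    moreover have "?L ` fst (dch c) \<subseteq> fst (vch c)"
    proof (rule image_subsetI)
      fix u assume u: "u \<in> fst (dch c)"
      show "?L u \<in> fst (vch c)"
        unfolding L[OF u c(1)] by (rule vch_vert(1)) (use u c in auto)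
    qed
    ultimately show "\<exists>e W. e \<in> VA \<and> openin (atlas_topology D) W \<and> v \<in> W \<and> ?L ` W \<subseteq> fst e \<and>
        smf D W (\<lambda>q. snd e (?L q))"
      using c v openin_dom[OF c(1)] by (intro exI[of _ "vch c"] exI[of _ "fst (dch c)"]) simp
  qed
  assume w: "w \<in> tangent_space D v" and v: "v \<in> A" and c: "c \<in> C" "fst v \<in> fst c"
  have vd: "v \<in> fst (dch c)" using v c by simp
  have nd: "smooth_near D v (snd (dch c))" by (rule D.smooth_near_chart) (use vd c in auto)
  have nz: "smooth_near D v (\<lambda>u. snd (Z u) c)" by (rule AF.section_near[OF Z]) (use v c in auto)
  have "snd (tangent_map D VA ?L w) (vch c) = vdd D w (\<lambda>u. snd (vch c) (?L u))"
    by (rule D.tangent_map_apply(2)[OF atlas_vertical sm w])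
      (use v c L[OF vd c(1)] vch_vert(1)[OF v c] in simp_all)
  also have "\<dots> = vdd D w (\<lambda>u. (snd (dch c) u, snd (Z u) c))"
    by (rule D.vdd_cong[OF w openin_dom[OF c(1)] vd]) (use eq c in metis)
  finally have *: "snd (tangent_map D VA ?L w) (vch c) = vdd D w (\<lambda>u. (snd (dch c) u, snd (Z u) c))" .
  have "fst (vdd D w (\<lambda>u. (snd (dch c) u, snd (Z u) c))) = vdd D w (snd (dch c))"
    using D.vdd_linear[OF w near[OF v c] bounded_linear_fst] by (simp del: snd_dom)
  moreover have "vdd D w (snd (dch c)) = snd w (dch c)"
    by (rule D.vdd_coord[OF w]) (use vd c in auto)
  moreover have "snd (vdd D w (\<lambda>u. (snd (dch c) u, snd (Z u) c))) = vdd D w (\<lambda>u. snd (Z u) c)"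
    using D.vdd_linear[OF w near[OF v c] bounded_linear_snd] by (simp del: snd_dom)
  ultimately show "snd (tangent_map D VA ?L w) (vch c) = (snd w (dch c), vdd D w (\<lambda>u. snd (Z u) c))"
    unfolding * by (intro prod_eqI) (simp_all del: snd_dom)
qed

section \<open>Homotheties\<close>

lemma bounded_linear_scale_fibre:
  "bounded_linear (\<lambda>q::'a::real_normed_vector \<times> 'b::real_normed_vector. (fst q, l *\<^sub>R snd q))"
  by (intro bounded_linear_Pair bounded_linear_fst bounded_linear_scaleR_right
      bounded_linear_compose[OF bounded_linear_scaleR_right bounded_linear_snd])

lemma smooth_tscale:
  assumes l: "l > 0"
  shows "smooth_map D D (tscale l)"
    and "w \<in> tangent_space D v \<Longrightarrow> v \<in> A \<Longrightarrow> tangent_map D D (tscale l) w \<in> tangent_space D (tscale l v)"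
    and "w \<in> tangent_space D v \<Longrightarrow> v \<in> A \<Longrightarrow> c \<in> C \<Longrightarrow> fst v \<in> fst c \<Longrightarrow>
      snd (tangent_map D D (tscale l) w) (dch c) = (xcomp c w, l *\<^sub>R ycomp c w)"
proof -
  have near: "smooth_near D v (\<lambda>u. snd (dch c) (tscale l u))"
    and vdd: "w \<in> tangent_space D v \<Longrightarrow> vdd D w (\<lambda>u. snd (dch c) (tscale l u)) = (xcomp c w, l *\<^sub>R ycomp c w)"
    if v: "v \<in> A" "c \<in> C" "fst v \<in> fst c" for v c w
  proof -
    have n: "smooth_near D v (snd (dch c))" by (rule D.smooth_near_chart) (use v in auto)
    show "smooth_near D v (\<lambda>u. snd (dch c) (tscale l u))"
      using D.smooth_near_linear[OF bounded_linear_scale_fibre[of l] n] by simp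
    assume w: "w \<in> tangent_space D v"
    have "vdd D w (snd (dch c)) = snd w (dch c)" by (rule D.vdd_coord[OF w]) (use v in auto)
    then show "vdd D w (\<lambda>u. snd (dch c) (tscale l u)) = (xcomp c w, l *\<^sub>R ycomp c w)"
      using D.vdd_linear[OF w n bounded_linear_scale_fibre[of l]] by simp
  qed
  show sm: "smooth_map D D (tscale l)"
  proof (rule D.smooth_mapI[OF D.atlas_axioms])
    fix v assume "v \<in> carrier D"
    then have v: "v \<in> A" by simp
    then obtain c where c: "c \<in> C" "fst v \<in> fst c" using chart_ex by blast
    have "smf D (fst (dch c)) (\<lambda>u. snd (dch c) (tscale l u))"
      unfolding D.smf_near[OF openin_dom[OF c(1)]] using near c(1) by auto
    then show "\<exists>e W. e \<in> D \<and> openin (atlas_topology D) W \<and> v \<in> W \<and> tscale l ` W \<subseteq> fst e \<and>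
        smf D W (\<lambda>q. snd e (tscale l q))"
      using c v openin_dom[OF c(1)] scaleA[OF _ l]
      by (intro exI[of _ "dch c"] exI[of _ "fst (dch c)"]) (auto simp del: snd_dom)
  qed
  assume w: "w \<in> tangent_space D v" and v: "v \<in> A"
  show "tangent_map D D (tscale l) w \<in> tangent_space D (tscale l v)"
    by (rule D.tangent_map_apply(1)[OF D.atlas_axioms sm w]) (use v in simp)
  assume c: "c \<in> C" "fst v \<in> fst c"
  have "snd (tangent_map D D (tscale l) w) (dch c) = vdd D w (\<lambda>u. snd (dch c) (tscale l u))"
    by (rule D.tangent_map_apply(2)[OF D.atlas_axioms sm w]) (use v c scaleA[OF v l] in simp_all)
  then show "snd (tangent_map D D (tscale l) w) (dch c) = (xcomp c w, l *\<^sub>R ycomp c w)"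
    using vdd[OF v c w] by simp
qed

lemma vertical_homothety_vert:
  assumes l: "l > 0" and v: "v \<in> A" and c: "c \<in> C" "fst v \<in> fst c"
  shows "vertical_homothety C A l (vert c v z) = vert c (tscale l v) (l *\<^sub>R z)"
proof -
  note w = vert[OF v c, of z]
  have lv: "tscale l v \<in> A" "fst (tscale l v) \<in> fst c" using scaleA[OF v l] c by auto
  have s: "snd (tangent_map D D (tscale l) (vert c v z)) (dch c) = snd (vert c (tscale l v) (l *\<^sub>R z)) (dch c)"
    using smooth_tscale(3)[OF l w(2) v c] w(3) vert(3)[OF lv(1) c(1) lv(2)] by simp
  show ?thesis unfolding vertical_homothety_def
    by (rule D.tangent_eqI[OF smooth_tscale(2)[OF l w(2) v] vert(2)[OF lv(1) c(1) lv(2)] _ _ s])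
      (use lv c in auto)
qed

lemma smooth_vertical_homothety:
  assumes l: "l > 0"
  shows "smooth_map VA VA (vertical_homothety C A l)"
    and "\<xi> \<in> tangent_space VA (vert c v z) \<Longrightarrow> v \<in> A \<Longrightarrow> c \<in> C \<Longrightarrow> fst v \<in> fst c \<Longrightarrow>
      tangent_map VA VA (vertical_homothety C A l) \<xi> \<in> tangent_space VA (vert c (tscale l v) (l *\<^sub>R z))"
    and "\<xi> \<in> tangent_space VA (vert c v z) \<Longrightarrow> v \<in> A \<Longrightarrow> c \<in> C \<Longrightarrow> fst v \<in> fst c \<Longrightarrow>
      snd (tangent_map VA VA (vertical_homothety C A l) \<xi>) (vch c) =
        ((fst (fst (snd \<xi> (vch c))), l *\<^sub>R snd (fst (snd \<xi> (vch c)))), l *\<^sub>R snd (snd \<xi> (vch c)))"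
proof -
  let ?h = "vertical_homothety C A l"
  define L where "L q = ((fst (fst q), l *\<^sub>R snd (fst q)), l *\<^sub>R snd q)" for q :: "('e \<times> 'e) \<times> 'e"
  have L: "bounded_linear L"
    unfolding L_def
    by (intro bounded_linear_Pair bounded_linear_scaleR_right
        bounded_linear_compose[OF bounded_linear_scaleR_right]
        bounded_linear_compose[OF bounded_linear_fst] bounded_linear_compose[OF bounded_linear_snd]
        bounded_linear_fst bounded_linear_snd)
  have h: "?h e \<in> fst (vch c)" "snd (vch c) (?h e) = L (snd (vch c) e)"
    if e: "e \<in> fst (vch c)" "c \<in> C" for e c
  proof -
    have m: "e \<in> vertical_bundle C A" "fst (fst e) \<in> fst c" "fst e \<in> A"
      using e fst_vch vertical_bundle_fst by blast+
    have lv: "tscale l (fst e) \<in> A" "fst (tscale l (fst e)) \<in> fst c" using scaleA[OF m(3) l] m by auto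
    have he: "?h e = vert c (tscale l (fst e)) (l *\<^sub>R ycomp c e)"
      using vertical_homothety_vert[OF l m(3) e(2) m(2), of "ycomp c e"] vertical_collapse[OF m(1) e(2) m(2)]
      by simp
    show "?h e \<in> fst (vch c)" unfolding he by (rule vch_vert(1)[OF lv(1) e(2) lv(2)])
    show "snd (vch c) (?h e) = L (snd (vch c) e)"
      unfolding he vch_vert(2)[OF lv(1) e(2) lv(2)] by (simp add: L_def)
  qed
  show sm: "smooth_map VA VA ?h"
  proof (rule VA.smooth_mapI[OF atlas_vertical])
    fix e assume "e \<in> carrier VA"
    then have "e \<in> vertical_bundle C A" by simp
    then obtain c where c: "c \<in> C" "e \<in> fst (vch c)"
      using chart_ex vertical_bundle_fst fst_vch by blast
    have o: "openin (atlas_topology VA) (fst (vch c))" by (rule VA.openin_chart) (use c in simp)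
    have "smf VA (fst (vch c)) (\<lambda>e. L (snd (vch c) e))"
      by (rule VA.smf_linear[OF o L VA.smf_chart]) (use c in simp)
    then have "smf VA (fst (vch c)) (\<lambda>e. snd (vch c) (?h e))"
      by (rule VA.smf_cong[OF o, THEN iffD1, rotated]) (use h(2) c in metis)
    then show "\<exists>f W. f \<in> VA \<and> openin (atlas_topology VA) W \<and> e \<in> W \<and> ?h ` W \<subseteq> fst f \<and>
        smf VA W (\<lambda>q. snd f (?h q))"
      using c o h(1)[OF _ c(1)] by (intro exI[of _ "vch c"] exI[of _ "fst (vch c)"]) (auto simp del: snd_vch)
  qed
  assume \<xi>: "\<xi> \<in> tangent_space VA (vert c v z)" and v: "v \<in> A" and c: "c \<in> C" "fst v \<in> fst c"
  have e: "vert c v z \<in> fst (vch c)" by (rule vch_vert(1)[OF v c])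
  have eq: "?h (vert c v z) = vert c (tscale l v) (l *\<^sub>R z)" by (rule vertical_homothety_vert[OF l v c])
  have car: "vert c v z \<in> carrier VA" using vert(4)[OF v c] by simp
  show "tangent_map VA VA ?h \<xi> \<in> tangent_space VA (vert c (tscale l v) (l *\<^sub>R z))"
    using VA.tangent_map_apply(1)[OF atlas_vertical sm \<xi> car] unfolding eq .
  have "snd (tangent_map VA VA ?h \<xi>) (vch c) = vdd VA \<xi> (\<lambda>e. snd (vch c) (?h e))"
    by (rule VA.tangent_map_apply(2)[OF atlas_vertical sm \<xi> car]) (use h(1)[OF e c(1)] c in simp_all)
  also have "\<dots> = vdd VA \<xi> (\<lambda>e. L (snd (vch c) e))"
    by (rule VA.vdd_cong[OF \<xi> VA.openin_chart[OF vch_in[OF c(1)]] e]) (rule h(2)[OF _ c(1)])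
  also have "\<dots> = L (vdd VA \<xi> (snd (vch c)))"
    by (rule VA.vdd_linear[OF \<xi> VA.smooth_near_chart[OF vch_in[OF c(1)] e] L])
  also have "vdd VA \<xi> (snd (vch c)) = snd \<xi> (vch c)"
    by (rule VA.vdd_coord[OF \<xi> vch_in[OF c(1)] e])
  finally show "snd (tangent_map VA VA ?h \<xi>) (vch c) =
      ((fst (fst (snd \<xi> (vch c))), l *\<^sub>R snd (fst (snd \<xi> (vch c)))), l *\<^sub>R snd (snd \<xi> (vch c)))"
    by (simp add: L_def)
qed

end

section \<open>Linear connections in local coordinates\<close>

context conic
begin

abbreviation "VFs \<equiv> sections_along D D (\<lambda>v. v)"
abbreviation "AFs \<equiv> sections_along D C fst"

text \<open>A section of \<open>TM\<close> along the projection that is defined and smooth near \<open>v\<close>.\<close>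

definition section_germ :: "('m, 'e) tvec \<Rightarrow> (('m, 'e) tvec \<Rightarrow> ('m, 'e) tvec) \<Rightarrow> bool" where
  "section_germ v Z \<longleftrightarrow> (\<exists>W. openin (atlas_topology D) W \<and> v \<in> W \<and>
     (\<forall>u\<in>W. Z u \<in> tangent_space C (fst u) \<and> (\<exists>c\<in>C. fst u \<in> fst c \<and> smooth_near D u (\<lambda>u. snd (Z u) c))))"

lemma extend_section:
  assumes "section_germ v Z"
  obtains Z' W where "Z' \<in> AFs" "openin (atlas_topology D) W" "v \<in> W" "\<forall>u\<in>W. Z' u = Z u"
proof -
  obtain U where U: "openin (atlas_topology D) U" "v \<in> U"
    "\<And>u. u \<in> U \<Longrightarrow> Z u \<in> tangent_space C (fst u)"
    "\<And>u. u \<in> U \<Longrightarrow> \<exists>c\<in>C. fst u \<in> fst c \<and> smooth_near D u (\<lambda>u. snd (Z u) c)"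
    using assms unfolding section_germ_def by blast
  obtain \<rho> W where b: "D.supported_in \<rho> U" "openin (atlas_topology D) W" "v \<in> W" "W \<subseteq> U" "\<forall>q\<in>W. \<rho> q = 1"
    by (rule D.bump[OF hausdorff_D U(1,2)]) blast
  let ?Z = "\<lambda>u\<in>carrier D. if u \<in> U then tscale (\<rho> u) (Z u) else tzero (fst u)"
  have Z: "?Z \<in> AFs" by (rule AF.section_extend[OF b(1) U(1) U(3,4)])
  have "\<forall>u\<in>W. ?Z u = Z u"
    using b(4,5) D.openin_subset_carrier[OF b(2)] by (auto simp: tscale_def)
  then show thesis by (rule that[OF Z b(2,3)])
qed

lemma base_preimage: "c \<in> C \<Longrightarrow> fst -` fst c \<inter> carrier D = fst (dch c)"
  "c \<in> C \<Longrightarrow> (\<lambda>u. u) -` fst (dch c) \<inter> carrier D = fst (dch c)"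
  by auto

lemma extend_vector:
  assumes w: "w \<in> tangent_space D v" and v: "v \<in> A"
  obtains X where "X \<in> VFs" "X v = w"
proof -
  obtain c where c: "c \<in> C" "fst v \<in> fst c" using chart_ex[OF v] by blast
  have U: "openin (atlas_topology D) (fst (dch c))" "v \<in> fst (dch c)" using openin_dom c v by auto
  obtain \<rho> W where b: "D.supported_in \<rho> (fst (dch c))" "v \<in> W" "\<forall>q\<in>W. \<rho> q = 1"
    by (rule D.bump[OF hausdorff_D U]) blast
  show thesis
  proof (rule that)
    show "VF.cut_frame \<rho> (dch c) (snd w (dch c)) \<in> VFs"
      by (rule VF.cut_frame_section) (use b(1) c base_preimage(2) in simp_all)
    show "VF.cut_frame \<rho> (dch c) (snd w (dch c)) v = w"
      using U(2) v b(2,3) D.coord_vec_collapse[OF w dom_in[OF c(1)] U(2)]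
      by (simp add: VF.cut_frame_def tscale_def)
  qed
qed

lemma section_component_near:
  "Z \<in> AFs \<Longrightarrow> v \<in> A \<Longrightarrow> c \<in> C \<Longrightarrow> fst v \<in> fst c \<Longrightarrow> smooth_near D v (\<lambda>u. snd (Z u) c)"
  by (rule AF.section_near) auto

lemma field_component_near:
  "X \<in> VFs \<Longrightarrow> v \<in> A \<Longrightarrow> c \<in> C \<Longrightarrow> fst v \<in> fst c \<Longrightarrow> smooth_near D v (\<lambda>u. snd (X u) (dch c))"
  by (rule VF.section_near) auto

lemma field_in: "X \<in> VFs \<Longrightarrow> v \<in> A \<Longrightarrow> X v \<in> tangent_space D v"
  by (rule VF.section_in) auto

lemma section_in: "Z \<in> AFs \<Longrightarrow> v \<in> A \<Longrightarrow> Z v \<in> tangent_space C (fst v)"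
  by (rule AF.section_in) auto

lemma frame_germ:
  assumes v: "v \<in> A" and c: "c \<in> C" "fst v \<in> fst c"
  shows "section_germ v (\<lambda>u. coord_vec C c (fst u) z)"
  unfolding section_germ_def
proof (intro exI[of _ "fst (dch c)"] conjI ballI)
  show "openin (atlas_topology D) (fst (dch c))" "v \<in> fst (dch c)" using openin_dom c v by auto
  fix u assume u: "u \<in> fst (dch c)"
  show "coord_vec C c (fst u) z \<in> tangent_space C (fst u)" using u c by simp
  have "smooth_near D u (\<lambda>u. snd (coord_vec C c (fst u) z) c)"
    by (rule AF.frame_near[OF c(1)]) (use u c in auto)
  then show "\<exists>d\<in>C. fst u \<in> fst d \<and> smooth_near D u (\<lambda>u. snd (coord_vec C c (fst u) z) d)"
    using u c by auto
qed

lemma section_germ_of_section: "Z \<in> AFs \<Longrightarrow> v \<in> A \<Longrightarrow> section_germ v Z"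
  unfolding section_germ_def using D.openin_carrier section_in section_component_near chart_ex
  by (intro exI[of _ A]) (metis carrier_D)

end

locale koszul = conic C A
  for C :: "('m, 'e::euclidean_space) chart set" and A +
  fixes nabla :: "('m, 'e) koszul"
  assumes linear_connection: "linear_connection C A nabla"
begin

lemma nabla_in: "X \<in> VFs \<Longrightarrow> Z \<in> AFs \<Longrightarrow> nabla X Z \<in> AFs"
  using linear_connection unfolding linear_connection_def vector_fields_eq anisotropic_fields_eq
  by (blast dest: PiE_mem)

lemma nabla_tangent: "X \<in> VFs \<Longrightarrow> Z \<in> AFs \<Longrightarrow> v \<in> A \<Longrightarrow> nabla X Z v \<in> tangent_space C (fst v)"
  by (rule section_in[OF nabla_in])

lemma fst_nabla: "X \<in> VFs \<Longrightarrow> Z \<in> AFs \<Longrightarrow> v \<in> A \<Longrightarrow> fst (nabla X Z v) = fst v"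
  by (rule tangent_space_fst[OF nabla_tangent])

lemma nabla_add_field:
  "X \<in> VFs \<Longrightarrow> Y \<in> VFs \<Longrightarrow> Z \<in> AFs \<Longrightarrow> v \<in> A \<Longrightarrow>
    nabla (\<lambda>u\<in>A. tadd (X u) (Y u)) Z v = tadd (nabla X Z v) (nabla Y Z v)"
  using linear_connection unfolding linear_connection_def vector_fields_eq anisotropic_fields_eq by blast

lemma nabla_scale_field:
  "smf D A f \<Longrightarrow> X \<in> VFs \<Longrightarrow> Z \<in> AFs \<Longrightarrow> v \<in> A \<Longrightarrow>
    nabla (\<lambda>u\<in>A. tscale (f u) (X u)) Z v = tscale (f v) (nabla X Z v)"
  using linear_connection
  unfolding linear_connection_def vector_fields_eq anisotropic_fields_eq smooth_fun_on_eq_smf by blast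

lemma nabla_add_section:
  "X \<in> VFs \<Longrightarrow> Y \<in> AFs \<Longrightarrow> Z \<in> AFs \<Longrightarrow> v \<in> A \<Longrightarrow>
    nabla X (\<lambda>u\<in>A. tadd (Y u) (Z u)) v = tadd (nabla X Y v) (nabla X Z v)"
  using linear_connection unfolding linear_connection_def vector_fields_eq anisotropic_fields_eq by blast

lemma nabla_leibniz:
  "smf D A f \<Longrightarrow> X \<in> VFs \<Longrightarrow> Z \<in> AFs \<Longrightarrow> v \<in> A \<Longrightarrow>
    nabla X (\<lambda>u\<in>A. tscale (f u) (Z u)) v = tadd (tscale (vdd D (X v) f) (Z v)) (tscale (f v) (nabla X Z v))"
  using linear_connection
  unfolding linear_connection_def vector_fields_eq anisotropic_fields_eq smooth_fun_on_eq_smf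
    dir_deriv_eq_vdd by blast

lemma nabla_tcomb_field:
  assumes "finite I" and Z: "Z \<in> AFs" and v: "v \<in> A"
    and "\<And>i. i \<in> I \<Longrightarrow> smf D A (f i)" "\<And>i. i \<in> I \<Longrightarrow> E i \<in> VFs"
  shows "nabla (\<lambda>u\<in>A. tcomb u I (\<lambda>i. f i u) (\<lambda>i. E i u)) Z v =
    tcomb (fst v) I (\<lambda>i. f i v) (\<lambda>i. nabla (E i) Z v)"
  using assms(1,4,5)
proof (induction I rule: finite_induct)
  case empty
  let ?X = "\<lambda>u\<in>A. tcomb u {} (\<lambda>i. f i u) (\<lambda>i. E i u)"
  have X: "?X \<in> VFs" using VF.section_tcomb[of "{}" f E] by simp
  have eq: "(\<lambda>u\<in>A. tscale 0 (?X u)) = ?X"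
    by (intro restrict_ext tvec_eqI) auto
  have "nabla ?X Z v = tscale 0 (nabla ?X Z v)"
    using nabla_scale_field[OF smf_const X Z v, of 0] unfolding eq .
  then have s: "snd (nabla ?X Z v) c = 0" for c
    using snd_tscale[of 0 "nabla ?X Z v" c] by simp
  show ?case
    by (rule tvec_eqI) (simp_all only: fst_nabla[OF X Z v] s fst_tcomb snd_tcomb sum.empty)
next
  case (insert i I)
  let ?X = "\<lambda>u\<in>A. tcomb u I (\<lambda>i. f i u) (\<lambda>i. E i u)"
  let ?Y = "\<lambda>u\<in>A. tscale (f i u) (E i u)"
  have X: "?X \<in> VFs" using VF.section_tcomb[of I f E] insert.prems by simp
  have Y: "?Y \<in> VFs" using VF.section_tscale[of "f i" "E i"] insert.prems by simp
  have "fst (E i u) = u" if "u \<in> A" for u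
    by (rule tangent_space_fst[OF field_in[OF _ that]]) (use insert.prems in blast)
  then have "(\<lambda>u\<in>A. tcomb u (insert i I) (\<lambda>i. f i u) (\<lambda>i. E i u)) = (\<lambda>u\<in>A. tadd (?Y u) (?X u))"
    using insert.hyps by (intro restrict_ext tvec_eqI) auto
  then have "nabla (\<lambda>u\<in>A. tcomb u (insert i I) (\<lambda>i. f i u) (\<lambda>i. E i u)) Z v =
      tadd (nabla ?Y Z v) (nabla ?X Z v)"
    using nabla_add_field[OF Y X Z v] by simp
  also have "nabla ?Y Z v = tscale (f i v) (nabla (E i) Z v)"
    by (rule nabla_scale_field) (use insert.prems Z v in auto)
  also have "nabla ?X Z v = tcomb (fst v) I (\<lambda>i. f i v) (\<lambda>i. nabla (E i) Z v)"
    using insert by blast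
  finally show ?case
    using insert.hyps fst_nabla[OF _ Z v, of "E i"] insert.prems by (intro tvec_eqI) auto
qed

lemma nabla_tcomb_section:
  assumes "finite I" and X: "X \<in> VFs" and v: "v \<in> A"
    and "\<And>i. i \<in> I \<Longrightarrow> smf D A (f i)" "\<And>i. i \<in> I \<Longrightarrow> E i \<in> AFs"
  shows "snd (nabla X (\<lambda>u\<in>A. tcomb (fst u) I (\<lambda>i. f i u) (\<lambda>i. E i u)) v) c =
    (\<Sum>i\<in>I. vdd D (X v) (f i) *\<^sub>R snd (E i v) c + f i v *\<^sub>R snd (nabla X (E i) v) c)"
  using assms(1,4,5)
proof (induction I rule: finite_induct)
  case empty
  let ?Z = "\<lambda>u\<in>A. tcomb (fst u) {} (\<lambda>i. f i u) (\<lambda>i. E i u)"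
  have Z: "?Z \<in> AFs" using AF.section_tcomb[of "{}" f E] by simp
  have eq: "(\<lambda>u\<in>A. tscale 0 (?Z u)) = ?Z"
    by (intro restrict_ext tvec_eqI) auto
  have Zv: "snd (?Z v) c = 0" using v by simp
  have "nabla X ?Z v = tadd (tscale (vdd D (X v) (\<lambda>_. 0)) (?Z v)) (tscale 0 (nabla X ?Z v))"
    using nabla_leibniz[OF smf_const X Z v, of 0] unfolding eq .
  then have "snd (nabla X ?Z v) c =
      snd (tadd (tscale (vdd D (X v) (\<lambda>_. 0)) (?Z v)) (tscale 0 (nabla X ?Z v))) c"
    by (rule arg_cong)
  also have "\<dots> = 0" unfolding snd_tadd snd_tscale Zv by simp
  finally show ?case unfolding sum.empty .
next
  case (insert i I)
  let ?Z = "\<lambda>u\<in>A. tcomb (fst u) I (\<lambda>i. f i u) (\<lambda>i. E i u)"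
  let ?Y = "\<lambda>u\<in>A. tscale (f i u) (E i u)"
  have Z: "?Z \<in> AFs" using AF.section_tcomb[of I f E] insert.prems by simp
  have Y: "?Y \<in> AFs" using AF.section_tscale[of "f i" "E i"] insert.prems by simp
  have "fst (E i u) = fst u" if "u \<in> A" for u
    by (rule tangent_space_fst[OF section_in[OF _ that]]) (use insert.prems in blast)
  then have "(\<lambda>u\<in>A. tcomb (fst u) (insert i I) (\<lambda>i. f i u) (\<lambda>i. E i u)) = (\<lambda>u\<in>A. tadd (?Y u) (?Z u))"
    using insert.hyps by (intro restrict_ext tvec_eqI) auto
  then have "nabla X (\<lambda>u\<in>A. tcomb (fst u) (insert i I) (\<lambda>i. f i u) (\<lambda>i. E i u)) v =
      tadd (nabla X ?Y v) (nabla X ?Z v)"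
    using nabla_add_section[OF X Y Z v] by simp
  also have "nabla X ?Y v = tadd (tscale (vdd D (X v) (f i)) (E i v)) (tscale (f i v) (nabla X (E i) v))"
    by (rule nabla_leibniz) (use insert.prems X v in auto)
  finally show ?case
    using insert by simp
qed

text \<open>
  Locality and tensoriality in one step. Let \<open>\<rho>\<close> be a bump function that is \<open>1\<close> near \<open>v\<close> and
  supported in the chart. Then \<open>\<rho>\<^sup>2 X\<close> is the global combination of the fields \<open>\<rho> E\<^sub>b\<close>, for the
  coordinate frame \<open>E\<^sub>b\<close>, with the global coefficients \<open>\<rho> X\<^sup>b\<close>, and likewise for \<open>Z\<close>. So
  the axioms, which are about global sections only, already give the coordinate formula.
\<close>

lemma nabla_coordinates:
  assumes v: "v \<in> A" and c: "c \<in> C" "fst v \<in> fst c"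
  obtains g :: "'e \<times> 'e \<Rightarrow> 'e \<Rightarrow> 'e" where
    "\<forall>X\<in>VFs. \<forall>Z\<in>AFs. snd (nabla X Z v) c = vdd D (X v) (\<lambda>u. snd (Z u) c) +
       (\<Sum>b\<in>Basis. \<Sum>j\<in>Basis. (snd (X v) (dch c) \<bullet> b) *\<^sub>R (snd (Z v) c \<bullet> j) *\<^sub>R g b j)"
proof -
  let ?U = "fst (dch c)"
  have U: "openin (atlas_topology D) ?U" "v \<in> ?U" using openin_dom c v by auto
  obtain \<rho> W where b: "D.supported_in \<rho> ?U" "openin (atlas_topology D) W" "v \<in> W" "W \<subseteq> ?U" "\<forall>q\<in>W. \<rho> q = 1"
    by (rule D.bump[OF hausdorff_D U]) blast
  have \<rho>v: "\<rho> v = 1" using b(3,5) by blast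
  let ?E = "VF.cut_frame \<rho> (dch c)" and ?P = "AF.cut_frame \<rho> c"
  have \<rho>V: "D.supported_in \<rho> ((\<lambda>u. u) -` fst (dch c) \<inter> carrier D)" using b(1) base_preimage(2)[OF c(1)] by simp
  have \<rho>A: "D.supported_in \<rho> (fst -` fst c \<inter> carrier D)" using b(1) base_preimage(1)[OF c(1)] by simp
  note E = VF.cut_frame_section[OF \<rho>V dom_in[OF c(1)]] and P = AF.cut_frame_section[OF \<rho>A c(1)]
  define g where "g b j = snd (nabla (?E b) (?P j) v) c" for b j
  let ?r = "\<lambda>u. \<rho> u * \<rho> u"
  have "smf D (carrier D) \<rho>" using b(1) by (simp add: D.supported_in_def)
  from D.smf_bilinear[OF bounded_bilinear_mult D.openin_carrier this this] have r: "smf D A ?r" by simp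
  have field: "nabla X Z v = tcomb (fst v) Basis (\<lambda>b. snd (X v) (dch c) \<bullet> b) (\<lambda>b. nabla (?E b) Z v)"
    if X: "X \<in> VFs" and Z: "Z \<in> AFs" for X Z
  proof -
    let ?f = "VF.cut_component \<rho> (dch c) X"
    have f: "smf D A (?f b)" for b
      using VF.cut_component_smooth[OF \<rho>V dom_in[OF c(1)] X] by simp
    have eq: "(\<lambda>u\<in>A. tscale (?r u) (X u)) = (\<lambda>u\<in>A. tcomb u Basis (\<lambda>b. ?f b u) (\<lambda>b. ?E b u))"
      using VF.cut_frame_combination[OF \<rho>V dom_in[OF c(1)] X] by simp
    have "tscale (?r v) (nabla X Z v) = tcomb (fst v) Basis (\<lambda>b. ?f b v) (\<lambda>b. nabla (?E b) Z v)"
      by (rule trans[OF nabla_scale_field[OF r X Z v, unfolded eq, symmetric]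
            nabla_tcomb_field[OF finite_Basis Z v f E]])
    then show ?thesis using U(2) v \<rho>v by (simp add: VF.cut_component_def tscale_def)
  qed
  show thesis
  proof (rule that[of g], intro ballI)
    fix X Z assume X: "X \<in> VFs" and Z: "Z \<in> AFs"
    let ?f = "AF.cut_component \<rho> c Z"
    have f: "smf D A (?f b)" for b
      using AF.cut_component_smooth[OF \<rho>A c(1) Z] by simp
    have eq: "(\<lambda>u\<in>A. tscale (?r u) (Z u)) = (\<lambda>u\<in>A. tcomb (fst u) Basis (\<lambda>b. ?f b u) (\<lambda>b. ?P b u))"
      using AF.cut_frame_combination[OF \<rho>A c(1) Z] by simp
    have Xv: "X v \<in> tangent_space D v" by (rule field_in[OF X v])
    have nZ: "smooth_near D v (\<lambda>u. snd (Z u) c)" by (rule section_component_near[OF Z v c])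
    have "vdd D (X v) ?r = vdd D (X v) (\<lambda>_. 1)"
      by (rule D.vdd_cong[OF Xv b(2,3)]) (simp add: b(5))
    then have "vdd D (X v) ?r = 0" using D.vdd_const[OF Xv, of 1] v by simp
    then have "snd (nabla X Z v) c = snd (nabla X (\<lambda>u\<in>A. tscale (?r u) (Z u)) v) c"
      using nabla_leibniz[OF r X Z v] by (simp add: \<rho>v)
    also have "\<dots> = (\<Sum>j\<in>Basis. vdd D (X v) (?f j) *\<^sub>R snd (?P j v) c + ?f j v *\<^sub>R snd (nabla X (?P j) v) c)"
      unfolding eq by (rule nabla_tcomb_section[OF finite_Basis X v f P])
    also have "\<dots> = (\<Sum>j\<in>Basis. (vdd D (X v) (\<lambda>u. snd (Z u) c) \<bullet> j) *\<^sub>R j +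
        (snd (Z v) c \<bullet> j) *\<^sub>R snd (nabla X (?P j) v) c)"
    proof (rule sum.cong[OF refl])
      fix j :: 'e
      have "vdd D (X v) (?f j) = vdd D (X v) (\<lambda>u. snd (Z u) c \<bullet> j)"
        by (rule D.vdd_cong[OF Xv b(2,3)]) (use b(4,5) c in \<open>auto simp: AF.cut_component_def\<close>)
      also have "\<dots> = vdd D (X v) (\<lambda>u. snd (Z u) c) \<bullet> j"
        by (rule D.vdd_linear[OF Xv nZ bounded_linear_inner_left])
      finally show "vdd D (X v) (?f j) *\<^sub>R snd (?P j v) c + ?f j v *\<^sub>R snd (nabla X (?P j) v) c =
        (vdd D (X v) (\<lambda>u. snd (Z u) c) \<bullet> j) *\<^sub>R j + (snd (Z v) c \<bullet> j) *\<^sub>R snd (nabla X (?P j) v) c"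
        using v c by (simp add: AF.cut_component_def AF.cut_frame_def \<rho>v)
    qed
    also have "\<dots> = vdd D (X v) (\<lambda>u. snd (Z u) c) + (\<Sum>j\<in>Basis. (snd (Z v) c \<bullet> j) *\<^sub>R snd (nabla X (?P j) v) c)"
      by (simp add: sum.distrib euclidean_representation)
    also have "(\<Sum>j\<in>Basis. (snd (Z v) c \<bullet> j) *\<^sub>R snd (nabla X (?P j) v) c) =
        (\<Sum>j\<in>Basis. \<Sum>b\<in>Basis. (snd (X v) (dch c) \<bullet> b) *\<^sub>R (snd (Z v) c \<bullet> j) *\<^sub>R g b j)"
      unfolding field[OF X P] snd_tcomb g_def scaleR_right.sum
      by (intro sum.cong refl) (simp add: mult.commute)
    also have "\<dots> = (\<Sum>b\<in>Basis. \<Sum>j\<in>Basis. (snd (X v) (dch c) \<bullet> b) *\<^sub>R (snd (Z v) c \<bullet> j) *\<^sub>R g b j)"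
      by (rule sum.swap)
    finally show "snd (nabla X Z v) c = vdd D (X v) (\<lambda>u. snd (Z u) c) +
       (\<Sum>b\<in>Basis. \<Sum>j\<in>Basis. (snd (X v) (dch c) \<bullet> b) *\<^sub>R (snd (Z v) c \<bullet> j) *\<^sub>R g b j)" .
  qed
qed

text \<open>
  By the coordinate formula the derivative at \<open>v\<close> depends on the field and on the section only through the
  value of the field at \<open>v\<close> and the germ of the section, so all extensions give the same result.
\<close>

lemma koszul_at_eq:
  assumes v: "v \<in> A" and X: "X \<in> VFs" "X v = w" and Z: "Z' \<in> AFs"
    and W: "openin (atlas_topology D) W" "v \<in> W" "\<forall>u\<in>W. Z' u = Z u"
  shows "koszul_at C A nabla w Z = nabla X Z' v"
proof -
  have w: "w \<in> tangent_space D v" using field_in[OF X(1) v] X(2) by simp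
  have fw: "fst w = v" by (rule tangent_space_fst[OF w])
  show ?thesis unfolding koszul_at_def
  proof (rule the_equality)
    show "\<exists>Xa\<in>vector_fields D A. \<exists>Z''\<in>anisotropic_fields C A. Xa (fst w) = w \<and>
        (\<exists>W. openin (atlas_topology D) W \<and> fst w \<in> W \<and> (\<forall>u\<in>W. Z'' u = Z u)) \<and> nabla X Z' v = nabla Xa Z'' (fst w)"
      using X Z W unfolding vector_fields_eq anisotropic_fields_eq fw by blast
  next
    fix z assume "\<exists>Xa\<in>vector_fields D A. \<exists>Z''\<in>anisotropic_fields C A. Xa (fst w) = w \<and>
        (\<exists>W. openin (atlas_topology D) W \<and> fst w \<in> W \<and> (\<forall>u\<in>W. Z'' u = Z u)) \<and> z = nabla Xa Z'' (fst w)"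
    then obtain X2 Z2 W2 where 2: "X2 \<in> VFs" "Z2 \<in> AFs" "X2 v = w" "openin (atlas_topology D) W2"
      "v \<in> W2" "\<forall>u\<in>W2. Z2 u = Z u" "z = nabla X2 Z2 v"
      unfolding vector_fields_eq anisotropic_fields_eq fw by blast
    obtain c where c: "c \<in> C" "fst v \<in> fst c" using chart_ex[OF v] by blast
    obtain g where g: "\<forall>X\<in>VFs. \<forall>Z\<in>AFs. snd (nabla X Z v) c = vdd D (X v) (\<lambda>u. snd (Z u) c) +
       (\<Sum>b\<in>Basis. \<Sum>j\<in>Basis. (snd (X v) (dch c) \<bullet> b) *\<^sub>R (snd (Z v) c \<bullet> j) *\<^sub>R g b j)"
      by (rule nabla_coordinates[OF v c]) blast
    have o: "openin (atlas_topology D) (W \<inter> W2)" using W(1) 2(4) by blast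
    have agree: "Z2 u = Z' u" if "u \<in> W \<inter> W2" for u using that W(3) 2(6) by simp
    have "vdd D w (\<lambda>u. snd (Z2 u) c) = vdd D w (\<lambda>u. snd (Z' u) c)"
      by (rule D.vdd_cong[OF w o]) (use agree W(2) 2(5) in auto)
    moreover have "Z2 v = Z' v" using agree W(2) 2(5) by blast
    ultimately have s: "snd z c = snd (nabla X Z' v) c"
      unfolding 2(7) bspec[OF bspec[OF g 2(1)] 2(2)] bspec[OF bspec[OF g X(1)] Z] 2(3) X(2) by simp
    show "z = nabla X Z' v"
      by (rule C.tangent_eqI[OF _ nabla_tangent[OF X(1) Z v] c s])
        (use nabla_tangent[OF 2(1,2) v] 2(7) in simp)
  qed
qed

lemma koszul_at_field: "X \<in> VFs \<Longrightarrow> Z \<in> AFs \<Longrightarrow> v \<in> A \<Longrightarrow> koszul_at C A nabla (X v) Z = nabla X Z v"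
  by (rule koszul_at_eq[OF _ _ refl _ D.openin_carrier]) auto

lemma koszul_at_tangent:
  assumes "v \<in> A" "w \<in> tangent_space D v" "section_germ v Z"
  shows "koszul_at C A nabla w Z \<in> tangent_space C (fst v)"
proof -
  obtain X where X: "X \<in> VFs" "X v = w" by (rule extend_vector[OF assms(2,1)]) blast
  obtain Z' W where Z: "Z' \<in> AFs" "openin (atlas_topology D) W" "v \<in> W" "\<forall>u\<in>W. Z' u = Z u"
    by (rule extend_section[OF assms(3)]) blast
  show ?thesis
    unfolding koszul_at_eq[OF assms(1) X Z] by (rule nabla_tangent[OF X(1) Z(1) assms(1)])
qed

text \<open>
  The connection form in the chart \<open>c\<close>: the derivative in the direction \<open>w\<close> of the section with
  constant components \<open>z\<close>. The Christoffel symbols are by definition its components for coordinate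
  vectors \<open>z\<close>, the horizontal ones for \<open>w = \<delta>\<^sub>i\<close> and the vertical ones for \<open>w\<close> tangent to the fibre
  coordinate \<open>y\<^sup>i\<close>.
\<close>

definition conn_form :: "('m, 'e) chart \<Rightarrow> ('m, 'e) ttvec \<Rightarrow> 'e \<Rightarrow> 'e" where
  "conn_form c w z = snd (koszul_at C A nabla w (\<lambda>u. coord_vec C c (fst u) z)) c"

lemma koszul_at_expansion:
  assumes v: "v \<in> A" and c: "c \<in> C" "fst v \<in> fst c"
  obtains g :: "'e \<times> 'e \<Rightarrow> 'e \<Rightarrow> 'e" where
    "\<forall>w\<in>tangent_space D v. \<forall>Z. section_germ v Z \<longrightarrow>
      snd (koszul_at C A nabla w Z) c = vdd D w (\<lambda>u. snd (Z u) c) +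
       (\<Sum>b\<in>Basis. \<Sum>j\<in>Basis. (snd w (dch c) \<bullet> b) *\<^sub>R (snd (Z v) c \<bullet> j) *\<^sub>R g b j)"
    "\<forall>w\<in>tangent_space D v. \<forall>z. conn_form c w z =
       (\<Sum>b\<in>Basis. \<Sum>j\<in>Basis. (snd w (dch c) \<bullet> b) *\<^sub>R (z \<bullet> j) *\<^sub>R g b j)"
proof -
  obtain g where g: "\<forall>X\<in>VFs. \<forall>Z\<in>AFs. snd (nabla X Z v) c = vdd D (X v) (\<lambda>u. snd (Z u) c) +
     (\<Sum>b\<in>Basis. \<Sum>j\<in>Basis. (snd (X v) (dch c) \<bullet> b) *\<^sub>R (snd (Z v) c \<bullet> j) *\<^sub>R g b j)"
    by (rule nabla_coordinates[OF v c]) blast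
  have *: "snd (koszul_at C A nabla w Z) c = vdd D w (\<lambda>u. snd (Z u) c) +
      (\<Sum>b\<in>Basis. \<Sum>j\<in>Basis. (snd w (dch c) \<bullet> b) *\<^sub>R (snd (Z v) c \<bullet> j) *\<^sub>R g b j)"
    if w: "w \<in> tangent_space D v" and germ: "section_germ v Z" for w Z
  proof -
    obtain X where X: "X \<in> VFs" "X v = w" by (rule extend_vector[OF w v]) blast
    obtain Z' W where Z: "Z' \<in> AFs" "openin (atlas_topology D) W" "v \<in> W" "\<forall>u\<in>W. Z' u = Z u"
      by (rule extend_section[OF germ]) blast
    have "vdd D w (\<lambda>u. snd (Z' u) c) = vdd D w (\<lambda>u. snd (Z u) c)"
      by (rule D.vdd_cong[OF w Z(2,3)]) (simp add: Z(4))
    then show ?thesis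
      using bspec[OF bspec[OF g X(1)] Z(1)] bspec[OF Z(4,3)] X(2)
      unfolding koszul_at_eq[OF v X Z] by simp
  qed
  have "conn_form c w z = (\<Sum>b\<in>Basis. \<Sum>j\<in>Basis. (snd w (dch c) \<bullet> b) *\<^sub>R (z \<bullet> j) *\<^sub>R g b j)"
    if w: "w \<in> tangent_space D v" for w z
  proof -
    have "vdd D w (\<lambda>u. snd (coord_vec C c (fst u) z) c) = vdd D w (\<lambda>u. z)"
      by (rule D.vdd_cong[OF w openin_dom[OF c(1)]]) (use v c in auto)
    also have "\<dots> = 0" by (rule D.vdd_const[OF w]) (use v in simp)
    finally show ?thesis
      unfolding conn_form_def *[OF w frame_germ[OF v c]] using c by simp
  qed
  then show thesis using * by (intro that[of g]) blast+
qed

lemma koszul_at_coordinates: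
  assumes v: "v \<in> A" and c: "c \<in> C" "fst v \<in> fst c"
    and w: "w \<in> tangent_space D v" and Z: "section_germ v Z"
  shows "snd (koszul_at C A nabla w Z) c = vdd D w (\<lambda>u. snd (Z u) c) + conn_form c w (snd (Z v) c)"
proof (rule koszul_at_expansion[OF v c])
  fix g
  assume "\<forall>w\<in>tangent_space D v. \<forall>Z. section_germ v Z \<longrightarrow>
      snd (koszul_at C A nabla w Z) c = vdd D w (\<lambda>u. snd (Z u) c) +
       (\<Sum>b\<in>Basis. \<Sum>j\<in>Basis. (snd w (dch c) \<bullet> b) *\<^sub>R (snd (Z v) c \<bullet> j) *\<^sub>R g b j)"
    and "\<forall>w\<in>tangent_space D v. \<forall>z. conn_form c w z =
       (\<Sum>b\<in>Basis. \<Sum>j\<in>Basis. (snd w (dch c) \<bullet> b) *\<^sub>R (z \<bullet> j) *\<^sub>R g b j)"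
  then show ?thesis using w Z by simp
qed

text \<open>A bilinear representative of the connection form on components.\<close>

lemma conn_form_bilinear:
  assumes v: "v \<in> A" and c: "c \<in> C" "fst v \<in> fst c"
  obtains G :: "'e \<times> 'e \<Rightarrow> 'e \<Rightarrow> 'e" where "bilinear G"
    "\<forall>w\<in>tangent_space D v. \<forall>z. conn_form c w z = G (snd w (dch c)) z"
proof (rule koszul_at_expansion[OF v c])
  fix g
  assume g: "\<forall>w\<in>tangent_space D v. \<forall>z. conn_form c w z =
       (\<Sum>b\<in>Basis. \<Sum>j\<in>Basis. (snd w (dch c) \<bullet> b) *\<^sub>R (z \<bullet> j) *\<^sub>R g b j)"
  define G where "G p z = (\<Sum>b\<in>Basis. \<Sum>j\<in>Basis. (p \<bullet> b) *\<^sub>R (z \<bullet> j) *\<^sub>R g b j)" for p z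
  have "linear (\<lambda>p. G p z)" for z
    unfolding G_def
    by (intro linearI) (simp_all add: inner_add_left sum.distrib scaleR_sum_right algebra_simps)
  moreover have "linear (G p)" for p
    unfolding G_def
    by (intro linearI) (simp_all add: inner_add_left sum.distrib scaleR_sum_right algebra_simps)
  ultimately have "bilinear G" unfolding bilinear_def by blast
  then show thesis by (rule that) (use g in \<open>simp add: G_def\<close>)
qed

end

section \<open>Smoothness of determinants\<close>

context atlas
begin

lemma smooth_near_prod:
  fixes f :: "'i \<Rightarrow> 'm \<Rightarrow> real"
  shows "p \<in> carrier C \<Longrightarrow> (\<And>i. i \<in> I \<Longrightarrow> smooth_near C p (f i)) \<Longrightarrow> smooth_near C p (\<lambda>q. \<Prod>i\<in>I. f i q)"
  by (induction I rule: infinite_finite_induct)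
    (auto intro: smooth_near_bilinear[OF bounded_bilinear_mult] smooth_near_const)

lemma smooth_near_det:
  fixes M :: "'m \<Rightarrow> real^'n^'n"
  assumes "p \<in> carrier C" "\<And>i j. smooth_near C p (\<lambda>q. M q $ i $ j)"
  shows "smooth_near C p (\<lambda>q. det (M q))"
  unfolding det_def
  by (intro smooth_near_sum smooth_near_bilinear[OF bounded_bilinear_mult] smooth_near_const
      smooth_near_prod assms)

lemma smooth_near_divide:
  fixes f g :: "'m \<Rightarrow> real"
  assumes "smooth_near C p f" "smooth_near C p g" "g p \<noteq> 0"
  shows "smooth_near C p (\<lambda>q. f q / g q)"
  unfolding divide_inverse
  by (intro smooth_near_bilinear[OF bounded_bilinear_mult] assms
      smooth_near_compose[OF assms(2) _ _ smooth_on_inverse_real]) (use assms(3) in auto)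

lemma local_field_near:
  assumes X: "X \<in> vector_fields C W" and W: "openin (atlas_topology C) W" "q \<in> W" and d: "d \<in> C" "q \<in> fst d"
  shows "smooth_near C q (\<lambda>u. snd (X u) d)" and "X q \<in> tangent_space C q"
proof -
  interpret R: atlas "restrict_atlas C W" by (rule atlas_restrict[OF W(1)])
  have X': "X q \<in> tangent_bundle C" "fst (X q) = q" "smooth_map (restrict_atlas C W) (tangent_atlas C) X"
    using X W(2) by (auto simp: vector_fields_def)
  then show Xq: "X q \<in> tangent_space C q" using tangent_bundle_iff[of "X q" C] by simp
  have "smooth_near (restrict_atlas C W) q (\<lambda>u. snd (natural_chart C d) (X u))"
  proof (rule R.smooth_map_near[OF X'(3)])
    show "q \<in> carrier (restrict_atlas C W)"
      using W openin_subset_carrier[OF W(1)] by (auto simp: carrier_restrict)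
    show "natural_chart C d \<in> tangent_atlas C" using d by (simp add: tangent_atlas_def)
    show "X q \<in> fst (natural_chart C d)" using Xq X'(2) d by (simp add: in_natural_chart)
  qed
  then have "smooth_near C q (\<lambda>u. snd (natural_chart C d) (X u))"
    by (rule smooth_near_restrict[OF W(1)])
  from smooth_near_linear[OF bounded_linear_snd this] show "smooth_near C q (\<lambda>u. snd (X u) d)"
    by (simp add: snd_natural_chart)
qed

end

lemma vec_eq_sum_axis: "x = (\<Sum>m\<in>UNIV. x $ m *\<^sub>R axis m 1)" for x :: "real^'n"
  using basis_expansion[of x] by (simp add: scalar_mult_eq_scaleR)

lemma linear_axis_expansion:
  fixes f :: "real^'n \<Rightarrow> 'b::real_vector"
  assumes "linear f"
  shows "f x = (\<Sum>i\<in>UNIV. x $ i *\<^sub>R f (axis i 1))"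
proof -
  have "f x = f (\<Sum>i\<in>UNIV. x $ i *\<^sub>R axis i 1)" by (simp flip: vec_eq_sum_axis)
  also have "\<dots> = (\<Sum>i\<in>UNIV. x $ i *\<^sub>R f (axis i 1))"
    by (simp add: linear_sum[OF assms] linear_scale[OF assms])
  finally show ?thesis .
qed

section \<open>The components of a nonlinear connection\<close>

locale nonlinear = conic C A
  for C :: "('m, real^'n) chart set" and A +
  fixes HA :: "('m, real^'n) tvec \<Rightarrow> ('m, real^'n) ttvec set"
  assumes homogeneous: "homogeneous_nonlinear_connection C A HA"
begin

lemma tspan_delta:
  assumes v: "v \<in> A" and c: "c \<in> C" "fst v \<in> fst c"
  shows "tspan v UNIV (\<lambda>i. delta_of C A c N i v) = {w \<in> tangent_space D v. ycomp c w = - (N *v xcomp c w)}"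
    and "delta_of C A c N i v \<in> tangent_space D v"
    and "snd (delta_of C A c N i v) (dch c) = (axis i 1, - (N *v axis i 1))"
proof -
  have cd: "dch c \<in> D" "v \<in> fst (dch c)" using v c by auto
  show comp: "snd (delta_of C A c N i v) (dch c) = (axis i 1, - (N *v axis i 1))" for i
  proof -
    have "snd (delta_of C A c N i v) (dch c) = (axis i 1, - (\<Sum>a\<in>UNIV. N $ a $ i *\<^sub>R axis a 1))"
      by (simp add: delta_of_def dx_vec_def dy_vec_def D.coord_vec_self[OF cd] scaleR_sum_right
          prod_eq_iff fst_sum snd_sum sum_negf)
    also have "(\<Sum>a\<in>UNIV. N $ a $ i *\<^sub>R axis a 1) = N *v axis i 1"
      by (simp add: vec_eq_iff matrix_vector_mul_component axis_def if_distrib[of "\<lambda>x. _ * x"]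
          matrix_vector_mult_def inner_vec_def cong: if_cong)
    finally show ?thesis .
  qed
  show T: "delta_of C A c N i v \<in> tangent_space D v" for i
    unfolding delta_of_def dx_vec_def dy_vec_def
    by (intro D.tadd_in D.tscale_in D.tcomb_in D.coord_vec_in cd)
  have lin: "(\<Sum>i\<in>UNIV. r i *\<^sub>R snd (delta_of C A c N i v) (dch c)) = (x, - (N *v x))"
    if "\<And>i. r i = x $ i" for r x
  proof -
    have "linear (\<lambda>x. (x, - (N *v x)))"
      by (intro linearI) (simp_all add: matrix_vector_right_distrib matrix_vector_mult_scaleR)
    then show ?thesis using linear_axis_expansion[of "\<lambda>x. (x, - (N *v x))" x] by (simp add: comp that)
  qed
  show "tspan v UNIV (\<lambda>i. delta_of C A c N i v) = {w \<in> tangent_space D v. ycomp c w = - (N *v xcomp c w)}"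
  proof (intro equalityI subsetI)
    fix w assume "w \<in> tspan v UNIV (\<lambda>i. delta_of C A c N i v)"
    then obtain r where w: "w = tcomb v UNIV r (\<lambda>i. delta_of C A c N i v)" unfolding tspan_def by blast
    have "snd w (dch c) = ((\<chi> i. r i), - (N *v (\<chi> i. r i)))"
      unfolding w snd_tcomb by (rule lin) simp
    then show "w \<in> {w \<in> tangent_space D v. ycomp c w = - (N *v xcomp c w)}"
      using D.tcomb_in[of UNIV "\<lambda>i. delta_of C A c N i v" v r, OF T] w by simp
  next
    fix w assume w: "w \<in> {w \<in> tangent_space D v. ycomp c w = - (N *v xcomp c w)}"
    let ?w = "tcomb v UNIV (\<lambda>i. xcomp c w $ i) (\<lambda>i. delta_of C A c N i v)"
    have s: "snd w (dch c) = snd ?w (dch c)"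
      using lin[of "\<lambda>i. xcomp c w $ i" "xcomp c w"] w by (simp add: prod_eq_iff)
    have "w = ?w"
      by (rule D.tangent_eqI[OF _ D.tcomb_in[OF T] cd s]) (use w in blast)
    then show "w \<in> tspan v UNIV (\<lambda>i. delta_of C A c N i v)" unfolding tspan_def by blast
  qed
qed

text \<open>
  A local frame of the horizontal distribution has components \<open>(P r, Q r)\<close> in a natural chart. As no
  horizontal vector is vertical, \<open>P\<close> is invertible, and the components of the connection
  are \<open>- Q P\<^sup>-\<^sup>1\<close>; Cramer's rule shows that they are smooth.
\<close>

lemma local_matrix:
  assumes v: "v \<in> A" and c: "c \<in> C" "fst v \<in> fst c"
  obtains W N where "openin (atlas_topology D) W" "v \<in> W" "W \<subseteq> fst (dch c)"
    "\<forall>q\<in>W. HA q = {w \<in> tangent_space D q. ycomp c w = - (N q *v xcomp c w)}"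
    "\<forall>a k. smooth_near D v (\<lambda>q. N q $ a $ k :: real)"
proof -
  have HA: "smooth_distribution D CARD('n) HA"
    and decomp: "\<And>v w. v \<in> A \<Longrightarrow> w \<in> tangent_space D v \<Longrightarrow>
      \<exists>!hu. hu \<in> HA v \<times> vertical_space C A v \<and> w = tadd (fst hu) (snd hu)"
    using homogeneous by (auto simp: homogeneous_nonlinear_connection_def nonlinear_connection_def)
  obtain U E where U: "openin (atlas_topology D) U" "v \<in> U" "\<forall>i<CARD('n). E i \<in> vector_fields D U"
    "\<forall>q\<in>U. HA q = tspan q {..<CARD('n)} (\<lambda>i. E i q) \<and>
      (\<forall>r. tcomb q {..<CARD('n)} r (\<lambda>i. E i q) = tzero q \<longrightarrow> (\<forall>i<CARD('n). r i = 0))"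
    using bspec[OF HA[unfolded smooth_distribution_def carrier_D] v]
    by (elim exE conjE) (rule that)
  obtain f :: "'n \<Rightarrow> nat" where f: "bij_betw f UNIV {..<CARD('n)}"
    using ex_bij_betw_finite_nat[of "UNIV :: 'n set"] by (auto simp: atLeast0LessThan)
  have fl: "f i < CARD('n)" for i using bij_betwE[OF f] by auto
  define W where "W = U \<inter> fst (dch c)"
  have W: "openin (atlas_topology D) W" "v \<in> W" "W \<subseteq> fst (dch c)"
    using U(1,2) openin_dom[OF c(1)] v c by (auto simp: W_def)
  have near: "smooth_near D q (\<lambda>u. snd (E (f i) u) (dch c))" and ET: "E (f i) q \<in> tangent_space D q"
    if "q \<in> W" for q i
    using D.local_field_near[OF _ U(1) _ dom_in[OF c(1)], of "E (f i)" q] U(3) fl that by (auto simp: W_def)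
  define P :: "('m, real^'n) tvec \<Rightarrow> real^'n^'n" where "P q = (\<chi> k i. xcomp c (E (f i) q) $ k)" for q
  define Q :: "('m, real^'n) tvec \<Rightarrow> real^'n^'n" where "Q q = (\<chi> k i. ycomp c (E (f i) q) $ k)" for q
  define comb where "comb q r = tcomb q {..<CARD('n)} (\<lambda>j. r $ inv_into UNIV f j) (\<lambda>j. E j q)"
    for q and r :: "real^'n"
  have comb_snd: "snd (comb q r) d = (\<Sum>i\<in>UNIV. r $ i *\<^sub>R snd (E (f i) q) d)" for q r d
  proof -
    have "(\<Sum>i\<in>UNIV. r $ i *\<^sub>R snd (E (f i) q) d) =
        (\<Sum>i\<in>UNIV. r $ inv_into UNIV f (f i) *\<^sub>R snd (E (f i) q) d)"
      using bij_betw_imp_inj_on[OF f] by (simp add: inv_into_f_f)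
    also have "\<dots> = (\<Sum>j<CARD('n). r $ inv_into UNIV f j *\<^sub>R snd (E j q) d)"
      by (rule sum.reindex_bij_betw[OF f, of "\<lambda>j. r $ inv_into UNIV f j *\<^sub>R snd (E j q) d"])
    finally show ?thesis by (simp add: comb_def)
  qed
  have comb_comp: "xcomp c (comb q r) = P q *v r" "ycomp c (comb q r) = Q q *v r" for q r
    by (simp_all add: comb_snd fst_sum snd_sum vec_eq_iff P_def Q_def matrix_vector_mult_def mult.commute)
  have comb_T: "comb q r \<in> tangent_space D q" if q: "q \<in> W" for q r
    unfolding comb_def
  proof (rule D.tcomb_in)
    fix j assume "j \<in> {..<CARD('n)}"
    then obtain i where "j = f i" using f by (metis bij_betw_imp_surj_on imageE)
    then show "E j q \<in> tangent_space D q" using ET[OF q] by simp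
  qed
  have HA_comb: "HA q = range (comb q)" if q: "q \<in> W" for q
  proof -
    have "HA q = tspan q {..<CARD('n)} (\<lambda>i. E i q)" using U(4) q by (simp add: W_def)
    also have "\<dots> = range (comb q)"
    proof (intro equalityI subsetI)
      fix w assume "w \<in> tspan q {..<CARD('n)} (\<lambda>i. E i q)"
      then obtain r where w: "w = tcomb q {..<CARD('n)} r (\<lambda>i. E i q)" unfolding tspan_def by blast
      have "w = comb q (\<chi> i. r (f i))"
        unfolding w comb_def using bij_betw_imp_surj_on[OF f]
        by (intro tvec_eqI) (auto intro!: sum.cong simp: f_inv_into_f)
      then show "w \<in> range (comb q)" by blast
    qed (auto simp: comb_def tspan_def)
    finally show ?thesis .
  qed
  have inj: "r = 0" if q: "q \<in> W" and r: "P q *v r = 0" for q r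
  proof -
    have qA: "q \<in> A" "fst q \<in> fst c" using q W(3) c(1) by auto
    \<comment> \<open>\<open>comb q r\<close> is horizontal and vertical, so \<open>(comb q r, 0)\<close> and \<open>(0, comb q r)\<close> both decompose it.\<close>
    let ?z = "tzero q :: ('m, real^'n) ttvec"
    have vert: "comb q r \<in> vertical_space C A q"
      using vertical_space_iff[OF qA(1) c(1) qA(2)] comb_T[OF q] comb_comp(1) r by simp
    have zero: "?z \<in> vertical_space C A q"
      using vertical_space_iff[OF qA(1) c(1) qA(2)] D.tzero_in by simp
    have hz: "?z \<in> HA q"
    proof -
      have "?z = comb q 0" by (intro tvec_eqI) (simp_all add: comb_snd comb_def)
      then show ?thesis using HA_comb[OF q] by blast
    qed
    have hc: "comb q r \<in> HA q" using HA_comb[OF q] by blast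
    have e: "comb q r = tadd (comb q r) ?z" "comb q r = tadd ?z (comb q r)"
      by (intro tvec_eqI, simp_all add: comb_def)+
    note ex = decomp[OF qA(1) comb_T[OF q, of r]]
    have 1: "(comb q r, ?z) \<in> HA q \<times> vertical_space C A q \<and>
        comb q r = tadd (fst (comb q r, ?z)) (snd (comb q r, ?z))"
      unfolding fst_conv snd_conv using hc zero e(1) by blast
    have 2: "(?z, comb q r) \<in> HA q \<times> vertical_space C A q \<and>
        comb q r = tadd (fst (?z, comb q r)) (snd (?z, comb q r))"
      unfolding fst_conv snd_conv using hz vert e(2) by blast
    have "(comb q r, ?z) = (?z, comb q r)"
      by (rule trans[OF the1_equality[OF ex 1, symmetric] the1_equality[OF ex 2]])
    then have "comb q r = tzero q" unfolding prod.inject by (rule conjunct1)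
    then have "\<forall>j<CARD('n). r $ inv_into UNIV f j = 0"
      using U(4) q unfolding comb_def W_def by blast
    then have "r $ i = 0" for i
      using fl[of i] inv_into_f_f[OF bij_betw_imp_inj_on[OF f], of i] by force
    then show ?thesis by (simp add: vec_eq_iff)
  qed
  have det: "det (P q) \<noteq> 0" if "q \<in> W" for q
    using inj[OF that] matrix_left_invertible_ker[of "P q"]
    by (metis invertible_det_nz invertible_left_inverse)
  define M where "M q a k = (\<chi> i j. if j = k then - (Q q $ a $ i) else transpose (P q) $ i $ j)"
    for q and a k :: 'n
  define N where "N q = (\<chi> a k. det (M q a k) / det (transpose (P q)))" for q
  have NP: "N q *v (P q *v r) = - (Q q *v r)" if q: "q \<in> W" for q r
  proof -
    have row: "transpose (P q) *v (N q $ a) = (\<chi> i. - (Q q $ a $ i))" for a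
    proof -
      have "det (transpose (P q)) \<noteq> 0" using det[OF q] by (simp add: det_transpose)
      then show ?thesis by (subst cramer) (simp_all add: N_def M_def vec_eq_iff cong: if_cong)
    qed
    have "(N q ** P q) $ a $ i = - (Q q $ a $ i)" for a i
    proof -
      have "(N q ** P q) $ a $ i = (transpose (P q) *v (N q $ a)) $ i"
        by (simp add: matrix_matrix_mult_def matrix_vector_mult_def transpose_def mult.commute)
      then show ?thesis unfolding row by simp
    qed
    then have "N q ** P q = - Q q" by (simp add: vec_eq_iff)
    then show ?thesis
      by (simp add: matrix_vector_mul_assoc) (simp add: matrix_vector_mult_def vec_eq_iff sum_negf)
  qed
  have "HA q = {w \<in> tangent_space D q. ycomp c w = - (N q *v xcomp c w)}" if q: "q \<in> W" for q
  proof (intro equalityI subsetI)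
    fix w assume "w \<in> HA q"
    then obtain r where w: "w = comb q r" using HA_comb[OF q] by blast
    show "w \<in> {w \<in> tangent_space D q. ycomp c w = - (N q *v xcomp c w)}"
      unfolding w using comb_T[OF q] by (simp add: comb_comp NP[OF q])
  next
    fix w assume w: "w \<in> {w \<in> tangent_space D q. ycomp c w = - (N q *v xcomp c w)}"
    obtain B where B: "P q ** B = mat 1"
      using det[OF q] by (meson invertible_det_nz invertible_right_inverse)
    define r where "r = B *v xcomp c w"
    have "P q *v r = xcomp c w"
      using B by (simp add: r_def matrix_vector_mul_assoc)
    then have "snd w (dch c) = snd (comb q r) (dch c)"
      using w NP[OF q, of r] comb_comp[of q r] by (simp add: prod_eq_iff)
    then have "w = comb q r"
      using D.tangent_eqI[OF _ comb_T[OF q] dom_in[OF c(1)], of w] w q W(3) by blast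
    then show "w \<in> HA q" using HA_comb[OF q] by blast
  qed
  moreover have "smooth_near D v (\<lambda>q. N q $ a $ k)" for a k
  proof -
    have vc: "v \<in> carrier D" using v by simp
    have sP: "smooth_near D v (\<lambda>q. P q $ k $ i)" for k i
      unfolding P_def
      using D.smooth_near_linear[OF bounded_linear_vec_nth D.smooth_near_linear[OF bounded_linear_fst near[OF W(2)]]]
      by simp
    have sQ: "smooth_near D v (\<lambda>q. Q q $ k $ i)" for k i
      unfolding Q_def
      using D.smooth_near_linear[OF bounded_linear_vec_nth D.smooth_near_linear[OF bounded_linear_snd near[OF W(2)]]]
      by simp
    have sQ': "smooth_near D v (\<lambda>q. - (Q q $ k $ i))" for k i
      by (rule D.smooth_near_linear[OF bounded_linear_minus[OF bounded_linear_ident] sQ])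
    have sT: "smooth_near D v (\<lambda>q. transpose (P q) $ i $ j)" for i j
      using sP by (simp add: transpose_def)
    have sM: "smooth_near D v (\<lambda>q. M q a k $ i $ j)" for i j
      unfolding M_def using sQ' sT by (cases "j = k") simp_all
    have d0: "det (transpose (P v)) \<noteq> 0" using det[OF W(2)] by (simp add: det_transpose)
    have "smooth_near D v (\<lambda>q. det (M q a k) / det (transpose (P q)))"
      by (rule D.smooth_near_divide[OF D.smooth_near_det[OF vc sM] D.smooth_near_det[OF vc sT] d0])
    then show ?thesis by (simp add: N_def)
  qed
  ultimately show thesis using W by (intro that[of W N]) simp_all
qed

abbreviation "Ncomp c v \<equiv> nonlinear_components C A HA c v"

lemma Ncomp_eqI:
  assumes v: "v \<in> A" and c: "c \<in> C" "fst v \<in> fst c"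
    and N: "HA v = {w \<in> tangent_space D v. ycomp c w = - (N *v xcomp c w)}"
  shows "Ncomp c v = N"
  unfolding nonlinear_components_def
proof (rule the_equality)
  show "HA v = tspan v UNIV (\<lambda>i. delta_of C A c N i v)" using tspan_delta(1)[OF v c] N by simp
  fix N' assume N': "HA v = tspan v UNIV (\<lambda>i. delta_of C A c N' i v)"
  have "N' *v axis i 1 = N *v axis i 1" for i
  proof -
    have "ycomp c (delta_of C A c N i v) = - (N *v xcomp c (delta_of C A c N i v))"
      using tspan_delta(3)[OF v c] by simp
    then have "delta_of C A c N i v \<in> HA v"
      unfolding N using tspan_delta(2)[OF v c] by blast
    then show ?thesis
      unfolding N' tspan_delta(1)[OF v c] by (simp add: tspan_delta(3)[OF v c])
  qed
  then have "N' $ a $ i = N $ a $ i" for a i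
    by (metis matrix_vector_mul_component matrix_vector_mult_basis column_def vec_lambda_beta)
  then show "N' = N" by (simp add: vec_eq_iff)
qed

lemma HA_eq:
  assumes v: "v \<in> A" and c: "c \<in> C" "fst v \<in> fst c"
  shows "HA v = {w \<in> tangent_space D v. ycomp c w = - (Ncomp c v *v xcomp c w)}"
proof -
  obtain W N where "v \<in> W" "\<forall>q\<in>W. HA q = {w \<in> tangent_space D q. ycomp c w = - (N q *v xcomp c w)}"
    by (rule local_matrix[OF v c]) blast
  then have "HA v = {w \<in> tangent_space D v. ycomp c w = - (N v *v xcomp c w)}" by blast
  then show ?thesis using Ncomp_eqI[OF v c] by simp
qed

lemma Ncomp_near:
  assumes v: "v \<in> A" and c: "c \<in> C" "fst v \<in> fst c"
  shows "smooth_near D v (\<lambda>u. Ncomp c u $ a $ k)"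
proof -
  obtain W N where W: "openin (atlas_topology D) W" "v \<in> W" "W \<subseteq> fst (dch c)"
    "\<forall>q\<in>W. HA q = {w \<in> tangent_space D q. ycomp c w = - (N q *v xcomp c w)}"
    "\<forall>a k. smooth_near D v (\<lambda>q. N q $ a $ k)"
    by (rule local_matrix[OF v c]) blast
  show ?thesis
  proof (rule D.smooth_near_cong[OF W(5)[rule_format] W(1,2)])
    fix q assume q: "q \<in> W"
    have "Ncomp c q = N q"
      by (rule Ncomp_eqI[OF _ c(1) _ W(4)[rule_format, OF q]]) (use q W(3) c in auto)
    then show "N q $ a $ k = Ncomp c q $ a $ k" by simp
  qed
qed

text \<open>
  In coordinates the homothety maps \<open>(a, b)\<close> to \<open>(a, l b)\<close>; since it preserves the horizontal spaces, it
  maps the graph of \<open>- N\<close> at \<open>v\<close> to the graph of \<open>- N\<close> at \<open>l v\<close>.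
\<close>

lemma Ncomp_scale:
  assumes v: "v \<in> A" and c: "c \<in> C" "fst v \<in> fst c" and l: "l > 0"
  shows "Ncomp c (tscale l v) *v x = l *\<^sub>R (Ncomp c v *v x)"
proof -
  have lv: "tscale l v \<in> A" "fst (tscale l v) \<in> fst c" using scaleA[OF v l] c by auto
  have H: "tangent_map D D (tscale l) ` HA v = HA (tscale l v)"
    using homogeneous l v unfolding homogeneous_nonlinear_connection_def by blast
  let ?w = "coord_vec D (dch c) v (x, - (Ncomp c v *v x))"
  have w: "?w \<in> tangent_space D v" "snd ?w (dch c) = (x, - (Ncomp c v *v x))" using v c by auto
  then have "?w \<in> HA v" unfolding HA_eq[OF v c] by simp
  then have "tangent_map D D (tscale l) ?w \<in> HA (tscale l v)" using H by blast
  then have "ycomp c (tangent_map D D (tscale l) ?w) =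
      - (Ncomp c (tscale l v) *v xcomp c (tangent_map D D (tscale l) ?w))"
    unfolding HA_eq[OF lv(1) c(1) lv(2)] by blast
  then show ?thesis
    using smooth_tscale(3)[OF l w(1) v c] w(2) by simp
qed

text \<open>The fibre component of the vertical part of a tangent vector of \<open>A\<close>.\<close>

definition eta :: "('m, real^'n) chart \<Rightarrow> ('m, real^'n) ttvec \<Rightarrow> real^'n" where
  "eta c w = ycomp c w + Ncomp c (fst w) *v xcomp c w"

text \<open>
  Subtracting from \<open>w\<close> the vertical vector with components \<open>eta c w\<close> leaves a horizontal vector. Being
  horizontal does not depend on the chart, so \<open>eta d w\<close> is the \<open>d\<close>-component of that same vertical vector.
\<close>

lemma eta_change:
  assumes w: "w \<in> tangent_space D v" and v: "v \<in> A"
    and c: "c \<in> C" "fst v \<in> fst c" and d: "d \<in> C" "fst v \<in> fst d"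
  shows "eta d w = jac c d (fst v) (eta c w)"
proof -
  note u = vert[OF v c, of "eta c w"]
  let ?h = "tadd w (tscale (- 1) (vert c v (eta c w)))"
  have fw: "fst w = v" by (rule tangent_space_fst[OF w])
  have h: "?h \<in> tangent_space D v" by (intro D.tadd_in D.tscale_in w u)
  have "ycomp c ?h = - (Ncomp c v *v xcomp c ?h)"
    using u(3) by (simp add: eta_def fw)
  then have "?h \<in> HA v" unfolding HA_eq[OF v c] using h by blast
  then have "ycomp d ?h = - (Ncomp d v *v xcomp d ?h)" unfolding HA_eq[OF v d] by blast
  then show ?thesis
    using vert_comp[OF v c d, of "eta c w"] by (simp add: eta_def fw diff_eq_eq)
qed

lemma delta_vec:
  assumes v: "v \<in> A" and c: "c \<in> C" "fst v \<in> fst c"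
  shows "delta_vec C A HA c i v \<in> tangent_space D v" "xcomp c (delta_vec C A HA c i v) = axis i 1"
    "eta c (delta_vec C A HA c i v) = 0"
  using tspan_delta(2,3)[OF v c] tangent_space_fst[OF tspan_delta(2)[OF v c]]
  by (simp_all add: delta_vec_def eta_def)

lemma dy_vec:
  assumes v: "v \<in> A" and c: "c \<in> C" "fst v \<in> fst c"
  shows "dy_vec C A c i v \<in> tangent_space D v" "xcomp c (dy_vec C A c i v) = 0"
    "eta c (dy_vec C A c i v) = axis i 1"
  using v c by (simp_all add: dy_vec_def eta_def)

end

section \<open>Christoffel symbols as bilinear maps\<close>

definition bil :: "('n \<Rightarrow> 'n \<Rightarrow> 'n::finite \<Rightarrow> real) \<Rightarrow> real^'n \<Rightarrow> real^'n \<Rightarrow> real^'n" where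
  "bil h a b = (\<chi> m. \<Sum>i\<in>UNIV. \<Sum>j\<in>UNIV. a $ i * b $ j * h m i j)"

lemma bilinear_bil: "bilinear (bil h)"
  unfolding bilinear_def
  by (intro allI conjI linearI)
    (simp_all add: bil_def vec_eq_iff sum_distrib_left algebra_simps sum.distrib)

lemma sum_axis: "(\<Sum>l\<in>UNIV. axis j 1 $ l * f l) = (f j :: real)" for j :: "'n::finite"
proof -
  have "(\<Sum>l\<in>UNIV. axis j 1 $ l * f l) = (\<Sum>l\<in>UNIV. if l = j then f l else 0)"
    by (intro sum.cong refl) (simp add: axis_def)
  then show ?thesis by simp
qed

lemma bil_axis: "bil h (axis i 1) (axis j 1) $ m = h m i j"
  by (simp add: bil_def mult.assoc sum_axis flip: sum_distrib_left)

lemma bilinear_eq_axis: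
  fixes f g :: "real^'n \<Rightarrow> real^'n \<Rightarrow> real^'n"
  assumes "bilinear f" "bilinear g" "\<And>i j. f (axis i 1) (axis j 1) = g (axis i 1) (axis j 1)"
  shows "f a b = g a b"
proof -
  have "f = g"
    by (rule bilinear_eq_stdbasis[OF assms(1,2)]) (use assms(3) in \<open>auto simp: Basis_vec_def\<close>)
  then show ?thesis by simp
qed

lemma bilinear_compose_linear:
  assumes "bilinear f" "linear g" "linear h" "linear k"
  shows "bilinear (\<lambda>a b. k (f (g a) (h b)))"
  using assms unfolding bilinear_def
  by (auto intro!: linear_compose[of _ k, unfolded o_def] linear_compose[of g "\<lambda>x. f x _", unfolded o_def]
      linear_compose[of h, unfolded o_def])

lemma bilinear_add: "bilinear f \<Longrightarrow> bilinear g \<Longrightarrow> bilinear (\<lambda>a b. f a b + g a b)"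
  unfolding bilinear_def by (auto intro!: linear_compose_add)

context conic
begin

lemma bilinear_hess:
  assumes "c \<in> C" "p \<in> fst c" "d \<in> C" "p \<in> fst d"
  shows "bilinear (hess c d p)"
proof -
  have "linear (frechet_derivative (\<lambda>x. frechet_derivative (transition c d) (at x) b) (at (snd c p)))" for b
    by (rule has_derivative_linear[OF smooth_on_has_derivative[OF
          smooth_on_derivative[OF C.smooth_transition[OF assms(1,3)]]]]) (use assms in auto)
  then show ?thesis
    unfolding bilinear_def hess_def
    by (intro allI conjI linearI)
      (simp_all add: inner_add_left scaleR_left_distrib sum.distrib scaleR_sum_right linear_add linear_scale
        scaleR_right_distrib mult.commute)
qed

end

context nonlinear
begin

lemma coord_jacobian_eq:
  assumes "c \<in> C" "p \<in> fst c" "d \<in> C" "p \<in> fst d"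
  shows "coord_jacobian c d a m p = jac c d p (axis m 1) $ a"
proof -
  have "((\<lambda>x. transition c d x $ a) has_derivative (\<lambda>h. jac c d p h $ a)) (at (snd c p))"
    by (rule bounded_linear.has_derivative[OF bounded_linear_vec_nth C.jac_has_derivative])
      (use assms in auto)
  then have "frechet_derivative (\<lambda>x. transition c d x $ a) (at (snd c p)) = (\<lambda>h. jac c d p h $ a)"
    by (rule frechet_derivative_at[symmetric])
  then show ?thesis by (simp add: coord_jacobian_def partial_deriv_def)
qed

lemma coord_hessian_eq:
  assumes "c \<in> C" "p \<in> fst c" "d \<in> C" "p \<in> fst d"
  shows "coord_hessian c d a i j p = hess c d p (axis i 1) (axis j 1) $ a"
proof -
  let ?S = "snd c ` (fst c \<inter> fst d)" and ?e = "axis j (1::real)"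
  let ?J = "\<lambda>x. frechet_derivative (transition c d) (at x) ?e"
  have S: "open ?S" "snd c p \<in> ?S" using C.open_overlap assms by auto
  have eq: "?J x $ a = partial_deriv j (\<lambda>x. transition c d x $ a) x" if "x \<in> ?S" for x
  proof -
    obtain q where q: "x = snd c q" "q \<in> fst c" "q \<in> fst d" using \<open>x \<in> ?S\<close> by blast
    show ?thesis
      using coord_jacobian_eq[OF assms(1) q(2) assms(3) q(3), of a j] unfolding coord_jacobian_def jac_def q(1)
      by simp
  qed
  have "((\<lambda>x. ?J x $ a) has_derivative (\<lambda>h. frechet_derivative ?J (at (snd c p)) h $ a)) (at (snd c p))"
    by (rule bounded_linear.has_derivative[OF bounded_linear_vec_nth])
      (rule smooth_on_has_derivative[OF smooth_on_derivative[OF C.smooth_transition[OF assms(1,3)]] S(2)])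
  then have "(partial_deriv j (\<lambda>x. transition c d x $ a) has_derivative
      (\<lambda>h. frechet_derivative ?J (at (snd c p)) h $ a)) (at (snd c p))"
    by (rule has_derivative_transform_within_open[OF _ S]) (rule eq)
  then have "frechet_derivative (partial_deriv j (\<lambda>x. transition c d x $ a)) (at (snd c p)) =
      (\<lambda>h. frechet_derivative ?J (at (snd c p)) h $ a)"
    by (rule frechet_derivative_at[symmetric])
  moreover have "hess c d p (axis i 1) ?e = frechet_derivative ?J (at (snd c p)) (axis i 1)"
  proof -
    have e: "?e \<in> Basis" by (auto simp: Basis_vec_def)
    have "hess c d p (axis i 1) ?e = (\<Sum>b\<in>Basis. if b = ?e then
        frechet_derivative (\<lambda>x. frechet_derivative (transition c d) (at x) b) (at (snd c p)) (axis i 1) else 0)"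
      unfolding hess_def by (intro sum.cong refl) (use e in \<open>auto simp: inner_Basis\<close>)
    also have "\<dots> = frechet_derivative ?J (at (snd c p)) (axis i 1)" using e by simp
    finally show ?thesis .
  qed
  ultimately show ?thesis by (simp add: coord_hessian_def partial_deriv_def)
qed

lemma jac_component:
  assumes "c \<in> C" "p \<in> fst c" "d \<in> C" "p \<in> fst d"
  shows "jac c d p y $ a = (\<Sum>m\<in>UNIV. coord_jacobian c d a m p * y $ m)"
proof -
  have "jac c d p y = (\<Sum>m\<in>UNIV. y $ m *\<^sub>R jac c d p (axis m 1))"
    by (rule linear_axis_expansion[OF C.jac_linear]) (use assms in auto)
  then show ?thesis by (simp add: coord_jacobian_eq[OF assms] mult.commute)
qed

text \<open>The transformation rules, freed from indices.\<close>

lemma connection_rule_iff: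
  assumes c: "c \<in> C" "fst v \<in> fst c" and d: "d \<in> C" "fst v \<in> fst d"
  shows "connection_rule c d H Hbar v \<longleftrightarrow> (\<forall>a b. bil (\<lambda>m i j. Hbar m i j v) a b =
     jac c d (fst v) (hess d c (fst v) a b +
       bil (\<lambda>m i j. H m i j v) (jac d c (fst v) a) (jac d c (fst v) b)))"
    (is "_ \<longleftrightarrow> (\<forall>a b. ?L a b = ?R a b)")
proof -
  have "(\<Sum>m\<in>UNIV. coord_jacobian c d a m (fst v) * (coord_hessian d c m i j (fst v) +
      (\<Sum>k\<in>UNIV. \<Sum>l\<in>UNIV. coord_jacobian d c k i (fst v) * coord_jacobian d c l j (fst v) * H m k l v)))
    = ?R (axis i 1) (axis j 1) $ a" for a i j
    unfolding jac_component[OF c d]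
    by (simp add: coord_hessian_eq[OF d c] coord_jacobian_eq[OF d c] bil_def)
  then have "connection_rule c d H Hbar v \<longleftrightarrow> (\<forall>i j. ?L (axis i 1) (axis j 1) = ?R (axis i 1) (axis j 1))"
    unfolding connection_rule_def vec_eq_iff bil_axis by auto
  moreover have "bilinear ?R"
  proof -
    have j: "linear (jac c d (fst v))" "linear (jac d c (fst v))" using C.jac_linear c d by auto
    have "bilinear (\<lambda>a b. hess d c (fst v) a b +
       bil (\<lambda>m i j. H m i j v) (jac d c (fst v) a) (jac d c (fst v) b))"
      by (intro bilinear_add bilinear_hess[OF d c]
          bilinear_compose_linear[OF bilinear_bil j(2,2) linear_ident])
    then show ?thesis by (rule bilinear_compose_linear[OF _ linear_ident linear_ident j(1)])
  qed
  ultimately show ?thesis using bilinear_eq_axis[OF bilinear_bil, of ?R] by blast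
qed

lemma tensor_rule_iff:
  assumes c: "c \<in> C" "fst v \<in> fst c" and d: "d \<in> C" "fst v \<in> fst d"
  shows "tensor_rule c d V Vbar v \<longleftrightarrow> (\<forall>a b. bil (\<lambda>m i j. Vbar m i j v) a b =
     jac c d (fst v) (bil (\<lambda>m i j. V m i j v) (jac d c (fst v) a) (jac d c (fst v) b)))"
    (is "_ \<longleftrightarrow> (\<forall>a b. ?L a b = ?R a b)")
proof -
  have "(\<Sum>m\<in>UNIV. \<Sum>k\<in>UNIV. \<Sum>l\<in>UNIV. coord_jacobian c d a m (fst v) *
      coord_jacobian d c k i (fst v) * coord_jacobian d c l j (fst v) * V m k l v)
    = ?R (axis i 1) (axis j 1) $ a" for a i j
    unfolding jac_component[OF c d]
    by (simp add: coord_jacobian_eq[OF d c] bil_def sum_distrib_left mult.assoc)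
  then have "tensor_rule c d V Vbar v \<longleftrightarrow> (\<forall>i j. ?L (axis i 1) (axis j 1) = ?R (axis i 1) (axis j 1))"
    unfolding tensor_rule_def vec_eq_iff bil_axis by auto
  moreover have "bilinear ?R"
  proof -
    have j: "linear (jac c d (fst v))" "linear (jac d c (fst v))" using C.jac_linear c d by auto
    show ?thesis by (rule bilinear_compose_linear[OF bilinear_bil j(2,2,1)])
  qed
  ultimately show ?thesis using bilinear_eq_axis[OF bilinear_bil, of ?R] by blast
qed

text \<open>
  The covariant derivative of \<open>Z\<close> in the direction \<open>w\<close> in the chart \<open>c\<close>, computed from given
  Christoffel symbols: \<open>w = w\<^sup>i \<delta>\<^sub>i + \<eta>\<^sup>i \<partial>\<^sub>i\<close> has \<open>H\<close>-coefficients \<open>xcomp\<close> and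
  \<open>V\<close>-coefficients \<open>eta\<close>.
\<close>

definition cov :: "('m, real^'n) chart \<Rightarrow> ('m, 'n) symbols \<Rightarrow> ('m, 'n) symbols \<Rightarrow> ('m, real^'n) ttvec
    \<Rightarrow> (('m, real^'n) tvec \<Rightarrow> ('m, real^'n) tvec) \<Rightarrow> real^'n" where
  "cov c H V w Z = vdd D w (\<lambda>u. snd (Z u) c) +
     bil (\<lambda>m i j. H m i j (fst w)) (xcomp c w) (snd (Z (fst w)) c) +
     bil (\<lambda>m i j. V m i j (fst w)) (eta c w) (snd (Z (fst w)) c)"

lemma section_germ_near:
  assumes "section_germ v Z" "c \<in> C" "fst v \<in> fst c" 
  obtains W where "openin (atlas_topology D) W" "v \<in> W" "\<forall>u\<in>W. Z u \<in> tangent_space C (fst u)"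
    "smooth_near D v (\<lambda>u. snd (Z u) c)"
proof -
  obtain Z' W where Z: "Z' \<in> AFs" "openin (atlas_topology D) W" "v \<in> W" "\<forall>u\<in>W. Z' u = Z u"
    by (rule extend_section[OF assms(1)]) blast
  have WA: "W \<subseteq> A" using D.openin_subset_carrier[OF Z(2)] by simp
  have "smooth_near D v (\<lambda>u. snd (Z u) c)"
    by (rule D.smooth_near_cong[OF section_component_near[OF Z(1) _ assms(2,3)] Z(2,3)])
      (use Z(3,4) WA in auto)
  moreover have "\<forall>u\<in>W. Z u \<in> tangent_space C (fst u)"
  proof
    fix u assume u: "u \<in> W"
    then show "Z u \<in> tangent_space C (fst u)"
      using section_in[OF Z(1) subsetD[OF WA u]] Z(4) by simp
  qed
  ultimately show thesis using that Z(2,3) by blast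
qed

text \<open>
  The second derivatives of the coordinate change that come from differentiating the components of
  \<open>Z\<close> cancel against those in the transformation rule of \<open>H\<close>.
\<close>

lemma cov_change:
  assumes w: "w \<in> tangent_space D v" and v: "v \<in> A" and Z: "section_germ v Z"
    and c: "c \<in> C" "fst v \<in> fst c" and d: "d \<in> C" "fst v \<in> fst d"
    and H: "connection_rule c d Hc Hd v" and V: "tensor_rule c d Vc Vd v"
  shows "cov d Hd Vd w Z = jac c d (fst v) (cov c Hc Vc w Z)"
proof -
  let ?p = "fst v"
  have fw: "fst w = v" by (rule tangent_space_fst[OF w])
  obtain W where W: "openin (atlas_topology D) W" "v \<in> W" "\<forall>u\<in>W. Z u \<in> tangent_space C (fst u)"
    and n: "smooth_near D v (\<lambda>u. snd (Z u) d)"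
    by (rule section_germ_near[OF Z d]) blast
  have vd: "vdd D w (\<lambda>u. snd (Z u) c) =
    jac d c ?p (vdd D w (\<lambda>u. snd (Z u) d)) + hess d c ?p (xcomp d w) (snd (Z v) d)"
    by (rule vdd_change[OF w v c d W(1,2) W(3)[rule_format] n])
  have z: "snd (Z v) c = jac d c ?p (snd (Z v) d)"
    by (rule C.tangent_comp[OF bspec[OF W(3,2)] d(1) c(1) d(2) c(2)])
  have x: "xcomp c w = jac d c ?p (xcomp d w)" by (rule xcomp_change[OF w v d c])
  have e: "eta c w = jac d c ?p (eta d w)" by (rule eta_change[OF w v d c])
  have inv: "jac c d ?p (jac d c ?p y) = y" for y
    using C.jac_comp[of d c d ?p y] C.jac_self[of d ?p y] c d by simp
  have lin: "linear (jac c d ?p)" using C.jac_linear c d by blast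
  have h: "bil (\<lambda>m i j. Hd m i j v) (xcomp d w) (snd (Z v) d) = jac c d ?p (hess d c ?p (xcomp d w) (snd (Z v) d)) +
      jac c d ?p (bil (\<lambda>m i j. Hc m i j v) (xcomp c w) (snd (Z v) c))"
    using H unfolding connection_rule_iff[OF c d] x z linear_add[OF lin, symmetric] by blast
  have vv: "bil (\<lambda>m i j. Vd m i j v) (eta d w) (snd (Z v) d) =
      jac c d ?p (bil (\<lambda>m i j. Vc m i j v) (eta c w) (snd (Z v) c))"
    using V unfolding tensor_rule_iff[OF c d] e z by blast
  show ?thesis
    unfolding cov_def fw h vv vd linear_add[OF lin] inv by (simp add: algebra_simps)
qed

end

section \<open>The Christoffel symbols of a linear connection\<close>

locale koszul_nonlinear = koszul C A nabla + nonlinear C A HA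
  for C :: "('m, real^'n) chart set" and A nabla HA
begin

abbreviation "chrH c \<equiv> christoffel_H C A HA nabla c"
abbreviation "chrV c \<equiv> christoffel_V C A nabla c"

text \<open>
  Both sides are bilinear in the components of \<open>w\<close> and in \<open>z\<close>, and they agree on the frame of
  \<open>\<delta>\<^sub>i\<close> and vertical coordinate vectors by the definition of the Christoffel symbols.
\<close>

lemma conn_form_eq:
  assumes w: "w \<in> tangent_space D v" and v: "v \<in> A" and c: "c \<in> C" "fst v \<in> fst c"
  shows "conn_form c w z = bil (\<lambda>m i j. chrH c m i j v) (xcomp c w) z + bil (\<lambda>m i j. chrV c m i j v) (eta c w) z"
proof -
  obtain G where G: "bilinear G" and g: "\<forall>w\<in>tangent_space D v. \<forall>z. conn_form c w z = G (snd w (dch c)) z"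
    by (rule conn_form_bilinear[OF v c]) blast
  have G1: "linear (\<lambda>p. G p z)" for z using G unfolding bilinear_def by blast
  have G2: "linear (G p)" for p using G unfolding bilinear_def by blast
  define h where "h a = (a, - (Ncomp c v *v a))" for a
  have lh: "linear h" unfolding h_def
    by (intro linearI) (simp_all add: matrix_vector_right_distrib matrix_vector_mult_scaleR)
  have lv: "linear (\<lambda>a::real^'n. (0::real^'n, a))" by (intro linearI) simp_all
  have H: "G (h a) z = bil (\<lambda>m i j. chrH c m i j v) a z" for a z
  proof (rule bilinear_eq_axis[OF _ bilinear_bil])
    show "bilinear (\<lambda>a z. G (h a) z)"
      unfolding bilinear_def using G2 linear_compose[OF lh G1, unfolded o_def] by blast
    fix i j :: 'n
    note dv = delta_vec[OF v c, of i]
    have "snd (delta_vec C A HA c i v) (dch c) = h (axis i 1)"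
      using dv(2,3) tangent_space_fst[OF dv(1)] by (simp add: eta_def h_def prod_eq_iff eq_neg_iff_add_eq_0)
    then have "G (h (axis i 1)) (axis j 1) = conn_form c (delta_vec C A HA c i v) (axis j 1)"
      using g dv(1) by simp
    then show "G (h (axis i 1)) (axis j 1) = bil (\<lambda>m i j. chrH c m i j v) (axis i 1) (axis j 1)"
      by (simp add: vec_eq_iff bil_axis christoffel_H_def conn_form_def coord_field_def[abs_def])
  qed
  have V: "G (0, a) z = bil (\<lambda>m i j. chrV c m i j v) a z" for a z
  proof (rule bilinear_eq_axis[OF _ bilinear_bil])
    show "bilinear (\<lambda>a z. G (0, a) z)"
      unfolding bilinear_def using G2 linear_compose[OF lv G1, unfolded o_def] by blast
    fix i j :: 'n
    note dv = dy_vec[OF v c, of i]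
    have "snd (dy_vec C A c i v) (dch c) = (0, axis i 1)"
      using v c by (simp add: dy_vec_def)
    then have "G (0, axis i 1) (axis j 1) = conn_form c (dy_vec C A c i v) (axis j 1)"
      using g dv(1) by simp
    then show "G (0, axis i 1) (axis j 1) = bil (\<lambda>m i j. chrV c m i j v) (axis i 1) (axis j 1)"
      by (simp add: vec_eq_iff bil_axis christoffel_V_def conn_form_def coord_field_def[abs_def])
  qed
  have s: "snd w (dch c) = h (xcomp c w) + (0, eta c w)"
    unfolding eta_def tangent_space_fst[OF w] h_def by (simp add: prod_eq_iff)
  have "conn_form c w z = G (snd w (dch c)) z" using g w by blast
  also have "\<dots> = G (h (xcomp c w) + (0, eta c w)) z" by (rule arg_cong[OF s, of "\<lambda>p. G p z"])
  finally have "conn_form c w z = G (h (xcomp c w)) z + G (0, eta c w) z"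
    unfolding linear_add[OF G1] .
  then show ?thesis by (simp add: H V)
qed

lemma koszul_at_cov:
  assumes w: "w \<in> tangent_space D v" and v: "v \<in> A" and c: "c \<in> C" "fst v \<in> fst c" and Z: "section_germ v Z"
  shows "snd (koszul_at C A nabla w Z) c = cov c (chrH c) (chrV c) w Z"
proof -
  have "snd (koszul_at C A nabla w Z) c = vdd D w (\<lambda>u. snd (Z u) c) + conn_form c w (snd (Z v) c)"
    by (rule koszul_at_coordinates[OF v c w Z])
  then show ?thesis
    using conn_form_eq[OF w v c] tangent_space_fst[OF w] by (simp add: cov_def)
qed

text \<open>
  The section with constant components \<open>z\<close> in \<open>d\<close> has the components \<open>K z\<close> in \<open>c\<close>, where the Jacobian
  \<open>K\<close> varies with the base point.
\<close>

lemma conn_form_change: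
  assumes w: "w \<in> tangent_space D v" and v: "v \<in> A"
    and c: "c \<in> C" "fst v \<in> fst c" and d: "d \<in> C" "fst v \<in> fst d"
  shows "conn_form d w z = jac c d (fst v) (hess d c (fst v) (xcomp d w) z + conn_form c w (jac d c (fst v) z))"
proof -
  let ?Z = "\<lambda>u. coord_vec C d (fst u) z"
  have germ: "section_germ v ?Z" by (rule frame_germ[OF v d])
  obtain W where W: "openin (atlas_topology D) W" "v \<in> W" "\<forall>u\<in>W. ?Z u \<in> tangent_space C (fst u)"
    and n: "smooth_near D v (\<lambda>u. snd (?Z u) d)"
    by (rule section_germ_near[OF germ d]) blast
  have vd: "vdd D w (\<lambda>u. snd (?Z u) c) =
    jac d c (fst v) (vdd D w (\<lambda>u. snd (?Z u) d)) + hess d c (fst v) (xcomp d w) (snd (?Z v) d)"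
    by (rule vdd_change[OF w v c d W(1,2) W(3)[rule_format] n])
  have "vdd D w (\<lambda>u. snd (?Z u) d) = vdd D w (\<lambda>u. z)"
    by (rule D.vdd_cong[OF w openin_dom[OF d(1)]]) (use v d in auto)
  also have "\<dots> = 0" by (rule D.vdd_const[OF w]) (use v in simp)
  finally have "vdd D w (\<lambda>u. snd (?Z u) c) = hess d c (fst v) (xcomp d w) z"
    using vd d linear_0[OF C.jac_linear[OF d(1) c(1) d(2) c(2)]] by simp
  moreover have "snd (koszul_at C A nabla w ?Z) c = vdd D w (\<lambda>u. snd (?Z u) c) + conn_form c w (snd (?Z v) c)"
    by (rule koszul_at_coordinates[OF v c w germ])
  moreover have "snd (koszul_at C A nabla w ?Z) d = jac c d (fst v) (snd (koszul_at C A nabla w ?Z) c)"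
    by (rule C.tangent_comp[OF koszul_at_tangent[OF v w germ] c(1) d(1) c(2) d(2)])
  moreover have "snd (?Z v) c = jac d c (fst v) z" by (rule C.coord_vec_apply[OF c])
  ultimately show ?thesis by (simp add: conn_form_def)
qed

text \<open>
  Horizontal vectors \<open>w\<close> single out the horizontal symbols in the transformation of the connection form,
  and vertical vectors \<open>w\<close> the vertical symbols. For the latter the second derivatives drop out,
  because their base component is zero.
\<close>

lemma christoffel_rules:
  assumes v: "v \<in> A" and c: "c \<in> C" "fst v \<in> fst c" and d: "d \<in> C" "fst v \<in> fst d"
  shows "connection_rule c d (chrH c) (chrH d) v" and "tensor_rule c d (chrV c) (chrV d) v"
proof -
  note lin = linear_0[OF bilinear_bil[unfolded bilinear_def, THEN conjunct2, rule_format]]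
  have dd: "dch d \<in> D" "v \<in> fst (dch d)" using v d by auto
  show "connection_rule c d (chrH c) (chrH d) v"
    unfolding connection_rule_iff[OF c d]
  proof (intro allI)
    fix a b
    let ?w = "coord_vec D (dch d) v (a, - (Ncomp d v *v a))"
    have w: "?w \<in> tangent_space D v" "snd ?w (dch d) = (a, - (Ncomp d v *v a))" "eta d ?w = 0"
      using D.coord_vec_in[OF dd] D.coord_vec_self[OF dd] by (simp_all add: eta_def)
    have x: "xcomp c ?w = jac d c (fst v) a" using xcomp_change[OF w(1) v d c] w(2) by simp
    have e: "eta c ?w = 0"
      using eta_change[OF w(1) v d c] w(3) linear_0[OF C.jac_linear[OF d(1) c(1) d(2) c(2)]] by simp
    show "bil (\<lambda>m i j. chrH d m i j v) a b = jac c d (fst v) (hess d c (fst v) a b +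
       bil (\<lambda>m i j. chrH c m i j v) (jac d c (fst v) a) (jac d c (fst v) b))"
      using conn_form_change[OF w(1) v c d, of b]
      unfolding conn_form_eq[OF w(1) v d] conn_form_eq[OF w(1) v c] x e w(3) lin w(2) by simp
  qed
  show "tensor_rule c d (chrV c) (chrV d) v"
    unfolding tensor_rule_iff[OF c d]
  proof (intro allI)
    fix a b
    let ?w = "vert d v a"
    have w: "?w \<in> tangent_space D v" "snd ?w (dch d) = (0, a)" "eta d ?w = a"
      using vert[OF v d, of a] by (simp_all add: eta_def)
    have x: "xcomp c ?w = 0"
      using vert_comp[OF v d c, of a] by simp
    have e: "eta c ?w = jac d c (fst v) a"
      using eta_change[OF w(1) v d c] w(3) by simp
    have x': "xcomp d ?w = 0" using w(2) by simp
    show "bil (\<lambda>m i j. chrV d m i j v) a b = jac c d (fst v)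
       (bil (\<lambda>m i j. chrV c m i j v) (jac d c (fst v) a) (jac d c (fst v) b))"
      using conn_form_change[OF w(1) v c d, of b]
      unfolding conn_form_eq[OF w(1) v d] conn_form_eq[OF w(1) v c] x e w(3) lin x' hess_zero_left[OF d c]
      by simp
  qed
qed

end

section \<open>The horizontal distribution and invariance by homotheties\<close>

context koszul
begin

text \<open>
  The value and the derivative in the direction \<open>w\<close> of a section can be prescribed: take components that
  are affine functions of the coordinates of \<open>A\<close>, and extend.
\<close>

lemma section_with_jet:
  assumes v: "v \<in> A" and c: "c \<in> C" "fst v \<in> fst c" and w: "w \<in> tangent_space D v"
    and \<zeta>: "snd w (dch c) = 0 \<Longrightarrow> \<zeta> = 0"
  obtains Z where "Z \<in> AFs" "snd (Z v) c = z" "vdd D w (\<lambda>u. snd (Z u) c) = \<zeta>"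
proof -
  let ?p = "snd w (dch c)"
  \<comment> \<open>\<open>L\<close> maps \<open>w\<close> to \<open>\<zeta>\<close>; if \<open>w\<close> is zero, then division by zero makes \<open>L\<close> zero, as it should be.\<close>
  define L where "L q = ((q \<bullet> ?p) / (?p \<bullet> ?p)) *\<^sub>R \<zeta>" for q
  have L: "bounded_linear L"
  proof -
    have "bounded_linear (\<lambda>q. (q \<bullet> ?p) *\<^sub>R ((1 / (?p \<bullet> ?p)) *\<^sub>R \<zeta>))"
      by (rule bounded_linear_compose[OF bounded_linear_scaleR_left bounded_linear_inner_left])
    then show ?thesis by (simp add: L_def[abs_def])
  qed
  have Lp: "L ?p = \<zeta>" using \<zeta> by (cases "?p = 0") (simp_all add: L_def)
  define F where "F u = (z - L (snd (dch c) v)) + L (snd (dch c) u)" for u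
  define Z0 where "Z0 u = coord_vec C c (fst u) (F u)" for u
  have cd: "dch c \<in> D" "v \<in> fst (dch c)" using v c by auto
  have nF: "smooth_near D u F" if u: "u \<in> fst (dch c)" for u
    unfolding F_def
    by (intro D.smooth_near_add D.smooth_near_const D.smooth_near_linear[OF L] D.smooth_near_chart[OF cd(1) u])
      (use u c in simp)
  have Z0c: "snd (Z0 u) c = F u" if "u \<in> fst (dch c)" for u
    using that c by (simp add: Z0_def)
  have germ: "section_germ v Z0"
    unfolding section_germ_def
  proof (intro exI[of _ "fst (dch c)"] conjI ballI)
    show "openin (atlas_topology D) (fst (dch c))" "v \<in> fst (dch c)" using openin_dom c cd by auto
    fix u assume u: "u \<in> fst (dch c)"
    show "Z0 u \<in> tangent_space C (fst u)" using u c by (simp add: Z0_def)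
    have "smooth_near D u (\<lambda>u. snd (Z0 u) c)"
      by (rule D.smooth_near_cong[OF nF[OF u] openin_dom[OF c(1)] u]) (simp only: Z0c)
    then show "\<exists>d\<in>C. fst u \<in> fst d \<and> smooth_near D u (\<lambda>u. snd (Z0 u) d)" using u c by auto
  qed
  obtain Z W where Z: "Z \<in> AFs" "openin (atlas_topology D) W" "v \<in> W" "\<forall>u\<in>W. Z u = Z0 u"
    by (rule extend_section[OF germ]) blast
  have o: "openin (atlas_topology D) (W \<inter> fst (dch c))" using Z(2) openin_dom[OF c(1)] by blast
  have vo: "v \<in> W \<inter> fst (dch c)" using Z(3) cd(2) by blast
  have "vdd D w (\<lambda>u. snd (Z u) c) = vdd D w F"
    by (rule D.vdd_cong[OF w o vo]) (use Z(4) Z0c in auto)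
  also have "\<dots> = vdd D w (\<lambda>u. z - L (snd (dch c) v)) + vdd D w (\<lambda>u. L (snd (dch c) u))"
    unfolding F_def
    by (intro D.vdd_add[OF w] D.smooth_near_const D.smooth_near_linear[OF L] D.smooth_near_chart[OF cd])
      (use v in simp)
  also have "vdd D w (\<lambda>u. z - L (snd (dch c) v)) = 0" by (rule D.vdd_const[OF w]) (use v in simp)
  also have "vdd D w (\<lambda>u. L (snd (dch c) u)) = L (vdd D w (snd (dch c)))"
    by (rule D.vdd_linear[OF w D.smooth_near_chart[OF cd] L])
  also have "vdd D w (snd (dch c)) = ?p" by (rule D.vdd_coord[OF w cd])
  finally have d: "vdd D w (\<lambda>u. snd (Z u) c) = \<zeta>" by (simp add: Lp)
  have "snd (Z v) c = z" using Z(3,4) Z0c[OF cd(2)] by (simp add: F_def)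
  then show thesis by (rule that[OF Z(1) _ d])
qed

text \<open>
  A section with value \<open>z\<close> at \<open>v\<close> can be given any derivative in a direction \<open>w \<noteq> 0\<close>, and its
  covariant derivative vanishes exactly if that derivative is minus the connection form.
\<close>

lemma horizontal_iff:
  assumes v: "v \<in> A" and c: "c \<in> C" "fst v \<in> fst c"
  shows "\<xi> \<in> horizontal_distribution C A nabla (vert c v z) \<longleftrightarrow> \<xi> \<in> tangent_space VA (vert c v z) \<and>
    snd (snd \<xi> (vch c)) = - conn_form c (coord_vec D (dch c) v (fst (snd \<xi> (vch c)))) z"
    (is "_ \<longleftrightarrow> ?R")
proof -
  note e = vert[OF v c, of z]
  have cd: "dch c \<in> D" "v \<in> fst (dch c)" using v c by auto
  have lift: "vertical_lift C A v (Z v) = vert c v (snd (Z v) c)" if Z: "Z \<in> AFs" for Z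
    by (rule vertical_lift_comp[OF v section_in[OF Z v] c])
  have kos: "koszul_at C A nabla w Z = tzero (fst v) \<longleftrightarrow> vdd D w (\<lambda>u. snd (Z u) c) = - conn_form c w (snd (Z v) c)"
    if Z: "Z \<in> AFs" and w: "w \<in> tangent_space D v" for Z w
  proof -
    note germ = section_germ_of_section[OF Z v]
    have k: "snd (koszul_at C A nabla w Z) c = vdd D w (\<lambda>u. snd (Z u) c) + conn_form c w (snd (Z v) c)"
      by (rule koszul_at_coordinates[OF v c w germ])
    have "koszul_at C A nabla w Z = tzero (fst v) \<longleftrightarrow> snd (koszul_at C A nabla w Z) c = 0"
      using C.tangent_eqI[OF koszul_at_tangent[OF v w germ] C.tzero_in c] snd_tzero by metis
    then show ?thesis unfolding k by (simp add: eq_neg_iff_add_eq_0)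
  qed
  have tan: "tangent_map D VA (\<lambda>v. vertical_lift C A v (Z v)) w \<in> tangent_space VA (vertical_lift C A v (Z v))"
    if Z: "Z \<in> AFs" and w: "w \<in> tangent_space D v" for Z w
    using D.tangent_map_apply(1)[OF atlas_vertical smooth_lift(1)[OF Z] w] v by simp
  show ?thesis
  proof
    assume "\<xi> \<in> horizontal_distribution C A nabla (vert c v z)"
    then obtain Z w where \<xi>: "\<xi> = tangent_map D VA (\<lambda>v. vertical_lift C A v (Z v)) w"
      and Z: "Z \<in> AFs" and w: "w \<in> tangent_space D v"
      and l: "vertical_lift C A v (Z v) = vert c v z" and k: "koszul_at C A nabla w Z = tzero (fst v)"
      unfolding horizontal_distribution_def anisotropic_fields_eq e(1) mem_Collect_eq
      by (elim exE conjE) (rule that)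
    have "snd (vert c v (snd (Z v) c)) (dch c) = snd (vert c v z) (dch c)"
      using l unfolding lift[OF Z] by (rule arg_cong)
    then have z: "snd (Z v) c = z" unfolding vert(3)[OF v c] by simp
    have s: "snd \<xi> (vch c) = (snd w (dch c), vdd D w (\<lambda>u. snd (Z u) c))"
      unfolding \<xi> by (rule smooth_lift(2)[OF Z w v c])
    have "\<xi> \<in> tangent_space VA (vert c v z)" using tan[OF Z w] unfolding \<xi> l .
    moreover have "snd (snd \<xi> (vch c)) = - conn_form c w z"
      using k unfolding kos[OF Z w] s z by simp
    moreover have "coord_vec D (dch c) v (fst (snd \<xi> (vch c))) = w"
      unfolding s fst_conv by (rule D.coord_vec_collapse[OF w cd])
    ultimately show ?R by simp
  next
    assume R: ?R
    define w where "w = coord_vec D (dch c) v (fst (snd \<xi> (vch c)))"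
    have w: "w \<in> tangent_space D v" "snd w (dch c) = fst (snd \<xi> (vch c))"
      unfolding w_def by (rule D.coord_vec_in[OF cd]) (rule D.coord_vec_self[OF cd])
    have \<zeta>: "snd (snd \<xi> (vch c)) = - conn_form c w z" using R unfolding w_def by blast
    have "snd (snd \<xi> (vch c)) = 0" if "snd w (dch c) = 0"
    proof (rule conn_form_bilinear[OF v c])
      fix G assume "bilinear G" "\<forall>w\<in>tangent_space D v. \<forall>z. conn_form c w z = G (snd w (dch c)) z"
      then show ?thesis using w(1) that \<zeta> bilinear_lzero by simp
    qed
    then obtain Z where Z: "Z \<in> AFs" "snd (Z v) c = z" "vdd D w (\<lambda>u. snd (Z u) c) = snd (snd \<xi> (vch c))"
      by (rule section_with_jet[OF v c w(1)])
    have l: "vertical_lift C A v (Z v) = vert c v z" using lift[OF Z(1)] Z(2) by simp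
    have k: "koszul_at C A nabla w Z = tzero (fst v)" unfolding kos[OF Z(1) w(1)] Z(2,3) by (rule \<zeta>)
    have "snd (tangent_map D VA (\<lambda>v. vertical_lift C A v (Z v)) w) (vch c) = snd \<xi> (vch c)"
      unfolding smooth_lift(2)[OF Z(1) w(1) v c] Z(3) w(2) by simp
    then have "tangent_map D VA (\<lambda>v. vertical_lift C A v (Z v)) w = \<xi>"
      using VA.tangent_eqI[OF tan[OF Z(1) w(1), unfolded l] conjunct1[OF R] vch_in[OF c(1)] vch_vert(1)[OF v c]]
      by blast
    then show "\<xi> \<in> horizontal_distribution C A nabla (vert c v z)"
      unfolding horizontal_distribution_def anisotropic_fields_eq e(1) mem_Collect_eq
      using Z(1) w(1) l k by (intro exI[of _ Z] exI[of _ w]) simp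
  qed
qed

lemma conn_form_scale:
  assumes v: "v \<in> A" and c: "c \<in> C" "fst v \<in> fst c" and w: "w \<in> tangent_space D v"
  shows "conn_form c w (l *\<^sub>R z) = l *\<^sub>R conn_form c w z"
proof (rule conn_form_bilinear[OF v c])
  fix G assume "bilinear G" "\<forall>w\<in>tangent_space D v. \<forall>z. conn_form c w z = G (snd w (dch c)) z"
  then show ?thesis using w bilinear_rmul[of G] by simp
qed

text \<open>
  In coordinates the homothety acts on \<open>T(VA)\<close> by \<open>((a, b), \<zeta>) \<mapsto> ((a, l b), l \<zeta>)\<close>. It preserves
  the horizontal spaces exactly if the connection form at \<open>l v\<close> applied to \<open>(a, l b)\<close> agrees with
  the connection form at \<open>v\<close> applied to \<open>(a, b)\<close>.
\<close>

definition homogeneous_form :: "('m, 'e) chart \<Rightarrow> ('m, 'e) tvec \<Rightarrow> real \<Rightarrow> bool" where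
  "homogeneous_form c v l \<longleftrightarrow> (\<forall>p z. conn_form c (coord_vec D (dch c) v p) z =
     conn_form c (coord_vec D (dch c) (tscale l v) (fst p, l *\<^sub>R snd p)) z)"

lemma homothety_horizontal_iff:
  assumes l: "l > 0" and v: "v \<in> A" and c: "c \<in> C" "fst v \<in> fst c"
  shows "(\<forall>z. tangent_map VA VA (vertical_homothety C A l) ` horizontal_distribution C A nabla (vert c v z) =
      horizontal_distribution C A nabla (vertical_homothety C A l (vert c v z))) \<longleftrightarrow> homogeneous_form c v l"
    (is "(\<forall>z. ?T ` ?H z = ?H' z) \<longleftrightarrow> _")
proof -
  let ?v = "tscale l v"
  have lv: "?v \<in> A" "fst ?v \<in> fst c" using scaleA[OF v l] c by auto
  have cd: "dch c \<in> D" "v \<in> fst (dch c)" "?v \<in> fst (dch c)" using v c lv by auto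
  have H': "?H' z = horizontal_distribution C A nabla (vert c ?v (l *\<^sub>R z))" for z
    unfolding vertical_homothety_vert[OF l v c] ..
  note T = smooth_vertical_homothety(2,3)[OF l _ v c]
  have T_horizontal: "?T \<xi> \<in> ?H' z \<longleftrightarrow>
      conn_form c (coord_vec D (dch c) v (fst (snd \<xi> (vch c)))) z =
      conn_form c (coord_vec D (dch c) ?v (fst (fst (snd \<xi> (vch c))), l *\<^sub>R snd (fst (snd \<xi> (vch c))))) z"
    if \<xi>: "\<xi> \<in> ?H z" for \<xi> z
  proof -
    have x: "\<xi> \<in> tangent_space VA (vert c v z)"
      "snd (snd \<xi> (vch c)) = - conn_form c (coord_vec D (dch c) v (fst (snd \<xi> (vch c)))) z"
      using \<xi> horizontal_iff[OF v c] by blast+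
    have "?T \<xi> \<in> ?H' z \<longleftrightarrow> l *\<^sub>R snd (snd \<xi> (vch c)) =
        - conn_form c (coord_vec D (dch c) ?v (fst (fst (snd \<xi> (vch c))), l *\<^sub>R snd (fst (snd \<xi> (vch c))))) (l *\<^sub>R z)"
      unfolding H' horizontal_iff[OF lv(1) c(1) lv(2)] T(2)[OF x(1)] using T(1)[OF x(1)] by simp
    also have "\<dots> \<longleftrightarrow> snd (snd \<xi> (vch c)) =
        - conn_form c (coord_vec D (dch c) ?v (fst (fst (snd \<xi> (vch c))), l *\<^sub>R snd (fst (snd \<xi> (vch c))))) z"
      unfolding conn_form_scale[OF lv(1) c(1) lv(2) D.coord_vec_in[OF cd(1,3)]] using l
      by (simp flip: scaleR_minus_right)
    finally show ?thesis unfolding x(2) by simp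
  qed
  define lift where "lift z p = coord_vec VA (vch c) (vert c v z) (p, - conn_form c (coord_vec D (dch c) v p) z)" for z p
  have lift: "snd (lift z p) (vch c) = (p, - conn_form c (coord_vec D (dch c) v p) z)"
    "lift z p \<in> tangent_space VA (vert c v z)" "lift z p \<in> ?H z" for z p
  proof -
    show 1: "snd (lift z p) (vch c) = (p, - conn_form c (coord_vec D (dch c) v p) z)"
      unfolding lift_def by (rule VA.coord_vec_self[OF vch_in[OF c(1)] vch_vert(1)[OF v c]])
    show 2: "lift z p \<in> tangent_space VA (vert c v z)"
      unfolding lift_def by (rule VA.coord_vec_in[OF vch_in[OF c(1)] vch_vert(1)[OF v c]])
    show "lift z p \<in> ?H z" unfolding horizontal_iff[OF v c] 1 using 2 by simp
  qed
  show ?thesis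
  proof
    assume R: "\<forall>z. ?T ` ?H z = ?H' z"
    show "homogeneous_form c v l"
      unfolding homogeneous_form_def
    proof (intro allI)
      fix p z
      have "?T (lift z p) \<in> ?H' z" using R lift(3) by blast
      then show "conn_form c (coord_vec D (dch c) v p) z =
          conn_form c (coord_vec D (dch c) (tscale l v) (fst p, l *\<^sub>R snd p)) z"
        unfolding T_horizontal[OF lift(3)] lift(1) fst_conv .
    qed
  next
    assume hom: "homogeneous_form c v l"
    show "\<forall>z. ?T ` ?H z = ?H' z"
    proof (intro allI equalityI subsetI)
      fix z \<xi>' assume "\<xi>' \<in> ?T ` ?H z"
      then obtain \<xi> where \<xi>: "\<xi> \<in> ?H z" "\<xi>' = ?T \<xi>" by blast
      show "\<xi>' \<in> ?H' z"
        unfolding \<xi>(2) T_horizontal[OF \<xi>(1)] using hom unfolding homogeneous_form_def by blast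
    next
      fix z \<xi>' assume \<xi>': "\<xi>' \<in> ?H' z"
      define p where "p = fst (snd \<xi>' (vch c))"
      have x: "\<xi>' \<in> tangent_space VA (vert c ?v (l *\<^sub>R z))"
        "snd \<xi>' (vch c) = (p, - conn_form c (coord_vec D (dch c) ?v p) (l *\<^sub>R z))"
        using \<xi>' unfolding H' horizontal_iff[OF lv(1) c(1) lv(2)] by (auto simp: p_def prod_eq_iff)
      let ?q = "(fst p, (1 / l) *\<^sub>R snd p)"
      have "conn_form c (coord_vec D (dch c) v ?q) z = conn_form c (coord_vec D (dch c) ?v p) z"
        using hom[unfolded homogeneous_form_def, rule_format, of ?q z] l by simp
      then have "snd (?T (lift z ?q)) (vch c) = snd \<xi>' (vch c)"
        unfolding T(2)[OF lift(2)] lift(1) x(2) conn_form_scale[OF lv(1) c(1) lv(2) D.coord_vec_in[OF cd(1,3)]]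
        using l by simp
      then have "?T (lift z ?q) = \<xi>'"
        using VA.tangent_eqI[OF T(1)[OF lift(2)] x(1) vch_in[OF c(1)] vch_vert(1)[OF lv(1) c(1) lv(2)]] by blast
      then show "\<xi>' \<in> ?T ` ?H z" using lift(3) by blast
    qed
  qed
qed

lemma homothety_invariant_imp:
  assumes "homothety_invariant C A nabla" "l > 0" "v \<in> A" "c \<in> C" "fst v \<in> fst c"
  shows "homogeneous_form c v l"
  unfolding homothety_horizontal_iff[OF assms(2-5), symmetric]
  using assms(1,2) vert(4)[OF assms(3-5)] unfolding homothety_invariant_def by blast

lemma homothety_invariantI:
  assumes "\<And>l v. l > 0 \<Longrightarrow> v \<in> A \<Longrightarrow> \<exists>c\<in>C. fst v \<in> fst c \<and> homogeneous_form c v l"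
  shows "homothety_invariant C A nabla"
  unfolding homothety_invariant_def
proof (intro allI impI ballI)
  fix l :: real and e assume l: "0 < l" and e: "e \<in> vertical_bundle C A"
  obtain c where c: "c \<in> C" "fst (fst e) \<in> fst c" "homogeneous_form c (fst e) l"
    using assms[OF l vertical_bundle_fst[OF e]] by blast
  have "tangent_map VA VA (vertical_homothety C A l) `
      horizontal_distribution C A nabla (vert c (fst e) (ycomp c e)) =
      horizontal_distribution C A nabla (vertical_homothety C A l (vert c (fst e) (ycomp c e)))"
    using c(3) unfolding homothety_horizontal_iff[OF l vertical_bundle_fst[OF e] c(1,2), symmetric] by blast
  then show "tangent_map VA VA (vertical_homothety C A l) ` horizontal_distribution C A nabla e =
      horizontal_distribution C A nabla (vertical_homothety C A l e)"
    unfolding vertical_collapse[OF e c(1,2)] .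
qed

end

context koszul_nonlinear
begin

text \<open>
  Since \<open>N\<close> is homogeneous of degree \<open>1\<close>, scaling the fibre component of a vector scales its
  \<open>\<eta>\<close>. Horizontal vectors then isolate the condition on the horizontal symbols and vertical vectors the one on
  the vertical symbols.
\<close>

lemma homogeneous_form_iff:
  assumes l: "l > 0" and v: "v \<in> A" and c: "c \<in> C" "fst v \<in> fst c"
  shows "homogeneous_form c v l \<longleftrightarrow> (\<forall>a i j. chrH c a i j (tscale l v) = chrH c a i j v \<and>
    chrV c a i j (tscale l v) = inverse l * chrV c a i j v)"
proof -
  let ?v = "tscale l v"
  have lv: "?v \<in> A" "fst ?v \<in> fst c" using scaleA[OF v l] c by auto
  let ?H = "\<lambda>v. bil (\<lambda>m i j. chrH c m i j v)" and ?V = "\<lambda>v. bil (\<lambda>m i j. chrV c m i j v)"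
  have form: "conn_form c (coord_vec D (dch c) u p) z =
      ?H u (fst p) z + ?V u (snd p + Ncomp c u *v fst p) z" if u: "u \<in> A" "fst u \<in> fst c" for u p z
  proof -
    have cd: "dch c \<in> D" "u \<in> fst (dch c)" using u c by auto
    show ?thesis
      unfolding conn_form_eq[OF D.coord_vec_in[OF cd] u(1) c(1) u(2)] eta_def D.coord_vec_self[OF cd] by simp
  qed
  note rmul = bilinear_lmul[OF bilinear_bil] and lzero = bilinear_lzero[OF bilinear_bil]
  have form': "conn_form c (coord_vec D (dch c) ?v (fst p, l *\<^sub>R snd p)) z =
      ?H ?v (fst p) z + l *\<^sub>R ?V ?v (snd p + Ncomp c v *v fst p) z" for p z
    unfolding form[OF lv] fst_conv snd_conv Ncomp_scale[OF v c l] scaleR_add_right[symmetric] rmul ..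
  show ?thesis
  proof
    assume hom: "homogeneous_form c v l"
    have eq: "?H v a z + ?V v (b + Ncomp c v *v a) z = ?H ?v a z + l *\<^sub>R ?V ?v (b + Ncomp c v *v a) z" for a b z
      using hom[unfolded homogeneous_form_def, rule_format, of "(a, b)" z]
      unfolding form[OF v c(2)] form' by simp
    have H: "?H ?v a z = ?H v a z" for a z
      using eq[of a z "- (Ncomp c v *v a)"] by (simp add: lzero)
    have V: "?V v a z = l *\<^sub>R ?V ?v a z" for a z
      using eq[of 0 z a] by (simp add: lzero)
    show "\<forall>a i j. chrH c a i j ?v = chrH c a i j v \<and> chrV c a i j ?v = inverse l * chrV c a i j v"
    proof (intro allI conjI)
      fix a i j
      show "chrH c a i j ?v = chrH c a i j v"
        using arg_cong[OF H[of "axis i 1" "axis j 1"], of "\<lambda>x. x $ a"] by (simp add: bil_axis)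
      show "chrV c a i j ?v = inverse l * chrV c a i j v"
        using arg_cong[OF V[of "axis i 1" "axis j 1"], of "\<lambda>x. x $ a"] l by (simp add: bil_axis)
    qed
  next
    assume "\<forall>a i j. chrH c a i j ?v = chrH c a i j v \<and> chrV c a i j ?v = inverse l * chrV c a i j v"
    then have H: "?H ?v = ?H v" and V: "?V ?v a z = inverse l *\<^sub>R ?V v a z" for a z
      by (simp_all add: bil_def vec_eq_iff sum_distrib_left algebra_simps)
    show "homogeneous_form c v l"
      unfolding homogeneous_form_def form' H V using form[OF v c(2)] l by simp
  qed
qed

end

section \<open>Linear connections from Christoffel symbols\<close>

context nonlinear
begin

lemma smooth_near_vec:
  fixes f :: "_ \<Rightarrow> real^'k"
  assumes v: "v \<in> A" and f: "\<And>m. smooth_near D v (\<lambda>u. f u $ m)"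
  shows "smooth_near D v f"
proof -
  have sm: "smooth_near D v (\<lambda>u. \<Sum>m\<in>UNIV. f u $ m *\<^sub>R axis m 1)"
    by (intro D.smooth_near_sum D.smooth_near_bilinear[OF bounded_bilinear_scaleR] D.smooth_near_const f)
      (use v in simp_all)
  have eq: "(\<lambda>u. \<Sum>m\<in>UNIV. f u $ m *\<^sub>R axis m 1) = f"
    by (rule ext) (rule vec_eq_sum_axis[symmetric])
  show ?thesis by (rule subst[where P="smooth_near D v", OF eq sm])
qed

lemma smooth_near_bil:
  assumes v: "v \<in> A" and h: "\<And>m i j. smooth_near D v (\<lambda>u. h m i j u)"
    and a: "smooth_near D v a" and b: "smooth_near D v b"
  shows "smooth_near D v (\<lambda>u. bil (\<lambda>m i j. h m i j u) (a u) (b u))"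
proof (rule smooth_near_vec[OF v])
  fix m
  have "smooth_near D v (\<lambda>u. \<Sum>i\<in>UNIV. \<Sum>j\<in>UNIV. a u $ i * b u $ j * h m i j u)"
    by (intro D.smooth_near_sum D.smooth_near_bilinear[OF bounded_bilinear_mult] h
        D.smooth_near_linear[OF bounded_linear_vec_nth a] D.smooth_near_linear[OF bounded_linear_vec_nth b])
      (use v in simp_all)
  then show "smooth_near D v (\<lambda>u. bil (\<lambda>m i j. h m i j u) (a u) (b u) $ m)"
    by (simp add: bil_def)
qed

lemma eta_near:
  assumes X: "X \<in> VFs" and v: "v \<in> A" and c: "c \<in> C" "fst v \<in> fst c"
  shows "smooth_near D v (\<lambda>u. xcomp c (X u))" and "smooth_near D v (\<lambda>u. eta c (X u))"
proof -
  note n = field_component_near[OF X v c]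
  show x: "smooth_near D v (\<lambda>u. xcomp c (X u))" by (rule D.smooth_near_linear[OF bounded_linear_fst n])
  have y: "smooth_near D v (\<lambda>u. ycomp c (X u))" by (rule D.smooth_near_linear[OF bounded_linear_snd n])
  have N: "smooth_near D v (\<lambda>u. Ncomp c u *v xcomp c (X u))"
  proof (rule smooth_near_vec[OF v])
    fix m
    have "smooth_near D v (\<lambda>u. \<Sum>k\<in>UNIV. Ncomp c u $ m $ k * xcomp c (X u) $ k)"
      by (intro D.smooth_near_sum D.smooth_near_bilinear[OF bounded_bilinear_mult] Ncomp_near[OF v c]
          D.smooth_near_linear[OF bounded_linear_vec_nth x]) (use v in simp)
    then show "smooth_near D v (\<lambda>u. (Ncomp c u *v xcomp c (X u)) $ m)"
      by (simp add: matrix_vector_mult_def)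
  qed
  show "smooth_near D v (\<lambda>u. eta c (X u))"
  proof (rule D.smooth_near_cong[OF D.smooth_near_add[OF y N] D.openin_carrier])
    show "ycomp c (X u) + Ncomp c u *v xcomp c (X u) = eta c (X u)" if "u \<in> carrier D" for u
      using tangent_space_fst[OF field_in[OF X, of u]] that by (simp add: eta_def)
  qed (use v in simp)
qed

lemma eta_tadd: "fst w = fst w' \<Longrightarrow> eta c (tadd w w') = eta c w + eta c w'"
  by (simp add: eta_def matrix_vector_right_distrib)

lemma eta_tscale: "eta c (tscale r w) = r *\<^sub>R eta c w"
  by (simp add: eta_def scaleR_add_right matrix_vector_mult_scaleR)

lemmas bil_simps = bilinear_ladd[OF bilinear_bil] bilinear_radd[OF bilinear_bil]
  bilinear_lmul[OF bilinear_bil] bilinear_rmul[OF bilinear_bil]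

lemma cov_tadd:
  assumes w: "w \<in> tangent_space D v" "w' \<in> tangent_space D v" and Z: "Z \<in> AFs"
    and v: "v \<in> A" and c: "c \<in> C" "fst v \<in> fst c"
  shows "cov c H V (tadd w w') Z = cov c H V w Z + cov c H V w' Z"
  using tangent_space_fst[OF w(1)] tangent_space_fst[OF w(2)]
  by (simp add: cov_def D.vdd_tadd[OF w section_component_near[OF Z v c]] eta_tadd bil_simps)

lemma cov_tscale:
  assumes w: "w \<in> tangent_space D v" and Z: "Z \<in> AFs" and v: "v \<in> A" and c: "c \<in> C" "fst v \<in> fst c"
  shows "cov c H V (tscale r w) Z = r *\<^sub>R cov c H V w Z"
  by (simp add: cov_def D.vdd_tscale[OF w section_component_near[OF Z v c]] eta_tscale bil_simps scaleR_add_right)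

lemma cov_section_tadd:
  assumes w: "w \<in> tangent_space D v" and Y: "Y \<in> AFs" and Z: "Z \<in> AFs"
    and v: "v \<in> A" and c: "c \<in> C" "fst v \<in> fst c"
  shows "cov c H V w (\<lambda>u\<in>A. tadd (Y u) (Z u)) = cov c H V w Y + cov c H V w Z"
proof -
  have "vdd D w (\<lambda>u. snd ((\<lambda>u\<in>A. tadd (Y u) (Z u)) u) c) = vdd D w (\<lambda>u. snd (Y u) c + snd (Z u) c)"
    by (rule D.vdd_cong[OF w D.openin_carrier]) (use v in auto)
  also have "\<dots> = vdd D w (\<lambda>u. snd (Y u) c) + vdd D w (\<lambda>u. snd (Z u) c)"
    by (rule D.vdd_add[OF w section_component_near[OF Y v c] section_component_near[OF Z v c]])
  finally show ?thesis
    using tangent_space_fst[OF w] v by (simp add: cov_def bil_simps)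
qed

lemma cov_leibniz:
  assumes w: "w \<in> tangent_space D v" and f: "smf D A f" and Z: "Z \<in> AFs"
    and v: "v \<in> A" and c: "c \<in> C" "fst v \<in> fst c"
  shows "cov c H V w (\<lambda>u\<in>A. tscale (f u) (Z u)) = vdd D w f *\<^sub>R snd (Z v) c + f v *\<^sub>R cov c H V w Z"
proof -
  have n: "smooth_near D v f"
    using f v D.smf_near[OF D.openin_carrier, of f] by simp
  have "vdd D w (\<lambda>u. snd ((\<lambda>u\<in>A. tscale (f u) (Z u)) u) c) = vdd D w (\<lambda>u. f u *\<^sub>R snd (Z u) c)"
    by (rule D.vdd_cong[OF w D.openin_carrier]) (use v in auto)
  also have "\<dots> = f v *\<^sub>R vdd D w (\<lambda>u. snd (Z u) c) + vdd D w f *\<^sub>R snd (Z v) c"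
    by (rule D.vdd_bilinear[OF bounded_bilinear_scaleR w n section_component_near[OF Z v c]])
  finally show ?thesis
    using tangent_space_fst[OF w] v by (simp add: cov_def bil_simps scaleR_add_right)
qed

end

locale christoffel_data = nonlinear C A HA
  for C :: "('m, real^'n) chart set" and A HA +
  fixes B :: "('m, real^'n) chart set"
    and H V :: "('m, real^'n) chart \<Rightarrow> ('m, 'n) symbols"
  assumes subset: "B \<subseteq> C" and covers: "carrier B = carrier C"
    and smooth: "c \<in> B \<Longrightarrow> smf D {v \<in> A. fst v \<in> fst c} (H c a i j)"
      "c \<in> B \<Longrightarrow> smf D {v \<in> A. fst v \<in> fst c} (V c a i j)"
    and rules: "c \<in> B \<Longrightarrow> d \<in> B \<Longrightarrow> v \<in> A \<Longrightarrow> fst v \<in> fst c \<Longrightarrow> fst v \<in> fst d \<Longrightarrow>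
        connection_rule c d (H c) (H d) v \<and> tensor_rule c d (V c) (V d) v"
begin

text \<open>
  At every point some chart of \<open>B\<close> is chosen; the transformation rules make the choice irrelevant.
\<close>

definition induced_connection :: "('m, real^'n) koszul" where
  "induced_connection = (\<lambda>X\<in>VFs. \<lambda>Z\<in>AFs. \<lambda>v\<in>A.
     let c = chart_at B (fst v) in coord_vec C c (fst v) (cov c (H c) (V c) (X v) Z))"

lemma B_chart: "v \<in> A \<Longrightarrow> \<exists>c\<in>B. c \<in> C \<and> fst v \<in> fst c"
  using A_base[of v] covers subset unfolding carrier_def by blast

lemma induced_connection:
  assumes X: "X \<in> VFs" and Z: "Z \<in> AFs" and v: "v \<in> A"
  shows "induced_connection X Z v \<in> tangent_space C (fst v)"
    and "c \<in> B \<Longrightarrow> fst v \<in> fst c \<Longrightarrow> snd (induced_connection X Z v) c = cov c (H c) (V c) (X v) Z"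
proof -
  define d where "d = chart_at B (fst v)"
  have d: "d \<in> B" "fst v \<in> fst d"
    using A_base[OF v] covers by (simp_all add: d_def chart_at_in in_chart_at)
  then have dC: "d \<in> C" using subset by blast
  have eq: "induced_connection X Z v = coord_vec C d (fst v) (cov d (H d) (V d) (X v) Z)"
    using X Z v by (simp add: induced_connection_def Let_def d_def)
  show "induced_connection X Z v \<in> tangent_space C (fst v)"
    unfolding eq by (rule C.coord_vec_in[OF dC d(2)])
  assume c: "c \<in> B" "fst v \<in> fst c"
  then have cC: "c \<in> C" using subset by blast
  have r: "connection_rule d c (H d) (H c) v" "tensor_rule d c (V d) (V c) v"
    using rules[OF d(1) c(1) v d(2) c(2)] by auto
  show "snd (induced_connection X Z v) c = cov c (H c) (V c) (X v) Z"
    unfolding eq C.coord_vec_apply[OF cC c(2)]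
    by (rule cov_change[OF field_in[OF X v] v section_germ_of_section[OF Z v] dC d(2) cC c(2) r, symmetric])
qed

lemma symbols_near:
  assumes v: "v \<in> A" and c: "c \<in> B" "fst v \<in> fst c"
  shows "smooth_near D v (H c a i j)" and "smooth_near D v (V c a i j)"
proof -
  have cC: "c \<in> C" using c subset by blast
  have "{v \<in> A. fst v \<in> fst c} = fst (dch c)" using cC by auto
  then have o: "openin (atlas_topology D) {v \<in> A. fst v \<in> fst c}" using openin_dom[OF cC] by simp
  have m: "v \<in> {v \<in> A. fst v \<in> fst c}" using v c by simp
  show "smooth_near D v (H c a i j)" by (rule D.smooth_nearI[OF o m smooth(1)[OF c(1)]])
  show "smooth_near D v (V c a i j)" by (rule D.smooth_nearI[OF o m smooth(2)[OF c(1)]])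
qed

lemma induced_connection_section:
  assumes X: "X \<in> VFs" and Z: "Z \<in> AFs"
  shows "induced_connection X Z \<in> AFs"
proof (rule AF.sectionI)
  show "induced_connection X Z \<in> extensional (carrier D)"
    using X Z by (simp add: induced_connection_def)
  fix v assume "v \<in> carrier D"
  then have v: "v \<in> A" by simp
  show "induced_connection X Z v \<in> tangent_space C (fst v)" by (rule induced_connection(1)[OF X Z v])
  obtain c where c: "c \<in> B" "c \<in> C" "fst v \<in> fst c" using B_chart[OF v] by blast
  have nZ: "smooth_near D v (\<lambda>u. snd (Z u) c)" by (rule section_component_near[OF Z v c(2,3)])
  have vd: "v \<in> fst (dch c)" using v c by simp
  have 1: "smooth_near D v (\<lambda>u. vdd D (X u) (\<lambda>u. snd (Z u) c))"
    by (rule D.smooth_near_vdd[OF dom_in[OF c(2)] vd nZ field_component_near[OF X v c(2,3)] D.openin_carrier])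
      (use v field_in[OF X] in auto)
  have 2: "smooth_near D v (\<lambda>u. bil (\<lambda>m i j. H c m i j u) (xcomp c (X u)) (snd (Z u) c))"
    by (rule smooth_near_bil[OF v symbols_near(1)[OF v c(1,3)] eta_near(1)[OF X v c(2,3)] nZ])
  have 3: "smooth_near D v (\<lambda>u. bil (\<lambda>m i j. V c m i j u) (eta c (X u)) (snd (Z u) c))"
    by (rule smooth_near_bil[OF v symbols_near(2)[OF v c(1,3)] eta_near(2)[OF X v c(2,3)] nZ])
  have "smooth_near D v (\<lambda>u. snd (induced_connection X Z u) c)"
  proof (rule D.smooth_near_cong[OF D.smooth_near_add[OF D.smooth_near_add[OF 1 2] 3] openin_dom[OF c(2)] vd])
    fix u assume "u \<in> fst (dch c)"
    then have u: "u \<in> A" "fst u \<in> fst c" using c by auto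
    show "vdd D (X u) (\<lambda>u. snd (Z u) c) + bil (\<lambda>m i j. H c m i j u) (xcomp c (X u)) (snd (Z u) c) +
        bil (\<lambda>m i j. V c m i j u) (eta c (X u)) (snd (Z u) c) = snd (induced_connection X Z u) c"
      unfolding induced_connection(2)[OF X Z u(1) c(1) u(2)] cov_def tangent_space_fst[OF field_in[OF X u(1)]] ..
  qed
  then show "\<exists>c\<in>C. fst v \<in> fst c \<and> smooth_near D v (\<lambda>u. snd (induced_connection X Z u) c)"
    using c by blast
qed

lemma linear_connection_induced: "linear_connection C A induced_connection"
  unfolding linear_connection_def vector_fields_eq anisotropic_fields_eq smooth_fun_on_eq_smf dir_deriv_eq_vdd
proof (intro conjI ballI allI impI)
  show "induced_connection \<in> VFs \<rightarrow>\<^sub>E AFs \<rightarrow>\<^sub>E AFs"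
  proof (rule PiE_I)
    fix X assume X: "X \<in> VFs"
    show "induced_connection X \<in> AFs \<rightarrow>\<^sub>E AFs"
      by (rule PiE_I[OF induced_connection_section[OF X]]) (use X in \<open>auto simp: induced_connection_def\<close>)
  qed (auto simp: induced_connection_def)
  fix X assume X: "X \<in> VFs"
  {
    fix Y Z v assume Y: "Y \<in> VFs" and Z: "Z \<in> AFs" and v: "v \<in> A"
    obtain c where c: "c \<in> B" "c \<in> C" "fst v \<in> fst c" using B_chart[OF v] by blast
    have XY: "(\<lambda>u\<in>A. tadd (X u) (Y u)) \<in> VFs" using VF.section_tadd[OF X Y] by simp
    note comp = induced_connection(2)[OF _ Z v c(1,3)]
    have "snd (induced_connection (\<lambda>u\<in>A. tadd (X u) (Y u)) Z v) c =
        snd (tadd (induced_connection X Z v) (induced_connection Y Z v)) c"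
      unfolding comp[OF XY] snd_tadd comp[OF X] comp[OF Y]
      using cov_tadd[OF field_in[OF X v] field_in[OF Y v] Z v c(2,3)] v by simp
    then show "induced_connection (\<lambda>u\<in>A. tadd (X u) (Y u)) Z v =
        tadd (induced_connection X Z v) (induced_connection Y Z v)"
      by (rule C.tangent_eqI[OF induced_connection(1)[OF XY Z v]
            C.tadd_in[OF induced_connection(1)[OF X Z v] induced_connection(1)[OF Y Z v]] c(2,3)])
  next
    fix f :: "_ \<Rightarrow> real" and Z v assume f: "smf D A f" and Z: "Z \<in> AFs" and v: "v \<in> A"
    obtain c where c: "c \<in> B" "c \<in> C" "fst v \<in> fst c" using B_chart[OF v] by blast
    have fX: "(\<lambda>u\<in>A. tscale (f u) (X u)) \<in> VFs" using VF.section_tscale[OF _ X, of f] f by simp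
    note comp = induced_connection(2)[OF _ Z v c(1,3)]
    have "snd (induced_connection (\<lambda>u\<in>A. tscale (f u) (X u)) Z v) c =
        snd (tscale (f v) (induced_connection X Z v)) c"
      unfolding comp[OF fX] snd_tscale comp[OF X]
      using cov_tscale[OF field_in[OF X v] Z v c(2,3)] v by simp
    then show "induced_connection (\<lambda>u\<in>A. tscale (f u) (X u)) Z v = tscale (f v) (induced_connection X Z v)"
      by (rule C.tangent_eqI[OF induced_connection(1)[OF fX Z v]
            C.tscale_in[OF induced_connection(1)[OF X Z v]] c(2,3)])
  next
    fix Y Z v assume Y: "Y \<in> AFs" and Z: "Z \<in> AFs" and v: "v \<in> A"
    obtain c where c: "c \<in> B" "c \<in> C" "fst v \<in> fst c" using B_chart[OF v] by blast
    have YZ: "(\<lambda>u\<in>A. tadd (Y u) (Z u)) \<in> AFs" using AF.section_tadd[OF Y Z] by simp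
    note comp = induced_connection(2)[OF X _ v c(1,3)]
    have "snd (induced_connection X (\<lambda>u\<in>A. tadd (Y u) (Z u)) v) c =
        snd (tadd (induced_connection X Y v) (induced_connection X Z v)) c"
      unfolding comp[OF YZ] snd_tadd comp[OF Y] comp[OF Z]
      by (rule cov_section_tadd[OF field_in[OF X v] Y Z v c(2,3)])
    then show "induced_connection X (\<lambda>u\<in>A. tadd (Y u) (Z u)) v =
        tadd (induced_connection X Y v) (induced_connection X Z v)"
      by (rule C.tangent_eqI[OF induced_connection(1)[OF X YZ v]
            C.tadd_in[OF induced_connection(1)[OF X Y v] induced_connection(1)[OF X Z v]] c(2,3)])
  next
    fix f :: "_ \<Rightarrow> real" and Z v assume f: "smf D A f" and Z: "Z \<in> AFs" and v: "v \<in> A"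
    obtain c where c: "c \<in> B" "c \<in> C" "fst v \<in> fst c" using B_chart[OF v] by blast
    have fZ: "(\<lambda>u\<in>A. tscale (f u) (Z u)) \<in> AFs" using AF.section_tscale[OF _ Z, of f] f by simp
    note comp = induced_connection(2)[OF X _ v c(1,3)]
    have "snd (induced_connection X (\<lambda>u\<in>A. tscale (f u) (Z u)) v) c =
        snd (tadd (tscale (vdd D (X v) f) (Z v)) (tscale (f v) (induced_connection X Z v))) c"
      unfolding comp[OF fZ] snd_tadd snd_tscale comp[OF Z]
      by (rule cov_leibniz[OF field_in[OF X v] f Z v c(2,3)])
    then show "induced_connection X (\<lambda>u\<in>A. tscale (f u) (Z u)) v =
        tadd (tscale (vdd D (X v) f) (Z v)) (tscale (f v) (induced_connection X Z v))"
      by (rule C.tangent_eqI[OF induced_connection(1)[OF X fZ v]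
            C.tadd_in[OF C.tscale_in[OF section_in[OF Z v]] C.tscale_in[OF induced_connection(1)[OF X Z v]]]
            c(2,3)])
  }
qed

lemma koszul_induced: "koszul C A induced_connection"
  by unfold_locales (rule linear_connection_induced)

lemma christoffel_induced:
  assumes v: "v \<in> A" and c: "c \<in> B" "fst v \<in> fst c"
  shows "christoffel_H C A HA induced_connection c a i j v = H c a i j v"
    and "christoffel_V C A induced_connection c a i j v = V c a i j v"
proof -
  interpret K: koszul C A induced_connection by (rule koszul_induced)
  have cC: "c \<in> C" using c subset by blast
  have form: "K.conn_form c w z = bil (\<lambda>m i j. H c m i j v) (xcomp c w) z + bil (\<lambda>m i j. V c m i j v) (eta c w) z"
    if w: "w \<in> tangent_space D v" for w z
  proof -
    let ?F = "\<lambda>u. coord_vec C c (fst u) z"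
    obtain X where X: "X \<in> VFs" "X v = w" by (rule extend_vector[OF w v]) blast
    obtain Z W where Z: "Z \<in> AFs" "openin (atlas_topology D) W" "v \<in> W" "\<forall>u\<in>W. Z u = ?F u"
      by (rule extend_section[OF frame_germ[OF v cC c(2)]]) blast
    have "K.conn_form c w z = snd (induced_connection X Z v) c"
      unfolding K.conn_form_def K.koszul_at_eq[OF v X Z] ..
    also have "\<dots> = cov c (H c) (V c) w Z"
      using induced_connection(2)[OF X(1) Z(1) v c] unfolding X(2) .
    also have "vdd D w (\<lambda>u. snd (Z u) c) = 0"
    proof -
      have o: "openin (atlas_topology D) (W \<inter> fst (dch c))" using Z(2) openin_dom[OF cC] by blast
      have "vdd D w (\<lambda>u. snd (Z u) c) = vdd D w (\<lambda>u. z)"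
        by (rule D.vdd_cong[OF w o]) (use Z(3,4) v c cC in auto)
      then show ?thesis using D.vdd_const[OF w] v by simp
    qed
    moreover have "snd (Z v) c = z" using Z(3,4) cC c(2) by simp
    ultimately show ?thesis using tangent_space_fst[OF w] by (simp add: cov_def)
  qed
  show "christoffel_H C A HA induced_connection c a i j v = H c a i j v"
    using form[OF delta_vec(1)[OF v cC c(2)], of i "axis j 1"] delta_vec(2,3)[OF v cC c(2), of i]
    by (simp add: christoffel_H_def K.conn_form_def coord_field_def[abs_def] bil_axis bilinear_lzero[OF bilinear_bil])
  show "christoffel_V C A induced_connection c a i j v = V c a i j v"
    using form[OF dy_vec(1)[OF v cC c(2)], of i "axis j 1"] dy_vec(2,3)[OF v cC c(2), of i]
    by (simp add: christoffel_V_def K.conn_form_def coord_field_def[abs_def] bil_axis bilinear_lzero[OF bilinear_bil])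
qed

text \<open>
  The coordinate formula expresses a connection through its Christoffel symbols in charts that cover \<open>M\<close>.
\<close>

lemma connection_unique:
  assumes lc: "linear_connection C A nabla"
    and chr: "\<And>c a i j v. c \<in> B \<Longrightarrow> v \<in> A \<Longrightarrow> fst v \<in> fst c \<Longrightarrow>
      christoffel_H C A HA nabla c a i j v = H c a i j v \<and> christoffel_V C A nabla c a i j v = V c a i j v"
  shows "nabla = induced_connection"
proof -
  interpret K: koszul_nonlinear C A nabla HA
    by unfold_locales (rule lc)
  have eq: "nabla X Z v = induced_connection X Z v" if X: "X \<in> VFs" and Z: "Z \<in> AFs" and v: "v \<in> A" for X Z v
  proof -
    obtain c where c: "c \<in> B" "c \<in> C" "fst v \<in> fst c" using B_chart[OF v] by blast
    have fX: "fst (X v) = v" by (rule tangent_space_fst[OF field_in[OF X v]])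
    have "snd (nabla X Z v) c = cov c (christoffel_H C A HA nabla c) (christoffel_V C A nabla c) (X v) Z"
      using K.koszul_at_cov[OF field_in[OF X v] v c(2,3) section_germ_of_section[OF Z v]]
      unfolding K.koszul_at_field[OF X Z v] .
    also have "\<dots> = cov c (H c) (V c) (X v) Z"
      using chr[OF c(1) v c(3)] by (simp add: cov_def fX)
    also have "\<dots> = snd (induced_connection X Z v) c"
      by (rule induced_connection(2)[OF X Z v c(1,3), symmetric])
    finally show ?thesis
      by (rule C.tangent_eqI[OF K.nabla_tangent[OF X Z v] induced_connection(1)[OF X Z v] c(2,3)])
  qed
  have ext: "n \<in> VFs \<rightarrow>\<^sub>E AFs \<rightarrow>\<^sub>E AFs" if "linear_connection C A n" for n
    using that unfolding linear_connection_def vector_fields_eq anisotropic_fields_eq by (rule conjunct1)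
  show ?thesis
  proof (rule PiE_ext[OF ext[OF lc] ext[OF linear_connection_induced]])
    fix X assume X: "X \<in> VFs"
    show "nabla X = induced_connection X"
    proof (rule PiE_ext[OF PiE_mem[OF ext[OF lc] X] PiE_mem[OF ext[OF linear_connection_induced] X]])
      fix Z assume Z: "Z \<in> AFs"
      have "induced_connection X Z \<in> extensional A" "nabla X Z \<in> extensional A"
        using AF.section_extensional[OF induced_connection_section[OF X Z]]
          AF.section_extensional[OF K.nabla_in[OF X Z]] by simp_all
      then show "nabla X Z = induced_connection X Z"
        using eq[OF X Z] by (intro extensionalityI[of _ A]) auto
    qed
  qed
qed

end

section \<open>The correspondence between linear connections and Christoffel symbols\<close>

theorem proposition2:
  fixes C :: "('m, real^'n) chart set"
    and A :: "('m, real^'n) tvec set"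
    and HA :: "('m, real^'n) tvec \<Rightarrow> ('m, real^'n) ttvec set"
  assumes M: "smooth_manifold C"
    and A: "conic_domain C A"
    and HA: "homogeneous_nonlinear_connection C A HA"
  shows
    "(\<forall>nabla. linear_connection C A nabla \<longrightarrow>
        (\<forall>c\<in>C. \<forall>d\<in>C. \<forall>v\<in>A. fst v \<in> fst c \<inter> fst d \<longrightarrow>
           connection_rule c d (christoffel_H C A HA nabla c) (christoffel_H C A HA nabla d) v \<and>
           tensor_rule c d (christoffel_V C A nabla c) (christoffel_V C A nabla d) v) \<and>
        (\<forall>c\<in>C. \<forall>d\<in>C. fst c = fst d \<longrightarrow>
           (\<forall>a i j. \<forall>v\<in>A. fst v \<in> fst c \<longrightarrow> christoffel_V C A nabla c a i j v = 0) \<longrightarrow>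
           (\<forall>a i j. \<forall>v\<in>A. fst v \<in> fst d \<longrightarrow> christoffel_V C A nabla d a i j v = 0)) \<and>
        (homothety_invariant C A nabla \<longrightarrow>
           (\<forall>c\<in>C. \<forall>a i j. \<forall>v\<in>A. fst v \<in> fst c \<longrightarrow> (\<forall>l>0.
              christoffel_H C A HA nabla c a i j (tscale l v) = christoffel_H C A HA nabla c a i j v \<and>
              christoffel_V C A nabla c a i j (tscale l v) = inverse l * christoffel_V C A nabla c a i j v))))
     \<and>
     (\<forall>B (H :: ('m, real^'n) chart \<Rightarrow> ('m, 'n) symbols) (V :: ('m, real^'n) chart \<Rightarrow> ('m, 'n) symbols).
        B \<subseteq> C \<and> carrier B = carrier C \<and>
        (\<forall>c\<in>B. \<forall>a i j.
           smooth_fun_on (domain_atlas C A) {v \<in> A. fst v \<in> fst c} (H c a i j) \<and>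
           smooth_fun_on (domain_atlas C A) {v \<in> A. fst v \<in> fst c} (V c a i j)) \<and>
        (\<forall>c\<in>B. \<forall>d\<in>B. \<forall>v\<in>A. fst v \<in> fst c \<inter> fst d \<longrightarrow>
           connection_rule c d (H c) (H d) v \<and> tensor_rule c d (V c) (V d) v)
        \<longrightarrow>
        (\<exists>!nabla. linear_connection C A nabla \<and>
           (\<forall>c\<in>B. \<forall>a i j. \<forall>v\<in>A. fst v \<in> fst c \<longrightarrow>
              christoffel_H C A HA nabla c a i j v = H c a i j v \<and>
              christoffel_V C A nabla c a i j v = V c a i j v)) \<and>
        ((\<forall>c\<in>B. \<forall>a i j. \<forall>v\<in>A. fst v \<in> fst c \<longrightarrow> (\<forall>l>0.
              H c a i j (tscale l v) = H c a i j v \<and>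
              V c a i j (tscale l v) = inverse l * V c a i j v)) \<longrightarrow>
         (\<forall>nabla. linear_connection C A nabla \<and>
           (\<forall>c\<in>B. \<forall>a i j. \<forall>v\<in>A. fst v \<in> fst c \<longrightarrow>
              christoffel_H C A HA nabla c a i j v = H c a i j v \<and>
              christoffel_V C A nabla c a i j v = V c a i j v) \<longrightarrow>
           homothety_invariant C A nabla)))"
  (is "(\<forall>nabla. linear_connection C A nabla \<longrightarrow> ?rules nabla \<and> ?zero nabla \<and> ?hom nabla) \<and>
    (\<forall>B H V. ?data B H V \<longrightarrow> (\<exists>!nabla. linear_connection C A nabla \<and> ?has B H V nabla) \<and>
      (?homdata B H V \<longrightarrow> (\<forall>nabla. linear_connection C A nabla \<and> ?has B H V nabla \<longrightarrow> ?inv nabla)))")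
proof -
  interpret nonlinear C A HA
    using M A HA by unfold_locales (auto simp: smooth_manifold_def conic_domain_def)
  have loc: "koszul_nonlinear C A nabla HA" if "linear_connection C A nabla" for nabla
    by unfold_locales (rule that)
  show ?thesis
  proof (rule conjI; intro allI impI)
    fix nabla assume lc: "linear_connection C A nabla"
    interpret K: koszul_nonlinear C A nabla HA by (rule loc[OF lc])
    show "?rules nabla \<and> ?zero nabla \<and> ?hom nabla"
    proof (intro conjI)
      show "?rules nabla" using K.christoffel_rules by blast
      show "?zero nabla"
      proof (intro ballI allI impI)
        fix c d a i j v
        assume c: "c \<in> C" "d \<in> C" "fst c = fst d" and v: "v \<in> A" "fst v \<in> fst d"
          and zero: "\<forall>a i j. \<forall>v\<in>A. fst v \<in> fst c \<longrightarrow> christoffel_V C A nabla c a i j v = 0"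
        have "tensor_rule c d (christoffel_V C A nabla c) (christoffel_V C A nabla d) v"
          using K.christoffel_rules(2) c v by simp
        then show "christoffel_V C A nabla d a i j v = 0"
          using zero c(3) v unfolding tensor_rule_def by simp
      qed
      show "?hom nabla"
        using K.homothety_invariant_imp K.homogeneous_form_iff by blast
    qed
  next
    fix B and H V :: "('m, real^'n) chart \<Rightarrow> ('m, 'n) symbols"
    assume data: "?data B H V"
    interpret S: christoffel_data C A HA B H V
      by unfold_locales (use data in \<open>auto simp: smooth_fun_on_eq_smf\<close>)
    show "(\<exists>!nabla. linear_connection C A nabla \<and> ?has B H V nabla) \<and>
      (?homdata B H V \<longrightarrow>
        (\<forall>nabla. linear_connection C A nabla \<and> ?has B H V nabla \<longrightarrow> homothety_invariant C A nabla))"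
    proof (intro conjI impI allI)
      show "\<exists>!nabla. linear_connection C A nabla \<and> ?has B H V nabla"
      proof (rule ex1I[of _ S.induced_connection])
        show "linear_connection C A S.induced_connection \<and> ?has B H V S.induced_connection"
          using S.linear_connection_induced S.christoffel_induced by blast
        fix nabla assume "linear_connection C A nabla \<and> ?has B H V nabla"
        then show "nabla = S.induced_connection" by (intro S.connection_unique) simp_all
      qed
    next
      fix nabla
      assume hom: "?homdata B H V" and nabla: "linear_connection C A nabla \<and> ?has B H V nabla"
      interpret K: koszul_nonlinear C A nabla HA by (rule loc[OF conjunct1[OF nabla]])
      note chr = conjunct2[OF nabla, rule_format]
      show "homothety_invariant C A nabla"
      proof (rule K.homothety_invariantI)
        fix l v assume l: "(l::real) > 0" and v: "v \<in> A"
        obtain c where c: "c \<in> B" "c \<in> C" "fst v \<in> fst c" using S.B_chart[OF v] by blast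
        have lv: "tscale l v \<in> A" "fst (tscale l v) \<in> fst c" using scaleA[OF v l] c by auto
        have "K.homogeneous_form c v l"
          unfolding K.homogeneous_form_iff[OF l v c(2,3)]
          using chr[OF c(1) v c(3)] chr[OF c(1) lv] hom[rule_format, OF c(1) v c(3) l] by simp
        then show "\<exists>c\<in>C. fst v \<in> fst c \<and> K.homogeneous_form c v l" using c by blast
      qed
    qed
  qed
qed

end
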